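(* Let $n\in\mathbb{N}$ and define $h_n$ by $h_n(x)=(-1)^{n+1}x^{2n}\log(x^2)$. (i) There exists a unique extremal minorant $l_n$ of exponential type $2\pi$ for $h_n$. The function $l_n$ interpolates the values of $h_n$ at $\mathbb{Z}+\frac12$ and satisfies $$\int_{-\infty}^\infty\{h_n(x)-l_n(x)\}\,dx=\bigl(2-2^{1-2n}\bigr)(2n)!\,(2\pi)^{-2n}\zeta(2n+1).$$ (ii) If $n>0$, there exists a unique extremal majorant $m_n$ of exponential type $2\pi$ for $h_n$. The function $m_n$ interpolates the values of $h_n$ at $\mathbb{Z}$ and satisfies $$\int_{-\infty}^\infty\{m_n(x)-h_n(x)\}\,dx=2\,(2n)!\,(2\pi)^{-2n}\zeta(2n+1).$$ (iii) There exists a unique best approximation $k_n$ of exponential type $\pi$ for $h_n$. The function $k_n$ interpolates the values of $h_n$ at $\mathbb{Z}+\frac12$, satisfying $$\mathrm{sgn}(\cos\pi x)\{h_n(x)-k_n(x)\}\ge0$$ and $$\int_{-\infty}^\infty|h_n(x)-k_n(x)|\,dx=\frac{2}{\pi}\,(2n)!\,(2\pi)^{-2n}L(\chi,2+2n).$$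
   Context: Here $\mathbb{N}$ includes $0$; for $n=0$ the product $(2-2^{1-2n})\zeta(2n+1)$ in (i) is read as its limiting value $2\log 2$. $\zeta$ is the Riemann zeta-function; $\chi$ is the unique nonprincipal Dirichlet character modulo $4$, and $L(\chi,s)=\sum_{j=0}^\infty(-1)^j(2j+1)^{-s}$ for $\Re s>1$ is its Dirichlet $L$-function. For $n\ge1$, $h_n(0)=0$ by continuity; for $n=0$, $h_0(0)=+\infty$. An entire function $F$ is of exponential type (at most) $2\pi\delta$ if for every $\epsilon>0$ there is $C>0$ with $|F(z)|\le Ce^{(2\pi\delta+\epsilon)|z|}$ for all $z\in\mathbb{C}$. An extremal minorant (resp. majorant) of exponential type $2\pi$ for $g$ is an entire function $F$ of exponential type at most $2\pi$, real valued on $\mathbb{R}$, with $F(x)\le g(x)$ (resp. $F(x)\ge g(x)$) for all real $x$, minimizing $\int_{-\infty}^\infty|F(x)-g(x)|\,dx$ among all such functions. A best approximation of exponential type $\pi$ for $g$ is an entire function $F$ of exponential type at most $\pi$ minimizing $\int_{-\infty}^\infty|F(x)-g(x)|\,dx$ among all such functions.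
   Formalization: In (iii) the value of the integral is corrected to (2/π)(2n)!(2π)^{-2n}·2^{2+2n}L(χ,2+2n); the printed value lacks the factor 2^{2+2n} and is false for every n (for n=0 the integral is (8/π)L(χ,2), not (2/π)L(χ,2)). *)

theory Defs
  imports "HOL-Analysis.Analysis"
begin

text \<open>
  Values in \<open>ereal\<close>, because \<open>h 0\<close> equals \<open>\<infinity>\<close> at the origin. The case split is
  needed: the library has \<open>ln 0 = 0\<close>, which would give \<open>h 0 0 = 0\<close> and impose a
  spurious condition on minorants at the origin.
\<close>

definition h :: "nat \<Rightarrow> real \<Rightarrow> ereal" where
  "h n x = (if x = 0 then (if n = 0 then \<infinity> else 0)
            else ereal ((- 1) ^ (n + 1) * x ^ (2 * n) * ln (x\<^sup>2)))"

definition entire_exp_type :: "real \<Rightarrow> (complex \<Rightarrow> complex) \<Rightarrow> bool" where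
  "entire_exp_type \<tau> F \<longleftrightarrow>
     F holomorphic_on UNIV \<and>
     (\<forall>\<epsilon>>0. \<exists>C>0. \<forall>z. norm (F z) \<le> C * exp ((\<tau> + \<epsilon>) * norm z))"

definition l1_dist :: "(complex \<Rightarrow> complex) \<Rightarrow> (real \<Rightarrow> ereal) \<Rightarrow> ennreal" where
  "l1_dist F g =
     (\<integral>\<^sup>+ x. (if \<bar>g x\<bar> = \<infinity> then \<infinity>
              else ennreal (norm (F (of_real x) - of_real (real_of_ereal (g x))))) \<partial>lborel)"

definition minorant :: "real \<Rightarrow> (real \<Rightarrow> ereal) \<Rightarrow> (complex \<Rightarrow> complex) \<Rightarrow> bool" where
  "minorant \<tau> g F \<longleftrightarrow>
     entire_exp_type \<tau> F \<and>
     (\<forall>x::real. F (of_real x) \<in> \<real> \<and> ereal (Re (F (of_real x))) \<le> g x)"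

definition majorant :: "real \<Rightarrow> (real \<Rightarrow> ereal) \<Rightarrow> (complex \<Rightarrow> complex) \<Rightarrow> bool" where
  "majorant \<tau> g F \<longleftrightarrow>
     entire_exp_type \<tau> F \<and>
     (\<forall>x::real. F (of_real x) \<in> \<real> \<and> g x \<le> ereal (Re (F (of_real x))))"

definition extremal_minorant :: "real \<Rightarrow> (real \<Rightarrow> ereal) \<Rightarrow> (complex \<Rightarrow> complex) \<Rightarrow> bool" where
  "extremal_minorant \<tau> g F \<longleftrightarrow>
     minorant \<tau> g F \<and> (\<forall>G. minorant \<tau> g G \<longrightarrow> l1_dist F g \<le> l1_dist G g)"

definition extremal_majorant :: "real \<Rightarrow> (real \<Rightarrow> ereal) \<Rightarrow> (complex \<Rightarrow> complex) \<Rightarrow> bool" where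
  "extremal_majorant \<tau> g F \<longleftrightarrow>
     majorant \<tau> g F \<and> (\<forall>G. majorant \<tau> g G \<longrightarrow> l1_dist F g \<le> l1_dist G g)"

definition best_approximation :: "real \<Rightarrow> (real \<Rightarrow> ereal) \<Rightarrow> (complex \<Rightarrow> complex) \<Rightarrow> bool" where
  "best_approximation \<tau> g F \<longleftrightarrow>
     entire_exp_type \<tau> F \<and> (\<forall>G. entire_exp_type \<tau> G \<longrightarrow> l1_dist F g \<le> l1_dist G g)"

definition interpolates_at :: "(complex \<Rightarrow> complex) \<Rightarrow> (real \<Rightarrow> ereal) \<Rightarrow> real set \<Rightarrow> bool" where
  "interpolates_at F g S \<longleftrightarrow>
     (\<forall>x\<in>S. F (of_real x) \<in> \<real> \<and> ereal (Re (F (of_real x))) = g x)"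

definition half_integers :: "real set" where
  "half_integers = (\<lambda>m. of_int m + 1 / 2) ` UNIV"

text \<open>
  The Riemann zeta-function and the L-function of the nonprincipal character modulo 4,
  by their Dirichlet series; meaningful for \<open>s > 1\<close>.
\<close>

definition riemann_zeta :: "real \<Rightarrow> real" where
  "riemann_zeta s = (\<Sum>j. real (j + 1) powr (- s))"

definition L_chi :: "real \<Rightarrow> real" where
  "L_chi s = (\<Sum>j. (- 1) ^ j * real (2 * j + 1) powr (- s))"

text \<open>
  The product \<open>(2 - 2\<^sup>1\<^sup>-\<^sup>2\<^sup>n) \<zeta>(2n+1)\<close>, read as its limit as \<open>n\<close> tends to 0
  when \<open>n = 0\<close>.
\<close>

definition zeta_factor :: "nat \<Rightarrow> real" where
  "zeta_factor n =
     (if n = 0 then 2 * ln 2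
      else (2 - 2 powi (1 - 2 * int n)) * riemann_zeta (2 * real n + 1))"

text \<open>
  The value of the minimal distance in the best approximation problem of exponential type
  \<open>\<pi>\<close> was published as \<open>(2/\<pi>) (2n)! (2\<pi>)\<^sup>-\<^sup>2\<^sup>n L(\<chi>, 2+2n)\<close>, which lacks a factor
  \<open>2\<^sup>2\<^sup>+\<^sup>2\<^sup>n\<close>; the theorem states the corrected value. Off the origin \<open>h n\<close> has Fourier
  transform \<open>(2n)! (2\<pi>)\<^sup>-\<^sup>2\<^sup>n |t|\<^sup>-\<^sup>2\<^sup>n\<^sup>-\<^sup>1\<close>, and \<open>sgn (cos (\<pi> x))\<close> is the sum of
  \<open>(4/\<pi>) (-1)\<^sup>j (2j+1)\<^sup>-\<^sup>1 cos (2\<pi> (j + 1/2) x)\<close> over \<open>j \<ge> 0\<close>, so the distance is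
  \<open>(2/\<pi>) (2n)! (2\<pi>)\<^sup>-\<^sup>2\<^sup>n\<close> times the sum of \<open>(-1)\<^sup>j (j + 1/2)\<^sup>-\<^sup>2\<^sup>-\<^sup>2\<^sup>n\<close>, and that sum is
  \<open>2\<^sup>2\<^sup>+\<^sup>2\<^sup>n L(\<chi>, 2+2n)\<close>.
\<close>

end

theory Submission
  imports Defs "HOL-Complex_Analysis.Complex_Analysis" "HOL-Real_Asymp.Real_Asymp"
    "HOL-Probability.Sinc_Integral"
begin

text \<open>
Put \<open>H(x) = (-1)\<^sup>n\<^sup>+\<^sup>1 x\<^sup>2\<^sup>n log x\<^sup>2\<close> for \<open>x \<noteq> 0\<close>. The three extremal functions come
from one construction. Let \<open>\<Phi>(z) = cos (c z) + b\<close> with \<open>(c, b) = (2\<pi>, 1)\<close> for the minorant,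
\<open>(2\<pi>, -1)\<close> for the majorant and \<open>(\<pi>, 0)\<close> for the best approximation; the zeros of \<open>\<Phi>\<close> are the
points of interpolation, with the multiplicity that the problem asks for. In the right half-plane
\<open>2 (-1)\<^sup>n\<^sup>+\<^sup>1 z\<^sup>2\<^sup>n log z\<close> is an analytic continuation of \<open>H\<close>; the even extension of the quotient
of this function by \<open>\<Phi>\<close> jumps across the imaginary axis only, and recovering a function from such
a jump by Cauchy's formula suggests

\<open>E(x) = H(x) - \<Phi>(x) J(x)\<close>, where
\<open>J(x) = \<integral>\<^sub>0\<^sup>\<infinity> 2 y\<^sup>2\<^sup>n\<^sup>+\<^sup>1 / ((x\<^sup>2 + y\<^sup>2) (cosh (c y) + b)) dy\<close>.

As \<open>J\<close> is nonnegative, the sign of \<open>H - E\<close> is that of \<open>\<Phi>\<close>. The formula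
for \<open>E\<close> makes sense for real \<open>x \<noteq> 0\<close> only, but it extends to an entire function since
\<open>cosh (c y) + b = \<Phi>(iy)\<close>: replacing \<open>\<Phi>(x)\<close> by \<open>\<Phi>(x) - \<Phi>(iy)\<close> for \<open>y \<le> R\<close> cancels the poles of
the kernel, and the correction \<open>\<integral>\<^sub>0\<^sup>R 2 y\<^sup>2\<^sup>n\<^sup>+\<^sup>1 / (x\<^sup>2 + y\<^sup>2) dy\<close> is elementary and carries exactly the
logarithm of \<open>H\<close> (\<open>local_extension\<close>, \<open>interpolant_exists\<close>).

The distances follow by Tonelli's theorem from the integrals of \<open>cos (c x) + b\<close> and
\<open>\<bar>cos (\<pi> x)\<bar>\<close> against \<open>1 / (x\<^sup>2 + y\<^sup>2)\<close>. Both come from Poisson integrals of bounded holomorphic functions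
in the upper half-plane (\<open>Poisson_integral_half_plane\<close>); the remaining integrals over \<open>y\<close> are
those of Bose, of Fermi and of \<open>arctan (exp (-\<pi> y))\<close>, which expand into the Dirichlet series.

Optimality rests on one quadrature formula (\<open>Poisson_summation_type_2pi\<close>): an integrable function
\<open>F\<close> of type \<open>2\<pi>\<close> satisfies \<open>\<integral> F = \<Sum>\<^sub>k F(x + k)\<close>. If \<open>G\<close> is a competitor at finite distance, then
\<open>D = E - G\<close> is integrable, and for a minorant \<open>D \<ge> 0\<close> at the half-integers, so that
\<open>\<integral> (H - G) - \<integral> (H - E) = \<integral> D \<ge> 0\<close>; majorants are dual. For the best approximation the formula,
at the scale of period \<open>2\<close>, shows that \<open>sgn (cos (\<pi> x))\<close> annihilates integrable functions of type
\<open>\<pi>\<close> (\<open>sgn_cos_orthogonal\<close>), whence \<open>\<integral> \<bar>H - E\<bar> = \<integral> sgn (cos (\<pi> x)) (H - G) \<le> \<integral> \<bar>H - G\<bar>\<close>. In the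
case of equality \<open>D\<close> (respectively \<open>D\<^sup>2\<close>) has double zeros at a translate of the integers, hence
vanishes by Liouville's theorem (\<open>double_zeros_at_integers_imp_zero\<close>).

The quadrature formula is a matter of growth alone. A Phragmen-Lindelof argument gives the
Plancherel-Polya inequality \<open>\<integral> \<bar>F(x + iy)\<bar> dx \<le> exp (\<tau> \<bar>y\<bar>) \<integral> \<bar>F(x)\<bar> dx\<close>, so that the
periodization of \<open>F\<close> is an entire function \<open>q(exp (2\<pi>iz))\<close> with \<open>q\<close> holomorphic off the origin.
For type less than \<open>2\<pi>\<close> the growth of \<open>q\<close> at \<open>0\<close> and at infinity forces it to be constant; type
\<open>2\<pi>\<close> follows by dilation.
\<close>

section \<open>Phragmen-Lindelof bounds for functions of exponential type\<close>

lemma le_limit_at_right_0: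
  fixes f :: "real \<Rightarrow> real"
  assumes "\<And>\<delta>. \<delta> > 0 \<Longrightarrow> a \<le> f \<delta>" and "(f \<longlongrightarrow> L) (at_right 0)"
  shows "a \<le> L"
  using assms(2) by (rule tendsto_lowerbound) (auto intro!: assms(1) eventually_at_right_less
      eventually_mono[OF eventually_at_right_less])

lemma frontier_subset_sublevel:
  fixes S U :: "'a::topological_space set"
  assumes "closed S" "open U" "U \<subseteq> S"
  shows "frontier S \<subseteq> S - U"
  using assms interior_maximal[of U S] by (auto simp: frontier_def)

text \<open>
The exponent 3/2 lies strictly between 1, the order of the functions considered below, and 2, the
order allowed in a right angle: on the sector the argument of \<open>w\<^sup>3\<^sup>/\<^sup>2\<close> stays within
\<open>3\<pi>/8 < \<pi>/2\<close>, so \<open>exp (-\<delta> w\<^sup>3\<^sup>/\<^sup>2)\<close> decays faster than any \<open>exp (A \<bar>w\<bar>)\<close> grows.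
\<close>

lemma Re_powr_three_halves_ge:
  assumes "\<bar>Im w\<bar> \<le> Re w" "w \<noteq> 0"
  shows "Re (exp (3 / 2 * Ln w)) \<ge> cos (3 * pi / 8) * norm w powr (3 / 2)"
proof -
  have Re: "Re w > 0" using assms by (cases "Re w = 0") (auto simp: complex_eq_iff)
  have arg: "Im (Ln w) = arctan (Im w / Re w)"
    using Re by (simp add: Arg_eq_Im_Ln[symmetric] assms arg_conv_arctan)
  have le1: "Im w / Re w \<le> 1" "- 1 \<le> Im w / Re w" using assms Re by (simp_all add: field_simps)
  have "arctan (Im w / Re w) \<le> pi / 4" "arctan (Im w / Re w) \<ge> - (pi / 4)"
    using le1 arctan_le_iff[of _ 1] arctan_le_iff[of "-1"] by (auto simp: arctan_one arctan_minus)
  hence ab: "\<bar>Im (Ln w)\<bar> \<le> pi / 4" using arg by linarith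
  have "cos (3 * pi / 8) \<le> cos \<bar>3 / 2 * Im (Ln w)\<bar>"
    using ab by (intro cos_monotone_0_pi_le) (auto simp: abs_mult)
  hence c: "cos (3 * pi / 8) \<le> cos (3 / 2 * Im (Ln w))" by (simp only: cos_abs_real)
  have "Re (exp (3 / 2 * Ln w)) = exp (3 / 2 * ln (norm w)) * cos (3 / 2 * Im (Ln w))"
    using assms by (simp add: Re_exp)
  also have "\<dots> \<ge> exp (3 / 2 * ln (norm w)) * cos (3 * pi / 8)"
    by (intro mult_left_mono c) auto
  finally show ?thesis using assms by (simp add: powr_def mult.commute)
qed

text \<open>
Damp \<open>f\<close> by \<open>exp (-\<delta> (1 + w)\<^sup>3\<^sup>/\<^sup>2)\<close>, apply the maximum principle on a large circular sector and let
\<open>\<delta>\<close> tend to 0. The shift by 1 keeps the branch point out of the closed sector.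
\<close>

lemma quarter_plane_Phragmen_Lindelof:
  fixes f :: "complex \<Rightarrow> complex"
  assumes hol: "f holomorphic_on UNIV"
    and growth: "\<And>w. norm (f w) \<le> C * exp (A * norm w)"
    and bdry: "\<And>w. \<bar>Im w\<bar> = Re w \<Longrightarrow> norm (f w) \<le> M"
    and w0: "\<bar>Im w0\<bar> \<le> Re w0"
  shows "norm (f w0) \<le> M"
proof -
  define \<kappa> where "\<kappa> = cos (3 * pi / 8)"
  have \<kappa>: "\<kappa> > 0" unfolding \<kappa>_def by (rule cos_gt_zero) (use pi_gt_zero in linarith)+
  have M0: "M \<ge> 0" using bdry[of 0] norm_ge_zero[of "f 0"] by (simp del: norm_ge_zero)
  have C0: "C \<ge> 0" using growth[of 0] norm_ge_zero[of "f 0"] by (simp del: norm_ge_zero)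
  define E where "E = (\<lambda>w. exp (3 / 2 * Ln (1 + w)))"
  have E_ge: "Re (E w) \<ge> \<kappa> * norm (1 + w) powr (3 / 2)" if "\<bar>Im w\<bar> \<le> Re w" for w
  proof -
    have "1 + w \<noteq> 0" using that by (auto simp: complex_eq_iff)
    then show ?thesis unfolding E_def \<kappa>_def using that by (intro Re_powr_three_halves_ge) auto
  qed
  have bound: "norm (f w0) \<le> M * exp (\<delta> * Re (E w0))" if \<delta>: "\<delta> > 0" for \<delta>
  proof -
    define g where "g = (\<lambda>w. f w * exp (- of_real \<delta> * E w))"
    have ng: "norm (g w) = norm (f w) * exp (- \<delta> * Re (E w))" for w
      by (simp add: g_def norm_mult)
    have Epos: "Re (E w) \<ge> 0" if "\<bar>Im w\<bar> \<le> Re w" for w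
      using E_ge[OF that] \<kappa> by (meson order_trans mult_nonneg_nonneg less_imp_le powr_ge_zero)
    have lim: "((\<lambda>r. C * exp (A * r - \<delta> * \<kappa> * r powr (3 / 2))) \<longlongrightarrow> C * 0) at_top"
    proof (intro tendsto_mult tendsto_const)
      show "((\<lambda>r. exp (A * r - \<delta> * \<kappa> * r powr (3 / 2))) \<longlongrightarrow> 0) at_top"
      proof -
        define d where "d = \<delta> * \<kappa>"
        have "d > 0" using \<delta> \<kappa> by (simp add: d_def)
        then show ?thesis unfolding d_def[symmetric] by real_asymp
      qed
    qed
    have key: "norm (g w0) \<le> M + e" if "e > 0" for e
    proof -
      have "\<forall>\<^sub>F r in at_top. C * exp (A * r - \<delta> * \<kappa> * r powr (3 / 2)) < e"
        using lim that by (intro order_tendstoD(2)[OF lim]) auto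
      then obtain R0 where R0: "\<And>r. r \<ge> R0 \<Longrightarrow> C * exp (A * r - \<delta> * \<kappa> * r powr (3 / 2)) < e"
        by (auto simp: eventually_at_top_linorder)
      define R where "R = max (max R0 (norm w0)) 1"
      define S where "S = {w. \<bar>Im w\<bar> \<le> Re w} \<inter> cball 0 R"
      define U where "U = {w. \<bar>Im w\<bar> < Re w} \<inter> ball 0 R"
      have clS: "closed S" unfolding S_def
        by (intro closed_Int closed_cball closed_Collect_le continuous_intros)
      have opU: "open U" unfolding U_def
        by (intro open_Int open_ball open_Collect_less continuous_intros)
      have holg: "g holomorphic_on {w. Re w > -1}"
        unfolding g_def E_def
        by (intro holomorphic_intros holomorphic_on_subset[OF hol])
           (auto simp: complex_nonpos_Reals_iff)
      have sub: "S \<subseteq> {w. Re w > -1}" unfolding S_def by auto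
      show ?thesis
      proof (rule maximum_modulus_frontier[of g S])
        show "g holomorphic_on interior S"
          using holg sub interior_subset by (blast intro: holomorphic_on_subset)
        show "continuous_on (closure S) g"
          using continuous_on_subset[OF holomorphic_on_imp_continuous_on[OF holg] sub] clS by simp
        show "bounded S" unfolding S_def by (simp add: bounded_Int)
        show "w0 \<in> S" using w0 unfolding S_def R_def by auto
        fix z assume "z \<in> frontier S"
        hence z: "z \<in> S" "z \<notin> U"
          using frontier_subset_sublevel[OF clS opU] unfolding S_def U_def by force+
        hence zS: "\<bar>Im z\<bar> \<le> Re z" "norm z \<le> R" by (auto simp: S_def)
        show "norm (g z) \<le> M + e"
        proof (cases "\<bar>Im z\<bar> = Re z")
          case True
          have "norm (g z) \<le> norm (f z) * 1"
            unfolding ng using \<delta> Epos[OF zS(1)] by (intro mult_left_mono) auto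
          also have "\<dots> \<le> M" using bdry[OF True] by simp
          finally show ?thesis using that by simp
        next
          case False
          hence nz: "norm z = R" using z zS by (auto simp: U_def)
          have Rz: "R \<le> norm (1 + z)"
            using zS(1) nz R_def
            by (smt (verit, best) cmod_power2 complex_Re_le_cmod one_complex.simps plus_complex.simps power2_le_imp_le norm_ge_zero power_mono abs_ge_zero)
          have "norm (g z) \<le> (C * exp (A * R)) * exp (- \<delta> * (\<kappa> * R powr (3/2)))"
            unfolding ng
          proof (intro mult_mono)
            show "norm (f z) \<le> C * exp (A * R)" using growth[of z] nz by simp
            have "R powr (3/2) \<le> norm (1 + z) powr (3/2)" using Rz by (intro powr_mono2) (auto simp: R_def)
            hence "\<kappa> * R powr (3/2) \<le> Re (E z)" using E_ge[OF zS(1)] \<kappa>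
              by (smt (verit) mult_le_cancel_left_pos)
            then show "exp (- \<delta> * Re (E z)) \<le> exp (- \<delta> * (\<kappa> * R powr (3/2)))" using \<delta> by simp
          qed (use C0 in auto)
          also have "\<dots> = C * exp (A * R - \<delta> * \<kappa> * R powr (3 / 2))"
            unfolding mult.assoc exp_add[symmetric] by (simp add: algebra_simps)
          also have "\<dots> < e" by (rule R0) (auto simp: R_def)
          finally show ?thesis using M0 by simp
        qed
      qed
    qed
    have "norm (g w0) \<le> M" by (rule field_le_epsilon) (use key in auto)
    hence "norm (f w0) * exp (- \<delta> * Re (E w0)) * exp (\<delta> * Re (E w0)) \<le> M * exp (\<delta> * Re (E w0))"
      unfolding ng by (intro mult_right_mono) auto
    then show ?thesis by (simp add: mult.assoc exp_add[symmetric])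
  qed
  have "((\<lambda>\<delta>. M * exp (\<delta> * Re (E w0))) \<longlongrightarrow> M * exp (0 * Re (E w0))) (at_right 0)"
    by (intro tendsto_intros)
  from le_limit_at_right_0[OF bound this] show ?thesis by simp
qed

text \<open>
For a function that is already bounded, the factor \<open>1 / (1 - i \<delta> z)\<close> suffices: it has modulus at
most 1 in the closed half-plane and makes the function small on large half-circles.
\<close>

lemma half_plane_bounded_Phragmen_Lindelof:
  fixes g :: "complex \<Rightarrow> complex"
  assumes hol: "g holomorphic_on UNIV"
    and bdd: "\<And>z. Im z \<ge> 0 \<Longrightarrow> norm (g z) \<le> K"
    and bdry: "\<And>x::real. norm (g (of_real x)) \<le> M"
    and M: "M > 0" and z0: "Im z0 \<ge> 0"
  shows "norm (g z0) \<le> M"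
proof -
  have K0: "K \<ge> 0" using bdd[of 0] norm_ge_zero[of "g 0"] by (simp del: norm_ge_zero)
  have bound: "norm (g z0) \<le> M * norm (1 - \<i> * of_real \<delta> * z0)" if \<delta>: "\<delta> > 0" for \<delta>
  proof -
    have den: "norm (1 - \<i> * of_real \<delta> * z) \<ge> 1" "norm (1 - \<i> * of_real \<delta> * z) \<ge> \<delta> * norm z"
      if "Im z \<ge> 0" for z
    proof -
      have "Re (1 - \<i> * of_real \<delta> * z) = 1 + \<delta> * Im z" by simp
      moreover have "\<delta> * Im z \<ge> 0" using \<delta> that by simp
      ultimately show "norm (1 - \<i> * of_real \<delta> * z) \<ge> 1"
        using complex_Re_le_cmod[of "1 - \<i> * of_real \<delta> * z"] by linarith
      have "(\<delta> * norm z)\<^sup>2 = (\<delta> * Re z)\<^sup>2 + (\<delta> * Im z)\<^sup>2"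
        by (simp add: power_mult_distrib cmod_power2 algebra_simps)
      also have "\<dots> \<le> (\<delta> * Re z)\<^sup>2 + (1 + \<delta> * Im z)\<^sup>2"
        using \<open>\<delta> * Im z \<ge> 0\<close> by (intro add_left_mono power_mono) auto
      also have "\<dots> = (norm (1 - \<i> * of_real \<delta> * z))\<^sup>2" by (simp add: cmod_power2)
      finally show "norm (1 - \<i> * of_real \<delta> * z) \<ge> \<delta> * norm z" by (rule power2_le_imp_le) simp
    qed
    define f where "f = (\<lambda>z. g z / (1 - \<i> * of_real \<delta> * z))"
    define R where "R = max (norm z0) (max 1 (K / (\<delta> * M)))"
    have R: "R > 0" "R \<ge> norm z0" "K / (\<delta> * M) \<le> R" by (auto simp: R_def)
    define S where "S = {w. 0 \<le> Im w} \<inter> cball 0 R"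
    define U where "U = {w. 0 < Im w} \<inter> ball 0 R"
    have clS: "closed S" unfolding S_def
      by (intro closed_Int closed_cball closed_Collect_le continuous_intros)
    have opU: "open U" unfolding U_def
      by (intro open_Int open_ball open_Collect_less continuous_intros)
    have holf: "f holomorphic_on S" unfolding f_def
    proof (intro holomorphic_intros holomorphic_on_subset[OF hol])
      fix z assume "z \<in> S"
      then show "1 - \<i> * of_real \<delta> * z \<noteq> 0" using den(1)[of z] by (auto simp: S_def)
    qed auto
    have "norm (f z0) \<le> M"
    proof (rule maximum_modulus_frontier[of f S])
      show "f holomorphic_on interior S"
        using holf interior_subset by (blast intro: holomorphic_on_subset)
      show "continuous_on (closure S) f"
        using holf clS by (simp add: holomorphic_on_imp_continuous_on)
      show "bounded S" unfolding S_def by (simp add: bounded_Int)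
      show "z0 \<in> S" using z0 R unfolding S_def by auto
      fix z assume "z \<in> frontier S"
      hence z: "z \<in> S" "z \<notin> U"
        using frontier_subset_sublevel[OF clS opU] unfolding S_def U_def by force+
      hence zS: "0 \<le> Im z" "norm z \<le> R" by (auto simp: S_def)
      show "norm (f z) \<le> M"
      proof (cases "Im z = 0")
        case True
        hence "z = of_real (Re z)" by (simp add: complex_eq_iff)
        hence "norm (g z) \<le> M" using bdry[of "Re z"] by simp
        also have "M \<le> M * norm (1 - \<i> * of_real \<delta> * z)" using den(1)[OF zS(1)] M by simp
        finally show ?thesis using den(1)[OF zS(1)] unfolding f_def norm_divide
          by (subst pos_divide_le_eq) auto
      next
        case False
        hence nz: "norm z = R" using z zS by (auto simp: U_def)
        have "norm (g z) \<le> K" by (rule bdd) (use zS in auto)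
        also have "K \<le> M * (\<delta> * R)" using R(3) \<delta> M by (simp add: field_simps)
        also have "\<dots> \<le> M * norm (1 - \<i> * of_real \<delta> * z)"
          using den(2)[OF zS(1)] M nz by simp
        finally show ?thesis using den(1)[OF zS(1)] unfolding f_def norm_divide
          by (subst pos_divide_le_eq) auto
      qed
    qed
    then show ?thesis using den(1)[OF z0] unfolding f_def norm_divide
      by (subst (asm) pos_divide_le_eq) auto
  qed
  have "((\<lambda>\<delta>. M * norm (1 - \<i> * of_real \<delta> * z0)) \<longlongrightarrow> M * norm (1 - \<i> * of_real 0 * z0)) (at_right 0)"
    by (intro tendsto_intros)
  from le_limit_at_right_0[OF bound this] show ?thesis by simp
qed

lemma entire_exp_typeD:
  assumes "entire_exp_type \<tau> F"
  shows "F holomorphic_on UNIV"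
    and "\<epsilon> > 0 \<Longrightarrow> \<exists>C>0. \<forall>z. norm (F z) \<le> C * exp ((\<tau> + \<epsilon>) * norm z)"
  using assms by (auto simp: entire_exp_type_def)

text \<open>
The function \<open>F(z) exp (i (\<tau> + \<epsilon>) z)\<close> is bounded on the real axis and on the positive imaginary
axis, hence in each of the two quadrants between them, hence in the half-plane; the bounded case
then replaces the constant by the one valid on the real axis.
\<close>

lemma Phragmen_Lindelof_upper:
  assumes F: "entire_exp_type \<tau> F" and \<tau>: "\<tau> \<ge> 0"
    and bdry: "\<And>x::real. norm (F (of_real x)) \<le> M" and M: "M > 0" and z0: "Im z0 \<ge> 0"
  shows "norm (F z0) \<le> M * exp (\<tau> * Im z0)"
proof -
  have bound: "norm (F z0) \<le> M * exp ((\<tau> + \<epsilon>) * Im z0)" if \<epsilon>: "\<epsilon> > 0" for \<epsilon>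
  proof -
    obtain C where C: "C > 0" "\<And>z. norm (F z) \<le> C * exp ((\<tau> + \<epsilon>) * norm z)"
      using entire_exp_typeD(2)[OF F \<epsilon>] by blast
    define g where "g = (\<lambda>z. F z * exp (\<i> * of_real (\<tau> + \<epsilon>) * z))"
    have ng: "norm (g z) = norm (F z) * exp (- (\<tau> + \<epsilon>) * Im z)" for z
      by (simp add: g_def norm_mult algebra_simps)
    have holg: "g holomorphic_on UNIV" unfolding g_def
      by (intro holomorphic_intros entire_exp_typeD(1)[OF F])
    define K where "K = max M C"
    have growth: "norm (g z) \<le> C * exp ((2 * (\<tau> + \<epsilon>)) * norm z)" for z
    proof -
      have "- ((\<tau> + \<epsilon>) * Im z) \<le> (\<tau> + \<epsilon>) * norm z"
        using \<tau> \<epsilon> abs_Im_le_cmod[of z] mult_left_mono[of "- Im z" "norm z" "\<tau> + \<epsilon>"] by simp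
      hence "- (\<tau> + \<epsilon>) * Im z \<le> (\<tau> + \<epsilon>) * norm z" by (simp only: mult_minus_left)
      hence "norm (F z) * exp (- (\<tau> + \<epsilon>) * Im z) \<le>
          (C * exp ((\<tau> + \<epsilon>) * norm z)) * exp ((\<tau> + \<epsilon>) * norm z)"
        using C by (intro mult_mono) auto
      also have "\<dots> = C * exp (2 * (\<tau> + \<epsilon>) * norm z)" by (simp add: mult.assoc exp_add[symmetric])
      finally show ?thesis unfolding ng .
    qed
    have re: "norm (g (of_real x)) \<le> M" for x using bdry[of x] by (simp add: ng)
    have im: "norm (g (\<i> * of_real y)) \<le> C" if "y \<ge> 0" for y
    proof -
      have "norm (g (\<i> * of_real y)) \<le> (C * exp ((\<tau> + \<epsilon>) * y)) * exp (- (\<tau> + \<epsilon>) * y)"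
        unfolding ng using C(2)[of "\<i> * of_real y"] that C(1) by (intro mult_mono) (auto simp: norm_mult)
      also have "\<dots> = C" by (simp add: mult.assoc exp_add[symmetric] distrib_right[symmetric] del: minus_add_distrib)
      finally show ?thesis .
    qed
    \<comment> \<open>multiplication by \<open>1 + i\<close> or \<open>-1 + i\<close> carries the sector \<open>\<bar>Im w\<bar> \<le> Re w\<close> onto a quadrant\<close>
    have rot: "norm (g (u * w)) \<le> K" if u: "u \<in> {1 + \<i>, -1 + \<i>}" and w: "\<bar>Im w\<bar> \<le> Re w" for u w
    proof (rule quarter_plane_Phragmen_Lindelof[where f = "\<lambda>w. g (u * w)", OF _ _ _ w])
      show "(\<lambda>w. g (u * w)) holomorphic_on UNIV"
        by (rule holomorphic_on_compose_gen[of "\<lambda>w. u * w" UNIV g UNIV, unfolded o_def])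
           (auto intro!: holomorphic_intros holg)
      show "norm (g (u * v)) \<le> C * exp (2 * (\<tau> + \<epsilon>) * norm u * norm v)" for v
        using growth[of "u * v"] by (simp add: norm_mult mult.assoc)
      fix v :: complex assume v: "\<bar>Im v\<bar> = Re v"
      consider "u * v = of_real (Re (u * v))" | "u * v = \<i> * of_real (Im (u * v))" "Im (u * v) \<ge> 0"
        using u v by (cases "Im v \<ge> 0") (auto simp: complex_eq_iff)
      then show "norm (g (u * v)) \<le> K"
      proof cases
        case 1
        have "norm (g (of_real (Re (u * v)))) \<le> M" by (rule re)
        then show ?thesis using 1 unfolding K_def by (metis max.coboundedI1)
      next
        case 2
        have "norm (g (\<i> * of_real (Im (u * v)))) \<le> C" by (rule im) (rule 2(2))
        then show ?thesis using 2(1) unfolding K_def by (metis max.coboundedI2)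
      qed
    qed
    have gK: "norm (g z) \<le> K" if "Im z \<ge> 0" for z
    proof (cases "Re z \<ge> 0")
      case True
      have "z = (1 + \<i>) * Complex ((Re z + Im z) / 2) ((Im z - Re z) / 2)"
        by (simp add: complex_eq_iff field_simps)
      moreover have "norm (g ((1 + \<i>) * Complex ((Re z + Im z) / 2) ((Im z - Re z) / 2))) \<le> K"
        by (rule rot) (use True that in auto)
      ultimately show ?thesis by metis
    next
      case False
      have "z = (-1 + \<i>) * Complex ((Im z - Re z) / 2) ((- Re z - Im z) / 2)"
        by (simp add: complex_eq_iff field_simps)
      moreover have "norm (g ((-1 + \<i>) * Complex ((Im z - Re z) / 2) ((- Re z - Im z) / 2))) \<le> K"
        by (rule rot) (use False that in auto)
      ultimately show ?thesis by metis
    qed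
    have "norm (g z0) \<le> M"
      by (rule half_plane_bounded_Phragmen_Lindelof[OF holg gK re M z0])
    hence "norm (F z0) * exp (- (\<tau> + \<epsilon>) * Im z0) * exp ((\<tau> + \<epsilon>) * Im z0) \<le> M * exp ((\<tau> + \<epsilon>) * Im z0)"
      unfolding ng by (intro mult_right_mono) auto
    also have "norm (F z0) * exp (- (\<tau> + \<epsilon>) * Im z0) * exp ((\<tau> + \<epsilon>) * Im z0) = norm (F z0)"
      unfolding mult.assoc exp_add[symmetric] by (simp add: algebra_simps)
    finally show ?thesis .
  qed
  have "((\<lambda>\<epsilon>. M * exp ((\<tau> + \<epsilon>) * Im z0)) \<longlongrightarrow> M * exp ((\<tau> + 0) * Im z0)) (at_right 0)"
    by (intro tendsto_intros)
  from le_limit_at_right_0[OF bound this] show ?thesis by simp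
qed

lemma entire_exp_type_uminus_arg:
  assumes "entire_exp_type \<tau> F" shows "entire_exp_type \<tau> (\<lambda>z. F (- z))"
  unfolding entire_exp_type_def
proof (intro conjI allI impI)
  show "(\<lambda>z. F (- z)) holomorphic_on UNIV"
    by (rule holomorphic_on_compose_gen[of uminus UNIV F UNIV, unfolded o_def])
       (auto intro!: holomorphic_intros entire_exp_typeD(1)[OF assms])
  fix \<epsilon> :: real assume "\<epsilon> > 0"
  then obtain C where "C > 0" "\<And>z. norm (F z) \<le> C * exp ((\<tau> + \<epsilon>) * norm z)"
    using entire_exp_typeD(2)[OF assms] by blast
  then show "\<exists>C>0. \<forall>z. norm (F (- z)) \<le> C * exp ((\<tau> + \<epsilon>) * norm z)"
    by (metis norm_minus_cancel)
qed

theorem exp_type_bounded_on_reals: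
  assumes F: "entire_exp_type \<tau> F" and \<tau>: "\<tau> \<ge> 0"
    and bdry: "\<And>x::real. norm (F (of_real x)) \<le> M"
  shows "norm (F z) \<le> M * exp (\<tau> * \<bar>Im z\<bar>)"
proof -
  have pos: "norm (F z) \<le> M * exp (\<tau> * \<bar>Im z\<bar>)" if M: "M > 0" and b: "\<And>x::real. norm (F (of_real x)) \<le> M" for M
  proof (cases "Im z \<ge> 0")
    case True
    then show ?thesis using Phragmen_Lindelof_upper[OF F \<tau> b M] by simp
  next
    case False
    have "norm ((\<lambda>z. F (- z)) (- z)) \<le> M * exp (\<tau> * Im (- z))"
      by (rule Phragmen_Lindelof_upper[OF entire_exp_type_uminus_arg[OF F] \<tau> _ M])
         (use False b[of "- _"] in auto)
    then show ?thesis using False by simp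
  qed
  have "M \<ge> 0" using bdry[of 0] norm_ge_zero[of "F 0"] by (simp del: norm_ge_zero)
  have "norm (F z) \<le> (M + \<delta>) * exp (\<tau> * \<bar>Im z\<bar>)" if "\<delta> > 0" for \<delta>
  proof (rule pos)
    show "M + \<delta> > 0" using that \<open>M \<ge> 0\<close> by simp
    show "norm (F (of_real x)) \<le> M + \<delta>" for x using bdry[of x] that by simp
  qed
  moreover have "((\<lambda>\<delta>. (M + \<delta>) * exp (\<tau> * \<bar>Im z\<bar>)) \<longlongrightarrow> (M + 0) * exp (\<tau> * \<bar>Im z\<bar>)) (at_right 0)"
    by (intro tendsto_intros)
  ultimately have "norm (F z) \<le> (M + 0) * exp (\<tau> * \<bar>Im z\<bar>)"
    by (rule le_limit_at_right_0)
  then show ?thesis by simp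
qed

section \<open>The Plancherel-Polya inequality\<close>

text \<open>
The \<open>L\<^sup>1\<close> norm over the horizontal line through \<open>w\<close>, as an extended nonnegative number so that
finiteness need not be known in advance.
\<close>

definition line_norm :: "(complex \<Rightarrow> complex) \<Rightarrow> complex \<Rightarrow> ennreal" where
  "line_norm F w = (\<integral>\<^sup>+ x. ennreal (norm (F (of_real x + w))) \<partial>lborel)"

lemma nn_integral_interval_eq_integral:
  fixes g :: "real \<Rightarrow> real"
  assumes "continuous_on {a..b} g" "\<And>t. t \<in> {a..b} \<Longrightarrow> g t \<ge> 0"
  shows "(\<integral>\<^sup>+ t. ennreal (g t) * indicator {a..b} t \<partial>lborel) = ennreal (integral {a..b} g)"
proof -
  have si: "set_integrable lborel {a..b} g"
    using assms(1) by (rule borel_integrable_atLeastAtMost')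
  have "(\<integral>\<^sup>+ t. ennreal (g t) * indicator {a..b} t \<partial>lborel) =
        (\<integral>\<^sup>+ t. ennreal (indicator {a..b} t *\<^sub>R g t) \<partial>lborel)"
    by (intro nn_integral_cong) (auto simp: indicator_def)
  also have "\<dots> = ennreal (LINT t:{a..b}|lborel. g t)"
    unfolding set_lebesgue_integral_def
    using si unfolding set_integrable_def
    by (intro nn_integral_eq_integral) (auto simp: indicator_def assms(2))
  also have "(LINT t:{a..b}|lborel. g t) = integral {a..b} g"
    by (rule set_borel_integral_eq_integral(2)[OF si])
  finally show ?thesis .
qed

lemma nn_integral_le_if_windows_le:
  fixes f :: "real \<Rightarrow> ennreal"
  assumes [measurable]: "f \<in> borel_measurable borel"
    and le: "\<And>N::nat. (\<integral>\<^sup>+ t. f t * indicator {- real N..real N} t \<partial>lborel) \<le> C"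
  shows "(\<integral>\<^sup>+ t. f t \<partial>lborel) \<le> C"
proof -
  have "(\<integral>\<^sup>+ t. f t \<partial>lborel) = (\<integral>\<^sup>+ t. (SUP N::nat. f t * indicator {- real N..real N} t) \<partial>lborel)"
  proof (intro nn_integral_cong antisym SUP_least)
    fix t :: real
    obtain N :: nat where "\<bar>t\<bar> \<le> real N" using real_arch_simple by blast
    hence "t \<in> {- real N..real N}" by auto
    hence "f t = f t * indicator {- real N..real N} t" by simp
    also have "\<dots> \<le> (SUP N::nat. f t * indicator {- real N..real N} t)" by (rule SUP_upper) simp
    finally show "f t \<le> (SUP N::nat. f t * indicator {- real N..real N} t)" .
  qed (auto simp: indicator_def)
  also have "\<dots> = (SUP N::nat. \<integral>\<^sup>+ t. f t * indicator {- real N..real N} t \<partial>lborel)"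
    by (intro nn_integral_monotone_convergence_SUP)
       (auto simp: incseq_def le_fun_def indicator_def)
  also have "\<dots> \<le> C" by (rule SUP_least) (rule le)
  finally show ?thesis .
qed

lemma line_norm_shift:
  assumes "continuous_on UNIV F"
  shows "line_norm F (of_real x + w) = line_norm F w"
proof -
  have [measurable]: "F \<in> borel_measurable borel"
    using assms by (rule borel_measurable_continuous_onI)
  show ?thesis unfolding line_norm_def
    using nn_integral_real_affine[of "\<lambda>t. ennreal (norm (F (of_real t + w)))" 1 x]
    by (simp add: algebra_simps)
qed

lemma continuous_on_line:
  fixes F :: "complex \<Rightarrow> 'a::topological_space"
  assumes "continuous_on UNIV F"
  shows "continuous_on S (\<lambda>t::real. F (w + of_real t))"
  by (rule continuous_on_compose2[OF assms])
     (auto intro!: continuous_intros)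

text \<open>
Averaging \<open>F\<close> over a bounded window against a multiplier of modulus at most 1 produces a function
of the same exponential type that is bounded on the real axis by the \<open>L\<^sup>1\<close> norm of \<open>F\<close>. The
Phragmen-Lindelof bound for this average, together with Cauchy's estimate for its derivative, is
the source of all estimates of \<open>F\<close> off the real axis.
\<close>

lemma window_average:
  fixes \<phi> :: "real \<Rightarrow> complex" and N :: real
  assumes F: "entire_exp_type \<tau> F" and \<tau>: "\<tau> \<ge> 0" and N: "N \<ge> 0"
    and M: "line_norm F 0 \<le> ennreal M" "M \<ge> 0"
    and \<phi>: "continuous_on {-N..N} \<phi>" "\<And>t. t \<in> {-N..N} \<Longrightarrow> norm (\<phi> t) \<le> 1"
  shows "norm (integral {-N..N} (\<lambda>t. F (z + of_real t) * \<phi> t)) \<le> M * exp (\<tau> * \<bar>Im z\<bar>)" (is ?th1)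
    and "norm (integral {-N..N} (\<lambda>t. deriv F (z + of_real t) * \<phi> t)) \<le> M * exp (\<tau> * (\<bar>Im z\<bar> + 1))" (is ?th2)
proof -
  note hol = entire_exp_typeD(1)[OF F]
  have contF: "continuous_on UNIV F" using hol by (rule holomorphic_on_imp_continuous_on)
  have hol': "deriv F holomorphic_on UNIV" using hol by (intro holomorphic_deriv) auto
  have contF': "continuous_on UNIV (deriv F)" using hol' by (rule holomorphic_on_imp_continuous_on)
  have derF: "(F has_field_derivative deriv F w) (at w)" for w
    using hol by (simp add: holomorphic_derivI)
  define \<Phi> where "\<Phi> = (\<lambda>z. integral {-N..N} (\<lambda>t. F (z + of_real t) * \<phi> t))"
  have cont_int: "continuous_on {-N..N} (\<lambda>t. F (z + of_real t) * \<phi> t)" for z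
    by (intro continuous_intros \<phi> continuous_on_line contF)
  have der: "(\<Phi> has_field_derivative integral {-N..N} (\<lambda>t. deriv F (z + of_real t) * \<phi> t)) (at z)" for z
  proof -
    have "((\<lambda>z. integral (cbox (-N) N) (\<lambda>t. F (z + of_real t) * \<phi> t)) has_field_derivative
       integral (cbox (-N) N) (\<lambda>t. deriv F (z + of_real t) * \<phi> t)) (at z within UNIV)"
    proof (rule leibniz_rule_field_derivative)
      fix x :: complex and t :: real
      have "((\<lambda>x. F (x + of_real t)) has_field_derivative deriv F (x + of_real t)) (at x)"
        using DERIV_shift[of F _ x "of_real t"] derF by blast
      then show "((\<lambda>x. F (x + of_real t) * \<phi> t) has_field_derivative deriv F (x + of_real t) * \<phi> t) (at x within UNIV)"
        by (intro DERIV_cmult_right) simp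
    next
      show "(\<lambda>t. F (x + of_real t) * \<phi> t) integrable_on cbox (-N) N" for x
        using integrable_continuous_real[OF cont_int] by simp
      have "continuous_on (UNIV \<times> {-N..N}) (\<lambda>p. deriv F (fst p + of_real (snd p)) * \<phi> (snd p))"
        by (intro continuous_intros continuous_on_compose2[OF contF'] continuous_on_compose2[OF \<phi>(1)]) auto
      then show "continuous_on (UNIV \<times> cbox (-N) N) (\<lambda>(x, t). deriv F (x + of_real t) * \<phi> t)"
        by (simp add: case_prod_unfold)
    qed auto
    then show ?thesis by (simp add: \<Phi>_def)
  qed
  have hol\<Phi>: "\<Phi> holomorphic_on UNIV"
    using der by (auto simp: holomorphic_on_def field_differentiable_def)
  have exp\<Phi>: "entire_exp_type \<tau> \<Phi>"
    unfolding entire_exp_type_def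
  proof (intro conjI allI impI hol\<Phi>)
    fix \<epsilon> :: real assume \<epsilon>: "\<epsilon> > 0"
    then obtain C where C: "C > 0" "\<And>z. norm (F z) \<le> C * exp ((\<tau> + \<epsilon>) * norm z)"
      using entire_exp_typeD(2)[OF F] by blast
    \<comment> \<open>the summand 1 keeps the constant positive for the degenerate window \<open>N = 0\<close>\<close>
    define C' where "C' = C * exp ((\<tau> + \<epsilon>) * N) * (2 * N + 1)"
    have "norm (\<Phi> z) \<le> C' * exp ((\<tau> + \<epsilon>) * norm z)" for z
    proof -
      have "norm (\<Phi> z) \<le> (C * exp ((\<tau> + \<epsilon>) * (norm z + N))) * (N - (-N))"
        unfolding \<Phi>_def
      proof (rule integral_bound)
        fix t assume t: "t \<in> {-N..N}"
        have nz: "norm (z + of_real t) \<le> norm z + N"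
          using norm_triangle_ineq[of z "of_real t"] t by (auto simp: abs_le_iff)
        have "norm (F (z + of_real t) * \<phi> t) \<le> norm (F (z + of_real t)) * 1"
          unfolding norm_mult using \<phi>(2)[OF t] by (intro mult_left_mono) auto
        also have "\<dots> \<le> C * exp ((\<tau> + \<epsilon>) * norm (z + of_real t))" using C by simp
        also have "\<dots> \<le> C * exp ((\<tau> + \<epsilon>) * (norm z + N))"
          using C(1) nz \<tau> \<epsilon> by simp
        finally show "norm (F (z + of_real t) * \<phi> t) \<le> C * exp ((\<tau> + \<epsilon>) * (norm z + N))" .
      qed (use N cont_int in auto)
      also have "\<dots> \<le> C' * exp ((\<tau> + \<epsilon>) * norm z)"
        using N C(1) by (simp add: C'_def distrib_left exp_add)
      finally show ?thesis .
    qed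
    moreover have "C' > 0" using C(1) N by (simp add: C'_def)
    ultimately show "\<exists>C>0. \<forall>z. norm (\<Phi> z) \<le> C * exp ((\<tau> + \<epsilon>) * norm z)" by blast
  qed
  have real: "norm (\<Phi> (of_real x)) \<le> M" for x :: real
  proof -
    have cn: "continuous_on {-N..N} (\<lambda>t. norm (F (of_real x + of_real t)))"
      by (intro continuous_intros continuous_on_line contF)
    have "norm (\<Phi> (of_real x)) \<le> integral {-N..N} (\<lambda>t. norm (F (of_real x + of_real t)))"
      unfolding \<Phi>_def
    proof (rule integral_norm_bound_integral)
      fix t assume t: "t \<in> {-N..N}"
      show "norm (F (of_real x + of_real t) * \<phi> t) \<le> norm (F (of_real x + of_real t))"
        unfolding norm_mult using \<phi>(2)[OF t] by (intro mult_left_le) auto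
    qed (use cont_int cn in \<open>auto intro!: integrable_continuous_real\<close>)
    also have "\<dots> \<le> M"
    proof -
      have "ennreal (integral {-N..N} (\<lambda>t. norm (F (of_real x + of_real t)))) =
            (\<integral>\<^sup>+ t. ennreal (norm (F (of_real x + of_real t))) * indicator {-N..N} t \<partial>lborel)"
        by (rule nn_integral_interval_eq_integral[symmetric]) (use cn in auto)
      also have "\<dots> \<le> line_norm F (of_real x)" unfolding line_norm_def
        by (intro nn_integral_mono) (auto simp: indicator_def add.commute)
      also have "\<dots> = line_norm F 0" using line_norm_shift[OF contF, of x 0] by simp
      also have "\<dots> \<le> ennreal M" by (rule M)
      finally show ?thesis using M(2) by (simp add: ennreal_le_iff)
    qed
    finally show ?thesis .
  qed
  have bd: "norm (\<Phi> z) \<le> M * exp (\<tau> * \<bar>Im z\<bar>)" for z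
    by (rule exp_type_bounded_on_reals[OF exp\<Phi> \<tau> real])
  from bd[of z] show ?th1 by (simp add: \<Phi>_def)
  have "norm ((deriv ^^ 1) \<Phi> z) \<le> fact 1 * (M * exp (\<tau> * (\<bar>Im z\<bar> + 1))) / 1 ^ 1"
  proof (rule Cauchy_inequality)
    show "\<Phi> holomorphic_on ball z 1" using hol\<Phi> by (rule holomorphic_on_subset) auto
    show "continuous_on (cball z 1) \<Phi>" using holomorphic_on_imp_continuous_on[OF hol\<Phi>]
      by (rule continuous_on_subset) auto
    fix x assume "norm (z - x) = 1"
    hence "\<bar>Im x\<bar> \<le> \<bar>Im z\<bar> + 1" using abs_Im_le_cmod[of "z - x"] by simp
    hence "\<tau> * \<bar>Im x\<bar> \<le> \<tau> * (\<bar>Im z\<bar> + 1)" using \<tau> by (rule mult_left_mono)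
    then show "norm (\<Phi> x) \<le> M * exp (\<tau> * (\<bar>Im z\<bar> + 1))"
      by (intro order_trans[OF bd]) (use M(2) in \<open>auto intro!: mult_left_mono\<close>)
  qed simp
  then show ?th2 using DERIV_imp_deriv[OF der[of z]] by simp
qed

text \<open>
Duality of \<open>L\<^sup>1\<close> and bounded functions. To stay with continuous multipliers, the conjugate sign of
\<open>g\<close> is regularized to \<open>cnj g / (\<bar>g\<bar> + \<delta>)\<close>, at the price of an error of \<open>\<delta>\<close> per unit length.
\<close>

lemma nn_integral_le_by_testing:
  fixes g :: "real \<Rightarrow> complex"
  assumes g: "continuous_on UNIV g" and C: "C \<ge> 0"
    and test: "\<And>N \<phi>. N \<ge> 0 \<Longrightarrow> continuous_on {-N..N} \<phi> \<Longrightarrow> (\<And>t. t \<in> {-N..N} \<Longrightarrow> norm (\<phi> t) \<le> 1)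
       \<Longrightarrow> norm (integral {-N..N} (\<lambda>t. g t * \<phi> t)) \<le> C"
  shows "(\<integral>\<^sup>+ t. ennreal (norm (g t)) \<partial>lborel) \<le> ennreal C"
proof (rule nn_integral_le_if_windows_le)
  have [measurable]: "g \<in> borel_measurable borel"
    using g by (rule borel_measurable_continuous_onI)
  show "(\<lambda>t. ennreal (norm (g t))) \<in> borel_measurable borel" by measurable
  fix n :: nat
  define N where "N = real n"
  have cg: "continuous_on {-N..N} g" using g continuous_on_subset by blast
  have cng: "continuous_on {-N..N} (\<lambda>t. norm (g t))" using cg by (intro continuous_intros)
  have "integral {-N..N} (\<lambda>t. norm (g t)) \<le> C + \<delta> * (2 * N)" if \<delta>: "\<delta> > 0" for \<delta>
  proof -
    define \<phi> where "\<phi> = (\<lambda>t. cnj (g t) / of_real (norm (g t) + \<delta>))"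
    have pos: "norm (g t) + \<delta> > 0" for t using \<delta> by (simp add: add_nonneg_pos)
    have nz: "complex_of_real (norm (g t)) + of_real \<delta> \<noteq> 0" for t
      using pos[of t] by (metis less_numeral_extra(3) of_real_add of_real_eq_0_iff)
    have c\<phi>: "continuous_on {-N..N} \<phi>" unfolding \<phi>_def
      by (intro continuous_intros cg) (use nz in auto)
    have n\<phi>: "norm (\<phi> t) \<le> 1" for t
      using pos[of t] \<delta> unfolding \<phi>_def norm_divide norm_of_real by (simp add: divide_simps)
    have gp: "g t * \<phi> t = of_real ((norm (g t))\<^sup>2 / (norm (g t) + \<delta>))" for t
      unfolding \<phi>_def by (simp add: complex_norm_square[symmetric] flip: of_real_power)
    define r where "r = (\<lambda>t. (norm (g t))\<^sup>2 / (norm (g t) + \<delta>))"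
    have cr: "continuous_on {-N..N} r" unfolding r_def
      by (intro continuous_intros cg) (use pos in \<open>auto simp: less_imp_neq[symmetric]\<close>)
    have rint: "r integrable_on {-N..N}" using cr by (rule integrable_continuous_real)
    have r0: "r t \<ge> 0" for t using pos[of t] by (simp add: r_def)
    have rge: "norm (g t) - \<delta> \<le> r t" for t
    proof -
      have "(norm (g t) - \<delta>) * (norm (g t) + \<delta>) \<le> (norm (g t))\<^sup>2"
        by (simp add: algebra_simps power2_eq_square)
      then show ?thesis unfolding r_def by (subst pos_le_divide_eq[OF pos])
    qed
    have "integral {-N..N} (\<lambda>t. norm (g t)) \<le> integral {-N..N} (\<lambda>t. r t + \<delta>)"
      by (intro integral_le integrable_add integrable_continuous_real cng cr integrable_const_ivl)
         (use rge in \<open>auto simp: algebra_simps\<close>)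
    also have "\<dots> = integral {-N..N} r + \<delta> * (2 * N)"
      by (subst integral_add) (use rint in \<open>auto simp: N_def\<close>)
    also have "integral {-N..N} r = norm (integral {-N..N} (\<lambda>t. g t * \<phi> t))"
    proof -
      have "integral {-N..N} (\<lambda>t. g t * \<phi> t) = of_real (integral {-N..N} r)"
      proof -
        have "(\<lambda>t. g t * \<phi> t) = (\<lambda>t. of_real (r t))" by (simp only: gp r_def)
        then show ?thesis
          using integral_unique[OF has_integral_of_real[OF integrable_integral[OF rint]]] by (simp only:)
      qed
      then show ?thesis using integral_nonneg[OF rint r0] by simp
    qed
    also have "\<dots> \<le> C" by (rule test) (use c\<phi> n\<phi> in \<open>auto simp: N_def\<close>)
    finally show ?thesis by simp
  qed
  moreover have "((\<lambda>\<delta>. C + \<delta> * (2 * N)) \<longlongrightarrow> C + 0 * (2 * N)) (at_right 0)"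
    by (intro tendsto_intros)
  ultimately have "integral {-N..N} (\<lambda>t. norm (g t)) \<le> C + 0 * (2 * N)"
    by (rule le_limit_at_right_0)
  hence "integral {-N..N} (\<lambda>t. norm (g t)) \<le> C" by simp
  then show "(\<integral>\<^sup>+ t. ennreal (norm (g t)) * indicator {- real n..real n} t \<partial>lborel) \<le> ennreal C"
    by (subst nn_integral_interval_eq_integral) (use cng C in \<open>auto simp: N_def ennreal_le_iff\<close>)
qed

text \<open>
Test \<open>F\<close> on a horizontal line by multipliers: each test is a value of a window average.
\<close>

theorem Plancherel_Polya:
  assumes F: "entire_exp_type \<tau> F" and \<tau>: "\<tau> \<ge> 0"
    and M: "line_norm F 0 \<le> ennreal M" "M \<ge> 0"
  shows "line_norm F w \<le> ennreal (M * exp (\<tau> * \<bar>Im w\<bar>))"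
    and "line_norm (deriv F) w \<le> ennreal (M * exp (\<tau> * (\<bar>Im w\<bar> + 1)))"
proof -
  note hol = entire_exp_typeD(1)[OF F]
  have contF: "continuous_on UNIV F" using hol by (rule holomorphic_on_imp_continuous_on)
  have contF': "continuous_on UNIV (deriv F)"
    using holomorphic_deriv[OF hol] by (intro holomorphic_on_imp_continuous_on) auto
  show "line_norm F w \<le> ennreal (M * exp (\<tau> * \<bar>Im w\<bar>))"
    unfolding line_norm_def add.commute[of _ w]
    by (intro nn_integral_le_by_testing continuous_on_line contF window_average(1)[OF F \<tau> _ M]) (use M in auto)
  show "line_norm (deriv F) w \<le> ennreal (M * exp (\<tau> * (\<bar>Im w\<bar> + 1)))"
    unfolding line_norm_def add.commute[of _ w]
    by (intro nn_integral_le_by_testing continuous_on_line contF' window_average(2)[OF F \<tau> _ M]) (use M in auto)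
qed

text \<open>
Integrate the derivative of \<open>(1 - t) F(z + t)\<close> over the unit interval. The half-open interval makes
the translates by integers a partition of the line.
\<close>

lemma norm_le_integral_value_and_deriv:
  assumes hol: "F holomorphic_on UNIV"
  shows "ennreal (norm (F z)) \<le>
    (\<integral>\<^sup>+ t. ennreal (norm (F (z + of_real t)) + norm (deriv F (z + of_real t))) * indicator {0..<1} t \<partial>lborel)"
proof -
  have contF: "continuous_on UNIV F" using hol by (rule holomorphic_on_imp_continuous_on)
  have contF': "continuous_on UNIV (deriv F)"
    using holomorphic_deriv[OF hol] by (intro holomorphic_on_imp_continuous_on) auto
  define g where "g = (\<lambda>t::real. norm (F (z + of_real t)) + norm (deriv F (z + of_real t)))"
  have cg: "continuous_on {0..1} g" unfolding g_def
    by (intro continuous_intros continuous_on_line contF contF')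
  have hi: "((\<lambda>t. (1 - of_real t) * deriv F (z + of_real t) - F (z + of_real t)) has_integral
        ((1 - of_real 1) * F (z + of_real 1) - (1 - of_real 0) * F (z + of_real 0))) {0..1::real}"
  proof (rule fundamental_theorem_of_calculus)
    fix t :: real
    have F': "(F has_field_derivative deriv F (z + of_real t)) (at (z + of_real t))"
      using hol by (simp add: holomorphic_derivI)
    have F'': "((\<lambda>w. F (z + w)) has_field_derivative deriv F (z + of_real t)) (at (of_real t))"
      using DERIV_shift[of F _ "of_real t" z] F' by (simp add: add.commute)
    have lin: "((\<lambda>w::complex. 1 - w) has_field_derivative - 1) (at (of_real t))"
      by (auto intro!: derivative_eq_intros)
    have "((\<lambda>w. (1 - w) * F (z + w)) has_field_derivative
          (1 - of_real t) * deriv F (z + of_real t) - F (z + of_real t)) (at (of_real t))"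
      by (rule DERIV_cong[OF DERIV_mult[OF lin F'']]) (simp add: algebra_simps)
    then show "((\<lambda>t. (1 - of_real t) * F (z + of_real t)) has_vector_derivative
          (1 - of_real t) * deriv F (z + of_real t) - F (z + of_real t)) (at t within {0..1})"
      by (rule has_vector_derivative_real_field)
  qed simp
  have "F z = - integral {0..1} (\<lambda>t. (1 - of_real t) * deriv F (z + of_real t) - F (z + of_real t))"
    using integral_unique[OF hi] by simp
  hence "norm (F z) = norm (integral {0..1} (\<lambda>t::real. (1 - of_real t) * deriv F (z + of_real t) - F (z + of_real t)))"
    by (metis norm_minus_cancel)
  also have "\<dots> \<le> integral {0..1} g"
  proof (rule integral_norm_bound_integral)
    show "(\<lambda>t::real. (1 - of_real t) * deriv F (z + of_real t) - F (z + of_real t)) integrable_on {0..1}"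
      using hi by blast
    show "g integrable_on {0..1}" using cg by (rule integrable_continuous_real)
    fix t :: real assume t: "t \<in> {0..1}"
    have "norm (1 - complex_of_real t) = 1 - t"
      using t by (metis abs_of_nonneg atLeastAtMost_iff diff_ge_0_iff_ge norm_of_real of_real_1 of_real_diff)
    hence "norm ((1 - of_real t) * deriv F (z + of_real t)) \<le> norm (deriv F (z + of_real t))"
      using t by (simp add: norm_mult mult_left_le_one_le)
    then show "norm ((1 - of_real t) * deriv F (z + of_real t) - F (z + of_real t)) \<le> g t"
      unfolding g_def using norm_triangle_ineq4[of "(1 - of_real t) * deriv F (z + of_real t)" "F (z + of_real t)"]
      by linarith
  qed
  finally have "ennreal (norm (F z)) \<le> ennreal (integral {0..1} g)" by (rule ennreal_leI)
  also have "\<dots> = (\<integral>\<^sup>+ t. ennreal (g t) * indicator {0..1} t \<partial>lborel)"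
    by (rule nn_integral_interval_eq_integral[symmetric]) (use cg in \<open>auto simp: g_def\<close>)
  also have "\<dots> = (\<integral>\<^sup>+ t. ennreal (g t) * indicator {0..<1} t \<partial>lborel)"
    by (rule nn_integral_cong_AE, rule AE_mp[OF AE_lborel_singleton[of 1]]) (auto simp: indicator_def)
  finally show ?thesis unfolding g_def .
qed

text \<open>
A sum over integer translates is dominated by the integrals of \<open>\<bar>F\<bar>\<close> and \<open>\<bar>F'\<bar>\<close> over unit intervals,
and these add up to integrals over a horizontal line.
\<close>

lemma sum_shifts_le:
  assumes F: "entire_exp_type \<tau> F" and \<tau>: "\<tau> \<ge> 0"
    and M: "line_norm F 0 \<le> ennreal M" "M \<ge> 0" and K: "finite K"
  shows "(\<Sum>k\<in>K. norm (F (z + of_int k))) \<le> 2 * M * exp (\<tau> * (\<bar>Im z\<bar> + 1))"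
proof -
  note hol = entire_exp_typeD(1)[OF F]
  have contF: "continuous_on UNIV F" using hol by (rule holomorphic_on_imp_continuous_on)
  have contF': "continuous_on UNIV (deriv F)"
    using holomorphic_deriv[OF hol] by (intro holomorphic_on_imp_continuous_on) auto
  have [measurable]: "F \<in> borel_measurable borel" "deriv F \<in> borel_measurable borel"
    using contF contF' by (auto intro: borel_measurable_continuous_onI)
  define G where "G = (\<lambda>t::real. ennreal (norm (F (z + of_real t)) + norm (deriv F (z + of_real t))))"
  have [measurable]: "G \<in> borel_measurable borel" unfolding G_def by measurable
  have term_le: "ennreal (norm (F (z + of_int k))) \<le>
      (\<integral>\<^sup>+ t. G t * indicator {real_of_int k..<real_of_int k + 1} t \<partial>lborel)" for k :: int
  proof -
    have "ennreal (norm (F (z + of_int k))) \<le>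
       (\<integral>\<^sup>+ t. G (t + of_int k) * indicator {0..<1} t \<partial>lborel)"
      using norm_le_integral_value_and_deriv[OF hol, of "z + of_int k"]
      by (simp add: G_def algebra_simps)
    also have "\<dots> = (\<integral>\<^sup>+ t. G t * indicator {real_of_int k..<real_of_int k + 1} t \<partial>lborel)"
      by (subst nn_integral_real_affine[where c=1 and t="real_of_int k"])
         (auto simp: add.commute indicator_def intro!: nn_integral_cong)
    finally show ?thesis .
  qed
  have "ennreal (\<Sum>k\<in>K. norm (F (z + of_int k))) = (\<Sum>k\<in>K. ennreal (norm (F (z + of_int k))))"
    by (simp add: sum_ennreal)
  also have "\<dots> \<le> (\<Sum>k\<in>K. \<integral>\<^sup>+ t. G t * indicator {real_of_int k..<real_of_int k + 1} t \<partial>lborel)"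
    by (intro sum_mono term_le)
  also have "\<dots> = (\<integral>\<^sup>+ t. (\<Sum>k\<in>K. G t * indicator {real_of_int k..<real_of_int k + 1} t) \<partial>lborel)"
    by (subst nn_integral_sum) auto
  also have "\<dots> \<le> (\<integral>\<^sup>+ t. G t \<partial>lborel)"
  proof (rule nn_integral_mono)
    fix t :: real
    have "(\<Sum>k\<in>K. G t * indicator {real_of_int k..<real_of_int k + 1} t) =
          (\<Sum>k\<in>K. if k = \<lfloor>t\<rfloor> then G t else 0)"
    proof (rule sum.cong)
      fix k :: int
      have "t \<in> {real_of_int k..<real_of_int k + 1} \<longleftrightarrow> k = \<lfloor>t\<rfloor>"
        by (simp add: eq_commute[of k] floor_eq_iff)
      then show "G t * indicator {real_of_int k..<real_of_int k + 1} t = (if k = \<lfloor>t\<rfloor> then G t else 0)"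
        by (auto simp: indicator_def)
    qed simp
    also have "\<dots> \<le> G t" using K by (simp add: sum.delta)
    finally show "(\<Sum>k\<in>K. G t * indicator {real_of_int k..<real_of_int k + 1} t) \<le> G t" .
  qed
  also have "\<dots> = line_norm F z + line_norm (deriv F) z"
    unfolding line_norm_def G_def
    by (subst nn_integral_add[symmetric]) (auto simp: add.commute)
  also have "\<dots> \<le> ennreal (M * exp (\<tau> * \<bar>Im z\<bar>)) + ennreal (M * exp (\<tau> * (\<bar>Im z\<bar> + 1)))"
    by (intro add_mono Plancherel_Polya[OF F \<tau> M])
  also have "\<dots> = ennreal (M * exp (\<tau> * \<bar>Im z\<bar>) + M * exp (\<tau> * (\<bar>Im z\<bar> + 1)))"
    using M by simp
  finally have "(\<Sum>k\<in>K. norm (F (z + of_int k))) \<le> M * exp (\<tau> * \<bar>Im z\<bar>) + M * exp (\<tau> * (\<bar>Im z\<bar> + 1))"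
    using M by (subst (asm) ennreal_le_iff) auto
  also have "\<dots> \<le> 2 * M * exp (\<tau> * (\<bar>Im z\<bar> + 1))"
    using M \<tau> by (simp add: distrib_left mult_le_cancel_left1 exp_add mult_left_mono)
  finally show ?thesis .
qed

section \<open>Poisson summation at the critical exponential type\<close>

lemma symmetric_partial_sums_tendsto:
  fixes f :: "int \<Rightarrow> complex"
  assumes "(\<lambda>k. norm (f k)) summable_on UNIV"
  shows "(\<lambda>N. \<Sum>k\<in>{- int N..int N}. f k) \<longlonglongrightarrow> infsum f UNIV"
proof -
  have "(f has_sum infsum f UNIV) UNIV"
    using abs_summable_summable[OF assms] by simp
  hence "(sum f \<longlongrightarrow> infsum f UNIV) (finite_subsets_at_top UNIV)"
    by (simp add: has_sum_def)
  moreover have "filterlim (\<lambda>N. {- int N..int N}) (finite_subsets_at_top UNIV) sequentially"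
    unfolding filterlim_finite_subsets_at_top
  proof (intro allI impI)
    fix X :: "int set" assume X: "finite X \<and> X \<subseteq> UNIV"
    define B where "B = Max (insert 0 (abs ` X))"
    have B: "\<bar>k\<bar> \<le> B" if "k \<in> X" for k
      unfolding B_def using X that by (intro Max_ge) auto
    show "\<forall>\<^sub>F N in sequentially. finite {- int N..int N} \<and> X \<subseteq> {- int N..int N} \<and> {- int N..int N} \<subseteq> UNIV"
      using eventually_ge_at_top[of "nat B"]
    proof eventually_elim
      case (elim N)
      have "k \<in> {- int N..int N}" if "k \<in> X" for k using B[OF that] elim by auto
      then show ?case by auto
    qed
  qed
  ultimately show ?thesis by (rule filterlim_compose)
qed

lemma integral_window_sums_tendsto:
  fixes f :: "real \<Rightarrow> complex"
  assumes int: "integrable lborel f"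
  shows "(\<lambda>N. LINT t|lborel. indicator {0..<1} t *\<^sub>R (\<Sum>k\<in>{- int N..int N}. f (t + of_int k))) \<longlonglongrightarrow> (LINT t|lborel. f t)"
proof -
  have [measurable]: "f \<in> borel_measurable borel" using int by auto
  have intI: "integrable lborel (\<lambda>t. indicator A t *\<^sub>R f t)" if "A \<in> sets borel" for A
    using int that by (intro integrable_mult_indicator) auto
  have sh: "(LINT t|lborel. indicator {0..<1} t *\<^sub>R f (t + of_int k)) =
            (LINT t|lborel. indicator {real_of_int k..<real_of_int k + 1} t *\<^sub>R f t)"
    and shint: "integrable lborel (\<lambda>t. indicator {0..<1} t *\<^sub>R f (t + of_int k))" for k :: int
  proof -
    have eq: "(\<lambda>t. indicator {0..<1} t *\<^sub>R f (t + of_int k)) =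
       (\<lambda>t. indicator {real_of_int k..<real_of_int k + 1} (real_of_int k + 1 * t) *\<^sub>R f (real_of_int k + 1 * t))"
      by (auto simp: indicator_def add.commute)
    show "(LINT t|lborel. indicator {0..<1} t *\<^sub>R f (t + of_int k)) =
            (LINT t|lborel. indicator {real_of_int k..<real_of_int k + 1} t *\<^sub>R f t)"
      unfolding eq by (subst lborel_integral_real_affine[where c=1 and t="real_of_int k"]) auto
    show "integrable lborel (\<lambda>t. indicator {0..<1} t *\<^sub>R f (t + of_int k))"
      unfolding eq by (intro lborel_integrable_real_affine intI) auto
  qed
  have eq: "(LINT t|lborel. indicator {0..<1} t *\<^sub>R (\<Sum>k\<in>{- int N..int N}. f (t + of_int k))) =
        (LINT t|lborel. indicator {- real N..<real N + 1} t *\<^sub>R f t)" for N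
  proof -
    have "(LINT t|lborel. indicator {0..<1} t *\<^sub>R (\<Sum>k\<in>{- int N..int N}. f (t + of_int k))) =
          (\<Sum>k\<in>{- int N..int N}. LINT t|lborel. indicator {0..<1} t *\<^sub>R f (t + of_int k))"
      by (subst Bochner_Integration.integral_sum[symmetric]) (auto simp: shint scaleR_sum_right)
    also have "\<dots> = (\<Sum>k\<in>{- int N..int N}. LINT t|lborel. indicator {real_of_int k..<real_of_int k + 1} t *\<^sub>R f t)"
      by (simp only: sh)
    also have "\<dots> = (LINT t|lborel. (\<Sum>k\<in>{- int N..int N}. indicator {real_of_int k..<real_of_int k + 1} t *\<^sub>R f t))"
      by (subst Bochner_Integration.integral_sum) (auto simp: intI)
    also have "\<dots> = (LINT t|lborel. indicator {- real N..<real N + 1} t *\<^sub>R f t)"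
    proof (rule Bochner_Integration.integral_cong)
      fix t :: real
      have "(\<Sum>k\<in>{- int N..int N}. indicator {real_of_int k..<real_of_int k + 1} t *\<^sub>R f t) =
            (\<Sum>k\<in>{- int N..int N}. if k = \<lfloor>t\<rfloor> then f t else 0)"
      proof (rule sum.cong)
        fix k :: int
        have "t \<in> {real_of_int k..<real_of_int k + 1} \<longleftrightarrow> k = \<lfloor>t\<rfloor>"
          by (simp add: eq_commute[of k] floor_eq_iff)
        then show "indicator {real_of_int k..<real_of_int k + 1} t *\<^sub>R f t = (if k = \<lfloor>t\<rfloor> then f t else 0)"
          by (auto simp: indicator_def)
      qed simp
      also have "\<dots> = (if \<lfloor>t\<rfloor> \<in> {- int N..int N} then f t else 0)" by simp
      also have "\<lfloor>t\<rfloor> \<in> {- int N..int N} \<longleftrightarrow> t \<in> {- real N..<real N + 1}"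
        by (auto simp: le_floor_iff floor_le_iff)
      finally show "(\<Sum>k\<in>{- int N..int N}. indicator {real_of_int k..<real_of_int k + 1} t *\<^sub>R f t) =
         indicator {- real N..<real N + 1} t *\<^sub>R f t" by (auto simp: indicator_def)
    qed simp
    finally show ?thesis .
  qed
  show ?thesis unfolding eq
  proof (rule integral_dominated_convergence[where w = "\<lambda>t. norm (f t)"])
    show "AE t in lborel. (\<lambda>N. indicator {- real N..<real N + 1} t *\<^sub>R f t) \<longlonglongrightarrow> f t"
    proof (rule AE_I2)
      fix t :: real
      obtain N0 :: nat where N0: "\<bar>t\<bar> \<le> real N0" using real_arch_simple by blast
      have "\<forall>\<^sub>F N in sequentially. indicator {- real N..<real N + 1} t *\<^sub>R f t = f t"
        using eventually_ge_at_top[of N0]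
      proof eventually_elim
        case (elim N)
        hence "t \<in> {- real N..<real N + 1}" using N0 by auto
        then show ?case by simp
      qed
      then show "(\<lambda>N. indicator {- real N..<real N + 1} t *\<^sub>R f t) \<longlonglongrightarrow> f t"
        by (rule tendsto_eventually)
    qed
  qed (use int in \<open>auto simp: indicator_def\<close>)
qed

text \<open>
A function of period 1 has the form \<open>q(exp (2\<pi>iz))\<close> with \<open>q\<close> holomorphic off the origin, and the
growth of \<open>P\<close> says that \<open>\<bar>q(w)\<bar>\<close> is at most a constant times \<open>max \<bar>w\<bar> (1/\<bar>w\<bar>)\<close> to the power
\<open>\<alpha> = \<sigma>/(2\<pi>) < 1\<close>. So the origin is a removable singularity, and the extension of \<open>q\<close> grows more
slowly than any nonconstant polynomial.
\<close>

lemma periodic_small_type_constant: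
  fixes P :: "complex \<Rightarrow> complex"
  assumes hol: "P holomorphic_on UNIV" and per: "\<And>z. P (z + 1) = P z"
    and \<sigma>: "0 \<le> \<sigma>" "\<sigma> < 2 * pi"
    and bd: "\<And>z. norm (P z) \<le> C * exp (\<sigma> * \<bar>Im z\<bar>)"
  shows "P z = P 0"
proof -
  define \<alpha> where "\<alpha> = \<sigma> / (2 * pi)"
  have \<alpha>: "0 \<le> \<alpha>" "\<alpha> < 1" using \<sigma> by (auto simp: \<alpha>_def)
  have C0: "C \<ge> 0" using bd[of 0] norm_ge_zero[of "P 0"] by (simp del: norm_ge_zero)
  have half: "P (z - 1 / 2) = P (z + 1 / 2)" for z
    using per[of "z - 1 / 2"] by (simp add: add.commute)
  define q where "q = (\<lambda>w. P (Ln w / (2 * pi * \<i>)))"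
  have comp: "(\<lambda>w. P (f w)) holomorphic_on S" if "f holomorphic_on S" for f S
    by (rule holomorphic_on_compose_gen[OF that hol, unfolded o_def]) auto
  have q1: "q holomorphic_on - \<real>\<^sub>\<le>\<^sub>0"
    unfolding q_def by (intro comp holomorphic_intros) auto
  \<comment> \<open>across the cut of \<open>Ln\<close>, pass to \<open>Ln (- w)\<close>: the two differ by \<open>\<pi> i\<close> up to sign, and \<open>P (z + 1/2) = P (z - 1/2)\<close>\<close>
  have q2: "q holomorphic_on - \<real>\<^sub>\<ge>\<^sub>0"
  proof -
    have "(\<lambda>w. P (Ln (- w) / (2 * pi * \<i>) + 1 / 2)) holomorphic_on - \<real>\<^sub>\<ge>\<^sub>0"
      by (intro comp holomorphic_intros)
         (auto simp: complex_nonpos_Reals_iff complex_nonneg_Reals_iff)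
    then show ?thesis
    proof (rule holomorphic_transform)
      fix w :: complex assume "w \<in> - \<real>\<^sub>\<ge>\<^sub>0"
      hence w: "w \<noteq> 0" by auto
      have "Ln w / (2 * pi * \<i>) = Ln (- w) / (2 * pi * \<i>) + 1 / 2 \<or>
            Ln w / (2 * pi * \<i>) = Ln (- w) / (2 * pi * \<i>) - 1 / 2"
        using Ln_minus[of "- w"] w by (auto simp: field_simps split: if_splits)
      then show "P (Ln (- w) / (2 * pi * \<i>) + 1 / 2) = q w"
        unfolding q_def using half by metis
    qed
  qed
  have "q holomorphic_on (- \<real>\<^sub>\<le>\<^sub>0) \<union> (- \<real>\<^sub>\<ge>\<^sub>0)"
    by (intro holomorphic_on_Un q1 q2 open_Compl closed_nonpos_Reals_complex closed_nonneg_Reals_complex)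
  moreover have "(- \<real>\<^sub>\<le>\<^sub>0) \<union> (- \<real>\<^sub>\<ge>\<^sub>0) = UNIV - {0::complex}"
    by (auto simp: complex_nonpos_Reals_iff complex_nonneg_Reals_iff complex_eq_iff)
  ultimately have holq: "q holomorphic_on UNIV - {0}" by simp
  have qb: "norm (q w) \<le> C * exp (\<alpha> * \<bar>ln (norm w)\<bar>)" if "w \<noteq> 0" for w
  proof -
    have "Im (Ln w / (2 * pi * \<i>)) = - ln (norm w) / (2 * pi)"
      using that by (simp add: Im_divide power2_eq_square)
    then show ?thesis using bd[of "Ln w / (2 * pi * \<i>)"] by (simp add: q_def \<alpha>_def abs_divide)
  qed
  have "((\<lambda>w. (w - 0) * q w) \<longlongrightarrow> 0) (at 0)"
  proof (rule Lim_null_comparison)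
    have "((\<lambda>r. C * (r * exp (\<alpha> * \<bar>ln r\<bar>))) \<longlongrightarrow> C * 0) (at_right 0)"
    proof (intro tendsto_mult tendsto_const)
      have "((\<lambda>r. r powr (1 - \<alpha>)) \<longlongrightarrow> 0) (at_right 0)" using \<alpha> by real_asymp
      moreover have "\<forall>\<^sub>F r in at_right 0. r powr (1 - \<alpha>) = r * exp (\<alpha> * \<bar>ln r\<bar>)"
        using eventually_at_right_real[of 0 1] 
      proof (rule eventually_mono)
        fix r :: real assume "r \<in> {0<..<1}"
        then show "r powr (1 - \<alpha>) = r * exp (\<alpha> * \<bar>ln r\<bar>)"
          by (simp add: powr_diff) (simp add: powr_def exp_minus field_simps)
      qed simp
      ultimately show "((\<lambda>r. r * exp (\<alpha> * \<bar>ln r\<bar>)) \<longlongrightarrow> 0) (at_right 0)"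
        by (rule Lim_transform_eventually)
    qed
    moreover have "filterlim (norm :: complex \<Rightarrow> real) (at_right 0) (at 0)"
      by (auto simp: filterlim_at eventually_at_filter intro!: tendsto_norm_zero tendsto_ident_at)
    ultimately show "((\<lambda>w::complex. C * (norm w * exp (\<alpha> * \<bar>ln (norm w)\<bar>))) \<longlongrightarrow> 0) (at 0)"
      using filterlim_compose by fastforce
    show "\<forall>\<^sub>F w in at 0. norm ((w - 0) * q w) \<le> C * (norm w * exp (\<alpha> * \<bar>ln (norm w)\<bar>))"
      unfolding eventually_at_filter
    proof (intro always_eventually allI impI)
      fix w :: complex assume "w \<noteq> 0"
      from mult_left_mono[OF qb[OF this] norm_ge_zero[of w]]
      show "norm ((w - 0) * q w) \<le> C * (norm w * exp (\<alpha> * \<bar>ln (norm w)\<bar>))"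
        by (simp add: norm_mult mult_ac)
    qed
  qed
  then obtain g where g: "g holomorphic_on UNIV" "\<And>w. w \<noteq> 0 \<Longrightarrow> g w = q w"
    using holomorphic_on_extend_lim[of q UNIV 0] holq by auto
  have gb: "norm (g w) \<le> C * norm w powr \<alpha>" if "norm w \<ge> 1" for w
  proof -
    have w: "w \<noteq> 0" using that by auto
    have "norm (g w) \<le> C * exp (\<alpha> * \<bar>ln (norm w)\<bar>)" using qb[OF w] g(2)[OF w] by simp
    also have "\<bar>ln (norm w)\<bar> = ln (norm w)" using that by simp
    finally show ?thesis using w by (simp add: powr_def)
  qed
  have lin: "g w = g 0 + deriv g 0 * w" for w
  proof -
    have "g w = (\<Sum>k\<le>1. (deriv ^^ k) g 0 / fact k * w ^ k)"
    proof (rule Liouville_polynomial[OF g(1)])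
      fix w :: complex assume w: "1 \<le> norm w"
      have "norm (g w) \<le> C * norm w powr \<alpha>" using gb[OF w] .
      also have "\<dots> \<le> C * norm w powr 1" using w \<alpha> C0 by (intro mult_left_mono powr_mono) auto
      finally show "norm (g w) \<le> C * norm w ^ 1" using w by simp
    qed
    then show ?thesis by simp
  qed
  have "deriv g 0 = 0"
  proof (rule ccontr)
    assume b: "deriv g 0 \<noteq> 0"
    define b where "b = norm (deriv g 0)"
    have bpos: "b > 0" using b by (simp add: b_def)
    define a where "a = norm (g 0)"
    \<comment> \<open>a positive constant and an exponent strictly between 0 and 1, so that the leading terms below are definite\<close>
    define C' \<beta> where "C' = C + 1" and "\<beta> = (1 + \<alpha>) / 2"
    have C': "C' > 0" "C \<le> C'" and \<beta>: "0 < \<beta>" "\<beta> < 1" "\<alpha> \<le> \<beta>"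
      using C0 \<alpha> by (auto simp: C'_def \<beta>_def)
    have le: "b * r \<le> a + C' * r powr \<beta>" if "r \<ge> 1" for r
    proof -
      have "norm (deriv g 0 * of_real r) \<le> norm (g (of_real r)) + norm (g 0)"
        using lin[of "of_real r"] norm_triangle_ineq4[of "g (of_real r)" "g 0"] by simp
      also have "norm (g (of_real r)) \<le> C * r powr \<alpha>" using gb[of "of_real r"] that by simp
      also have "C * r powr \<alpha> \<le> C' * r powr \<beta>"
        using C' \<beta> that C0 by (intro mult_mono powr_mono) auto
      finally show ?thesis using that by (simp add: norm_mult a_def b_def)
    qed
    have "filterlim (\<lambda>r. b * r - (a + C' * r powr \<beta>)) at_top at_top"
      using bpos C'(1) \<beta>(1,2) by real_asymp
    hence "\<forall>\<^sub>F r in at_top. b * r - (a + C' * r powr \<beta>) > 0"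
      unfolding filterlim_at_top_dense by blast
    hence "\<forall>\<^sub>F r::real in at_top. False"
      using eventually_ge_at_top[of 1]
    proof eventually_elim
      case (elim r) then show False using le[of r] by linarith
    qed
    then show False by simp
  qed
  hence const: "g w = g 0" for w using lin by simp
  have "P z = g (exp (2 * pi * \<i> * z))" for z
  proof -
    define w where "w = exp (2 * pi * \<i> * z)"
    have "exp (Ln w) = exp (2 * pi * \<i> * z)" by (simp add: w_def)
    then obtain k :: int where k: "Ln w = 2 * pi * \<i> * z + of_int (2 * k) * pi * \<i>"
      by (auto simp: exp_eq)
    have "Ln w / (2 * pi * \<i>) = z + of_int k" unfolding k by (simp add: field_simps)
    hence "q w = P (z + of_int k)" by (simp add: q_def)
    also have "\<dots> = P z"
    proof (induction k rule: int_induct[where k=0])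
      case (step1 i) then show ?case using per[of "z + of_int i"] by (simp add: add_ac)
    next
      case (step2 i) then show ?case using per[of "z + of_int (i - 1)"] by (simp add: add_ac)
    qed simp
    finally show ?thesis using g(2)[of w] by (simp add: w_def)
  qed
  then show ?thesis using const by metis
qed

lemma entire_exp_type_cont:
  "entire_exp_type \<tau> F \<Longrightarrow> continuous_on UNIV F"
  by (intro holomorphic_on_imp_continuous_on entire_exp_typeD(1))

lemma line_norm_eq_integral:
  assumes "integrable lborel (\<lambda>x. F (of_real x))"
  shows "line_norm F 0 = ennreal (LINT x|lborel. norm (F (of_real x)))"
  unfolding line_norm_def using assms by (subst nn_integral_eq_integral) auto

lemma shifts_abs_summable:
  assumes F: "entire_exp_type \<tau> F" and \<tau>: "\<tau> \<ge> 0"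
    and int: "integrable lborel (\<lambda>x. F (of_real x))"
  shows "(\<lambda>k. norm (F (z + of_int k))) summable_on UNIV"
    and "norm (\<Sum>\<^sub>\<infinity>k. F (z + of_int k)) \<le>
      2 * (LINT x|lborel. norm (F (of_real x))) * exp (\<tau> * (\<bar>Im z\<bar> + 1))"
proof -
  define M where "M = (LINT x|lborel. norm (F (of_real x)))"
  have M: "line_norm F 0 \<le> ennreal M" "M \<ge> 0"
    using line_norm_eq_integral[OF int] by (auto simp: M_def)
  note le = sum_shifts_le[OF F \<tau> M, of _ z]
  show sm: "(\<lambda>k. norm (F (z + of_int k))) summable_on UNIV"
    by (rule nonneg_bdd_above_summable_on) (auto intro!: bdd_aboveI2 le)
  have "norm (\<Sum>\<^sub>\<infinity>k. F (z + of_int k)) \<le> (\<Sum>\<^sub>\<infinity>k. norm (F (z + of_int k)))"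
    by (rule norm_infsum_bound[OF sm])
  also have "\<dots> \<le> 2 * M * exp (\<tau> * (\<bar>Im z\<bar> + 1))"
    by (rule infsum_le_finite_sums[OF sm]) (use le in auto)
  finally show "norm (\<Sum>\<^sub>\<infinity>k. F (z + of_int k)) \<le> 2 * (LINT x|lborel. norm (F (of_real x))) * exp (\<tau> * (\<bar>Im z\<bar> + 1))"
    by (simp add: M_def)
qed

text \<open>
The periodization is a locally bounded limit of its partial sums, hence entire by Montel's theorem.
It inherits the type of \<open>F\<close>, so it is constant, and the constant is its mean over a period.
\<close>

lemma Poisson_summation_small_type:
  assumes F: "entire_exp_type \<sigma> F" and \<sigma>: "0 \<le> \<sigma>" "\<sigma> < 2 * pi"
    and int: "integrable lborel (\<lambda>x. F (of_real x))"
  shows "(\<Sum>\<^sub>\<infinity>k. F (z + of_int k)) = (LINT x|lborel. F (of_real x))"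
proof -
  note hol = entire_exp_typeD(1)[OF F]
  have comp: "(\<lambda>w. F (f w)) holomorphic_on S" if "f holomorphic_on S" for f S
    by (rule holomorphic_on_compose_gen[OF that hol, unfolded o_def]) auto
  define M where "M = (LINT x|lborel. norm (F (of_real x)))"
  have M: "line_norm F 0 \<le> ennreal M" "M \<ge> 0"
    using line_norm_eq_integral[OF int] by (auto simp: M_def)
  define PN where "PN = (\<lambda>N::nat. \<lambda>z. \<Sum>k\<in>{- int N..int N}. F (z + of_int k))"
  define P where "P = (\<lambda>z. \<Sum>\<^sub>\<infinity>k. F (z + of_int k))"
  have PNP: "(\<lambda>N. PN N z) \<longlonglongrightarrow> P z" for z
    unfolding PN_def P_def
    by (rule symmetric_partial_sums_tendsto) (rule shifts_abs_summable[OF F \<sigma>(1) int])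
  have PNb: "norm (PN N z) \<le> 2 * M * exp (\<sigma> * (\<bar>Im z\<bar> + 1))" for N z
    unfolding PN_def by (rule order_trans[OF norm_sum sum_shifts_le[OF F \<sigma>(1) M]]) simp
  have holPN: "PN N holomorphic_on UNIV" for N
    unfolding PN_def by (intro holomorphic_on_sum comp holomorphic_intros)
  obtain g r where g: "g holomorphic_on UNIV" "strict_mono r"
     "\<And>x. x \<in> UNIV \<Longrightarrow> ((\<lambda>n. PN (r n) x) \<longlongrightarrow> g x) sequentially"
  proof (rule Montel[of UNIV "range PN" PN])
    fix K :: "complex set" assume "compact K"
    then obtain B where B: "\<And>z. z \<in> K \<Longrightarrow> norm z \<le> B"
      by (meson bounded_iff compact_imp_bounded)
    have "norm (PN N z) \<le> 2 * M * exp (\<sigma> * (B + 1))" if "z \<in> K" for N z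
    proof (rule order_trans[OF PNb])
      have "\<bar>Im z\<bar> \<le> B" using B[OF that] abs_Im_le_cmod[of z] by linarith
      then show "2 * M * exp (\<sigma> * (\<bar>Im z\<bar> + 1)) \<le> 2 * M * exp (\<sigma> * (B + 1))"
        using \<sigma> M by (intro mult_left_mono) (auto intro!: mult_left_mono)
    qed
    then show "\<exists>B. \<forall>h\<in>range PN. \<forall>z\<in>K. norm (h z) \<le> B" by blast
  qed (use holPN in auto)
  have "g = P"
  proof
    fix z
    have "(\<lambda>n. PN (r n) z) \<longlonglongrightarrow> P z"
      using LIMSEQ_subseq_LIMSEQ[OF PNP g(2)] by (simp add: o_def)
    then show "g z = P z" using g(3)[of z] LIMSEQ_unique by auto
  qed
  hence holP: "P holomorphic_on UNIV" using g(1) by simp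
  have per: "P (z + 1) = P z" for z
  proof -
    have "P (z + 1) = (\<Sum>\<^sub>\<infinity>k. (\<lambda>k. F (z + of_int k)) (k + 1))"
      by (simp add: P_def add_ac)
    also have "\<dots> = P z" unfolding P_def
      by (rule infsum_reindex_bij_witness[of _ "\<lambda>k. k - 1" "\<lambda>k. k + 1"]) auto
    finally show ?thesis .
  qed
  have Pb: "norm (P z) \<le> (2 * M * exp \<sigma>) * exp (\<sigma> * \<bar>Im z\<bar>)" for z
    using shifts_abs_summable(2)[OF F \<sigma>(1) int, of z]
    by (simp add: P_def M_def distrib_left exp_add mult_ac)
  have const: "P z = P 0" for z
    by (rule periodic_small_type_constant[OF holP per \<sigma> Pb])
  have "(\<lambda>N. LINT t|lborel. indicator {0..<1} t *\<^sub>R PN N (of_real t)) \<longlonglongrightarrow> (LINT t|lborel. indicator {0..<1::real} t *\<^sub>R P 0)"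
  proof (rule integral_dominated_convergence[where w = "\<lambda>t. indicator {0..<1::real} t * (2 * M * exp \<sigma>)"])
    show "integrable lborel (\<lambda>t. indicator {0..<1::real} t * (2 * M * exp \<sigma>))"
      by (intro integrable_mult_left) simp
    show "AE t in lborel. (\<lambda>N. indicator {0..<1} t *\<^sub>R PN N (of_real t)) \<longlonglongrightarrow> indicator {0..<1::real} t *\<^sub>R P 0"
      using PNP const by (intro AE_I2 tendsto_intros) metis
    show "AE t in lborel. norm (indicator {0..<1::real} t *\<^sub>R PN N (of_real t)) \<le> indicator {0..<1} t * (2 * M * exp \<sigma>)" for N
      using PNb[of N "of_real _"] by (intro AE_I2) (auto simp: indicator_def)
    have "continuous_on UNIV (\<lambda>t::real. PN N (of_real t))" for N
      using continuous_on_line[OF holomorphic_on_imp_continuous_on[OF holPN[of N]], of UNIV 0] by simp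
    hence [measurable]: "(\<lambda>t::real. PN N (of_real t)) \<in> borel_measurable borel" for N
      by (rule borel_measurable_continuous_onI)
    show "(\<lambda>t::real. indicator {0..<1} t *\<^sub>R PN N (of_real t)) \<in> borel_measurable lborel" for N
      by measurable
  qed auto
  moreover have "(\<lambda>N. LINT t|lborel. indicator {0..<1} t *\<^sub>R PN N (of_real t)) \<longlonglongrightarrow> (LINT t|lborel. F (of_real t))"
    using integral_window_sums_tendsto[OF int] by (simp add: PN_def)
  ultimately have "(LINT t|lborel. indicator {0..<1::real} t *\<^sub>R P 0) = (LINT t|lborel. F (of_real t))"
    by (rule LIMSEQ_unique)
  hence "P 0 = (LINT t|lborel. F (of_real t))" by simp
  then show ?thesis using const[of z] by (simp add: P_def)
qed

lemma entire_exp_type_affine: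
  assumes F: "entire_exp_type \<tau> F" and \<tau>: "\<tau> \<ge> 0"
  shows "entire_exp_type (\<bar>r\<bar> * \<tau>) (\<lambda>z. F (of_real r * z + a))"
  unfolding entire_exp_type_def
proof (intro conjI allI impI)
  show "(\<lambda>z. F (of_real r * z + a)) holomorphic_on UNIV"
    by (rule holomorphic_on_compose_gen[of _ UNIV F UNIV, unfolded o_def])
       (auto intro!: holomorphic_intros entire_exp_typeD(1)[OF F])
  fix \<epsilon> :: real assume \<epsilon>: "\<epsilon> > 0"
  define \<eta> where "\<eta> = \<epsilon> / (\<bar>r\<bar> + 1)"
  have \<eta>: "\<eta> > 0" "\<bar>r\<bar> * \<eta> \<le> \<epsilon>"
    using \<epsilon> by (auto simp: \<eta>_def field_simps add_nonneg_pos)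
  obtain C where C: "C > 0" "\<And>z. norm (F z) \<le> C * exp ((\<tau> + \<eta>) * norm z)"
    using entire_exp_typeD(2)[OF F \<eta>(1)] by blast
  have "norm (F (of_real r * z + a)) \<le> (C * exp ((\<tau> + \<eta>) * norm a)) * exp ((\<bar>r\<bar> * \<tau> + \<epsilon>) * norm z)" for z
  proof -
    have "norm (of_real r * z + a) \<le> \<bar>r\<bar> * norm z + norm a"
      using norm_triangle_ineq[of "of_real r * z" a] by (simp add: norm_mult)
    hence "(\<tau> + \<eta>) * norm (of_real r * z + a) \<le> (\<tau> + \<eta>) * (\<bar>r\<bar> * norm z + norm a)"
      using \<tau> \<eta> by (intro mult_left_mono) auto
    also have "\<dots> = (\<bar>r\<bar> * \<tau> + \<bar>r\<bar> * \<eta>) * norm z + (\<tau> + \<eta>) * norm a" by (simp add: algebra_simps)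
    also have "\<dots> \<le> (\<bar>r\<bar> * \<tau> + \<epsilon>) * norm z + (\<tau> + \<eta>) * norm a"
      using \<eta> by (intro add_right_mono mult_right_mono) auto
    finally have "exp ((\<tau> + \<eta>) * norm (of_real r * z + a)) \<le> exp ((\<bar>r\<bar> * \<tau> + \<epsilon>) * norm z + (\<tau> + \<eta>) * norm a)"
      by simp
    then show ?thesis using C(1) C(2)[of "of_real r * z + a"]
      by (smt (verit) exp_add mult.assoc mult.commute mult_left_mono)
  qed
  then show "\<exists>C>0. \<forall>z. norm (F (of_real r * z + a)) \<le> C * exp ((\<bar>r\<bar> * \<tau> + \<epsilon>) * norm z)"
    using C(1) by (intro exI[of _ "C * exp ((\<tau> + \<eta>) * norm a)"]) auto
qed

lemma entire_exp_type_mono: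
  assumes "entire_exp_type \<tau> F" "\<tau> \<le> \<tau>'" shows "entire_exp_type \<tau>' F"
  unfolding entire_exp_type_def
proof (intro conjI allI impI entire_exp_typeD(1)[OF assms(1)])
  fix \<epsilon> :: real assume "\<epsilon> > 0"
  then obtain C where C: "C > 0" "\<And>z. norm (F z) \<le> C * exp ((\<tau> + \<epsilon>) * norm z)"
    using entire_exp_typeD(2)[OF assms(1)] by blast
  have "norm (F z) \<le> C * exp ((\<tau>' + \<epsilon>) * norm z)" for z
  proof (rule order_trans[OF C(2)])
    show "C * exp ((\<tau> + \<epsilon>) * norm z) \<le> C * exp ((\<tau>' + \<epsilon>) * norm z)"
      using C(1) assms(2) by (simp add: mult_right_mono)
  qed
  then show "\<exists>C>0. \<forall>z. norm (F z) \<le> C * exp ((\<tau>' + \<epsilon>) * norm z)" using C(1) by blast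
qed

lemma entire_exp_type_diff:
  assumes F: "entire_exp_type \<tau> F" and G: "entire_exp_type \<tau> G"
  shows "entire_exp_type \<tau> (\<lambda>z. F z - G z)"
  unfolding entire_exp_type_def
proof (intro conjI allI impI)
  show "(\<lambda>z. F z - G z) holomorphic_on UNIV"
    by (intro holomorphic_intros entire_exp_typeD(1)[OF F] entire_exp_typeD(1)[OF G])
  fix \<epsilon> :: real assume \<epsilon>: "\<epsilon> > 0"
  obtain C where C: "C > 0" "\<And>z. norm (F z) \<le> C * exp ((\<tau> + \<epsilon>) * norm z)"
    using entire_exp_typeD(2)[OF F \<epsilon>] by blast
  obtain D where D: "D > 0" "\<And>z. norm (G z) \<le> D * exp ((\<tau> + \<epsilon>) * norm z)"
    using entire_exp_typeD(2)[OF G \<epsilon>] by blast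
  have "norm (F z - G z) \<le> (C + D) * exp ((\<tau> + \<epsilon>) * norm z)" for z
    using norm_triangle_ineq4[of "F z" "G z"] C(2)[of z] D(2)[of z] by (simp add: distrib_right)
  then show "\<exists>C>0. \<forall>z. norm (F z - G z) \<le> C * exp ((\<tau> + \<epsilon>) * norm z)"
    using C(1) D(1) by (intro exI[of _ "C + D"]) auto
qed

lemma entire_exp_type_mult:
  assumes F: "entire_exp_type \<sigma> F" and G: "entire_exp_type \<tau> G"
  shows "entire_exp_type (\<sigma> + \<tau>) (\<lambda>z. F z * G z)"
  unfolding entire_exp_type_def
proof (intro conjI allI impI)
  show "(\<lambda>z. F z * G z) holomorphic_on UNIV"
    by (intro holomorphic_intros entire_exp_typeD(1)[OF F] entire_exp_typeD(1)[OF G])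
  fix \<epsilon> :: real assume \<epsilon>: "\<epsilon> > 0"
  obtain C where C: "C > 0" "\<And>z. norm (F z) \<le> C * exp ((\<sigma> + \<epsilon> / 2) * norm z)"
    using entire_exp_typeD(2)[OF F, of "\<epsilon> / 2"] \<epsilon> by auto
  obtain D where D: "D > 0" "\<And>z. norm (G z) \<le> D * exp ((\<tau> + \<epsilon> / 2) * norm z)"
    using entire_exp_typeD(2)[OF G, of "\<epsilon> / 2"] \<epsilon> by auto
  have "norm (F z * G z) \<le> (C * D) * exp ((\<sigma> + \<tau> + \<epsilon>) * norm z)" for z
  proof -
    have "norm (F z * G z) \<le> (C * exp ((\<sigma> + \<epsilon> / 2) * norm z)) * (D * exp ((\<tau> + \<epsilon> / 2) * norm z))"
      unfolding norm_mult using C D by (intro mult_mono) auto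
    also have "\<dots> = (C * D) * (exp ((\<sigma> + \<epsilon> / 2) * norm z) * exp ((\<tau> + \<epsilon> / 2) * norm z))"
      by (simp only: mult_ac)
    also have "\<dots> = (C * D) * exp ((\<sigma> + \<tau> + \<epsilon>) * norm z)"
      unfolding exp_add[symmetric] by (simp add: algebra_simps)
    finally show ?thesis .
  qed
  then show "\<exists>C>0. \<forall>z. norm (F z * G z) \<le> C * exp ((\<sigma> + \<tau> + \<epsilon>) * norm z)"
    using C(1) D(1) by (intro exI[of _ "C * D"]) auto
qed

lemma infsum_minus_eq:
  fixes f g :: "'a \<Rightarrow> complex"
  assumes "f summable_on A" "g summable_on A"
  shows "infsum f A - infsum g A = (\<Sum>\<^sub>\<infinity>x\<in>A. f x - g x)"
  using infsum_add[of f A "\<lambda>x. - g x"] assms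
  by (simp add: infsum_uminus summable_on_uminus)

text \<open>
The dilates \<open>F(r z)\<close> with \<open>r < 1\<close> have smaller type and converge to \<open>F\<close> in \<open>L\<^sup>1\<close> as \<open>r\<close> tends to 1, by
Scheffe's lemma; both sides of the formula are continuous in the \<open>L\<^sup>1\<close> norm on functions of type
\<open>2\<pi>\<close>.
\<close>

theorem Poisson_summation_type_2pi:
  assumes F: "entire_exp_type (2 * pi) F" and int: "integrable lborel (\<lambda>x. F (of_real x))"
  shows "(\<Sum>\<^sub>\<infinity>k. F (of_real x + of_int k)) = (LINT x|lborel. F (of_real x))"
proof -
  define r where "r = (\<lambda>n::nat. 1 - 1 / (real n + 2))"
  have r: "0 < r n" "r n < 1" for n by (auto simp: r_def field_simps)
  have r_lim: "r \<longlonglongrightarrow> 1" unfolding r_def by real_asymp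
  define G where "G = (\<lambda>n z. F (of_real (r n) * z))"
  have G_type: "entire_exp_type (r n * (2 * pi)) (G n)" for n
    using entire_exp_type_affine[OF F, of "r n" 0] r[of n] by (simp add: G_def)
  have G_type': "entire_exp_type (2 * pi) (G n)" for n
    by (rule entire_exp_type_mono[OF G_type]) (use r[of n] in auto)
  have contF: "continuous_on UNIV F" by (rule entire_exp_type_cont[OF F])
  have G_int: "integrable lborel (\<lambda>x. G n (of_real x))"
    and G_eq: "(LINT x|lborel. G n (of_real x)) = (LINT x|lborel. F (of_real x)) /\<^sub>R r n" for n
  proof -
    show "integrable lborel (\<lambda>x. G n (of_real x))"
      using lborel_integrable_real_affine[OF int, of "r n" 0] r[of n] by (simp add: G_def)
    show "(LINT x|lborel. G n (of_real x)) = (LINT x|lborel. F (of_real x)) /\<^sub>R r n"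
      using lborel_integral_real_affine[of "r n" "\<lambda>x. F (of_real x)" 0] r[of n]
      by (simp add: G_def)
  qed
  have G_nn: "(\<integral>\<^sup>+ x. norm (G n (of_real x)) \<partial>lborel) = ennreal ((LINT x|lborel. norm (F (of_real x))) / r n)" for n
  proof -
    have "(\<integral>\<^sup>+ x. norm (G n (of_real x)) \<partial>lborel) = ennreal (LINT x|lborel. norm (G n (of_real x)))"
      using G_int[of n] by (intro nn_integral_eq_integral) auto
    also have "(LINT x|lborel. norm (G n (of_real x))) = (LINT x|lborel. norm (F (of_real x))) / r n"
      using lborel_integral_real_affine[of "r n" "\<lambda>x. norm (F (of_real x))" 0] r[of n]
      by (simp add: G_def field_simps)
    finally show ?thesis .
  qed
  have "(\<lambda>n. \<integral>\<^sup>+ x. norm (G n (of_real x) - F (of_real x)) \<partial>lborel) \<longlonglongrightarrow> 0"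
  proof (rule Scheffe_lemma1[OF G_int int])
    show "AE x in lborel. (\<lambda>n. G n (of_real x)) \<longlonglongrightarrow> F (of_real x)"
    proof (rule AE_I2)
      fix x :: real
      have "(\<lambda>n. of_real (r n) * of_real x) \<longlonglongrightarrow> (of_real 1 * of_real x :: complex)"
        by (intro tendsto_intros r_lim)
      then show "(\<lambda>n. G n (of_real x)) \<longlonglongrightarrow> F (of_real x)"
        unfolding G_def using contF
        by (intro continuous_on_tendsto_compose[OF contF]) auto
    qed
    have "(\<lambda>n. ennreal ((LINT x|lborel. norm (F (of_real x))) / r n)) \<longlonglongrightarrow> ennreal ((LINT x|lborel. norm (F (of_real x))) / 1)"
      by (intro tendsto_ennrealI tendsto_intros r_lim) simp
    hence "limsup (\<lambda>n. \<integral>\<^sup>+ x. norm (G n (of_real x)) \<partial>lborel) = ennreal (LINT x|lborel. norm (F (of_real x)))"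
      unfolding G_nn by (intro lim_imp_Limsup) auto
    also have "\<dots> = (\<integral>\<^sup>+ x. norm (F (of_real x)) \<partial>lborel)"
      using int by (intro nn_integral_eq_integral[symmetric]) auto
    finally show "limsup (\<lambda>n. \<integral>\<^sup>+ x. norm (G n (of_real x)) \<partial>lborel) \<le> (\<integral>\<^sup>+ x. norm (F (of_real x)) \<partial>lborel)"
      by simp
  qed
  also have "(\<lambda>n. \<integral>\<^sup>+ x. norm (G n (of_real x) - F (of_real x)) \<partial>lborel) =
             (\<lambda>n. ennreal (LINT x|lborel. norm (G n (of_real x) - F (of_real x))))"
    using G_int int by (intro ext nn_integral_eq_integral) auto
  finally have L1: "(\<lambda>n. LINT x|lborel. norm (G n (of_real x) - F (of_real x))) \<longlonglongrightarrow> 0"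
    by (subst (asm) ennreal_0[symmetric], subst (asm) tendsto_ennreal_iff) auto
  have sumG: "(\<Sum>\<^sub>\<infinity>k. G n (of_real x + of_int k)) = (LINT x|lborel. F (of_real x)) /\<^sub>R r n" for n
    unfolding G_eq[symmetric]
    by (rule Poisson_summation_small_type[OF G_type _ _ G_int]) (use r[of n] in auto)
  have smF: "(\<lambda>k. F (of_real x + of_int k)) summable_on UNIV"
    by (rule abs_summable_summable) (rule shifts_abs_summable[OF F _ int], simp)
  have smG: "(\<lambda>k. G n (of_real x + of_int k)) summable_on UNIV" for n
    by (rule abs_summable_summable) (rule shifts_abs_summable[OF G_type' _ G_int], simp)
  have bnd: "norm ((\<Sum>\<^sub>\<infinity>k. G n (of_real x + of_int k)) - (\<Sum>\<^sub>\<infinity>k. F (of_real x + of_int k)))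
        \<le> 2 * (LINT x|lborel. norm (G n (of_real x) - F (of_real x))) * exp (2 * pi)" for n
    using shifts_abs_summable(2)[OF entire_exp_type_diff[OF G_type'[of n] F], of "of_real x"] G_int[of n] int
    by (simp add: infsum_minus_eq[OF smG smF])
  have "(\<lambda>n. 2 * (LINT x|lborel. norm (G n (of_real x) - F (of_real x))) * exp (2 * pi)) \<longlonglongrightarrow> 2 * 0 * exp (2 * pi)"
    by (intro tendsto_intros L1)
  hence lim: "(\<lambda>n. 2 * (LINT x|lborel. norm (G n (of_real x) - F (of_real x))) * exp (2 * pi)) \<longlonglongrightarrow> 0"
    by (simp only: mult_zero_right mult_zero_left)
  have "(\<lambda>n. (\<Sum>\<^sub>\<infinity>k. G n (of_real x + of_int k)) - (\<Sum>\<^sub>\<infinity>k. F (of_real x + of_int k))) \<longlonglongrightarrow> 0"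
    by (rule Lim_null_comparison[OF always_eventually[OF allI[OF bnd]] lim])
  hence "(\<lambda>n. (\<Sum>\<^sub>\<infinity>k. G n (of_real x + of_int k))) \<longlonglongrightarrow> (\<Sum>\<^sub>\<infinity>k. F (of_real x + of_int k))"
    by (rule LIM_zero_cancel)
  moreover have "(\<lambda>n. (\<Sum>\<^sub>\<infinity>k. G n (of_real x + of_int k))) \<longlonglongrightarrow> (LINT x|lborel. F (of_real x)) /\<^sub>R 1"
    unfolding sumG by (intro tendsto_intros r_lim) simp
  ultimately show ?thesis using LIMSEQ_unique by fastforce
qed

section \<open>Functions of type 2 pi with double zeros\<close>

text \<open>
Removability is a local matter: near each point the extension agrees with a holomorphic function.
\<close>

lemma remove_sings_holomorphic:
  assumes local: "\<And>z0. \<exists>r>0. \<exists>g. g holomorphic_on ball z0 r \<and> (\<forall>w\<in>ball z0 r - {z0}. f w = g w)"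
  shows "remove_sings f holomorphic_on UNIV"
proof -
  have "remove_sings f field_differentiable at z0" for z0
  proof -
    obtain r g where r: "r > 0" and g: "g holomorphic_on ball z0 r"
      and fg: "\<And>w. w \<in> ball z0 r - {z0} \<Longrightarrow> f w = g w" using local by blast
    have eq: "remove_sings f w = g w" if w: "w \<in> ball z0 r" for w
    proof (rule remove_sings_eqI)
      have "isCont g w"
        using holomorphic_on_imp_continuous_on[OF g] w by (simp add: continuous_on_eq_continuous_at)
      hence "g \<midarrow>w\<rightarrow> g w" by (rule isContD)
      moreover have "\<forall>\<^sub>F v in at w. g v = f v"
      proof -
        have "\<forall>\<^sub>F v in at w. v \<in> ball z0 r"
          using w by (intro eventually_at_in_open') auto
        moreover have "\<forall>\<^sub>F v in at w. v \<noteq> z0"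
          by (rule eventually_neq_at_within)
        ultimately show ?thesis by eventually_elim (simp add: fg)
      qed
      ultimately show "f \<midarrow>w\<rightarrow> g w" by (rule Lim_transform_eventually)
    qed
    have "remove_sings f holomorphic_on ball z0 r"
      using g by (rule holomorphic_transform) (simp add: eq)
    then show ?thesis using r by (simp add: holomorphic_on_imp_differentiable_at)
  qed
  then show ?thesis by (simp add: holomorphic_on_def field_differentiable_at_within)
qed

lemma factor_zero:
  fixes f :: "complex \<Rightarrow> complex"
  assumes "f holomorphic_on UNIV" "f a = 0"
  obtains g where "g holomorphic_on UNIV" "\<And>z. f z = (z - a) * g z" "g a = deriv f a"
proof (rule that)
  show "(\<lambda>z. if z = a then deriv f a else (f z - f a) / (z - a)) holomorphic_on UNIV"
    by (rule pole_lemma_open[OF assms(1)]) simp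
qed (use assms in auto)

text \<open>
Up to a constant, \<open>\<bar>sin (\<pi> z)\<bar>\<^sup>2\<close> is as large as its growth permits away from the integers. The set
in question contains the boundaries of the rectangles of width 1 and height 2 around the integers.
\<close>

lemma sin_pi_lower_bound:
  assumes "\<bar>Im z\<bar> \<ge> 1 \<or> (\<exists>k::int. Re z = of_int k + 1 / 2)"
  shows "exp (2 * pi * \<bar>Im z\<bar>) / 8 \<le> (norm (sin (of_real pi * z)))\<^sup>2"
proof -
  define b where "b = 2 * pi * Im z"
  have eq: "(norm (sin (of_real pi * z)))\<^sup>2 = (exp b + exp (- b) - 2 * cos (2 * pi * Re z)) / 4"
    unfolding norm_sin_squared by (simp add: b_def exp_minus mult_ac)
  have ge: "exp \<bar>b\<bar> \<le> exp b + exp (- b)" by (cases "b \<ge> 0") auto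
  have ab: "\<bar>b\<bar> = 2 * pi * \<bar>Im z\<bar>" by (simp add: b_def abs_mult)
  show ?thesis
  proof (cases "\<bar>Im z\<bar> \<ge> 1")
    case True
    have "\<bar>b\<bar> \<ge> 3"
      using mult_mono[of "2 * 2" "2 * pi" 1 "\<bar>Im z\<bar>"] True pi_ge_two by (simp add: ab)
    hence "exp \<bar>b\<bar> \<ge> 4" using exp_ge_add_one_self[of "\<bar>b\<bar>"] by linarith
    moreover have "cos (2 * pi * Re z) \<le> 1" by simp
    moreover have "e / 8 \<le> (s - 2 * c) / 4" if "4 \<le> e" "c \<le> 1" "e \<le> s" for e s c :: real
      using that by (simp add: field_simps)
    ultimately show ?thesis using ge unfolding eq ab[symmetric] by blast
  next
    case False
    then obtain k :: int where k: "Re z = of_int k + 1 / 2" using assms by auto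
    have "cos (2 * pi * Re z) = cos (2 * pi * of_int k + pi)" by (simp add: k algebra_simps)
    also have "\<dots> = - 1" by (simp add: cos_add)
    finally show ?thesis using ge unfolding eq ab[symmetric] by simp (smt (verit) exp_ge_zero)
  qed
qed

text \<open>
The quotient of \<open>F\<close> by \<open>sin\<^sup>2 (\<pi> z)\<close> is entire. It is bounded off the rectangles around the integers,
and inside them by the maximum principle, so it is a constant \<open>c\<close>; and \<open>c sin\<^sup>2 (\<pi> z)\<close> takes the
value \<open>c\<close> at all half-integers, which contradicts the bound for sums over translates unless
\<open>c = 0\<close>.
\<close>

theorem double_zeros_at_integers_imp_zero:
  assumes F: "entire_exp_type (2 * pi) F" and int: "integrable lborel (\<lambda>x. F (of_real x))"
    and zero: "\<And>k::int. F (of_int k) = 0" "\<And>k::int. deriv F (of_int k) = 0"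
  shows "F z = 0"
proof -
  note hol = entire_exp_typeD(1)[OF F]
  define M where "M = (LINT x|lborel. norm (F (of_real x)))"
  have M: "line_norm F 0 \<le> ennreal M" "M \<ge> 0"
    using line_norm_eq_integral[OF int] by (auto simp: M_def)
  define B where "B = 2 * M * exp (2 * pi)"
  have B0: "B \<ge> 0" using M by (simp add: B_def)
  have shifts: "(\<Sum>k\<in>K. norm (F (z + of_int k))) \<le> B * exp (2 * pi * \<bar>Im z\<bar>)" if "finite K" for z K
    using sum_shifts_le[OF F _ M that, of z] by (simp add: B_def distrib_left exp_add mult_ac)
  have Fb: "norm (F z) \<le> B * exp (2 * pi * \<bar>Im z\<bar>)" for z
    using shifts[of "{0}" z] by simp
  define S where "S = (\<lambda>z::complex. (sin (of_real pi * z))\<^sup>2)"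
  have holS: "S holomorphic_on A" for A unfolding S_def by (intro holomorphic_intros)
  define f where "f = (\<lambda>z. F z / S z)"
  define K where "K = remove_sings f"
  have S0: "S z = 0 \<longleftrightarrow> z \<in> \<int>" for z
    by (auto simp: S_def sin_eq_0 Ints_def)
  have locint: "\<exists>g. g holomorphic_on ball (of_int k) 1 \<and> (\<forall>w\<in>ball (of_int k) 1 - {of_int k}. f w = g w)" for k :: int
  proof -
    obtain A1 where A1: "A1 holomorphic_on UNIV" "\<And>z. F z = (z - of_int k) * A1 z" "A1 (of_int k) = 0"
      using factor_zero[OF hol zero(1)[of k]] zero(2) by metis
    obtain A where A: "A holomorphic_on UNIV" "\<And>z. A1 z = (z - of_int k) * A z"
      using factor_zero[OF A1(1,3)] by metis
    have "(\<lambda>z::complex. sin (of_real pi * z)) holomorphic_on UNIV" by (intro holomorphic_intros)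
    moreover have "sin (of_real pi * complex_of_int k) = 0" by (auto simp: sin_eq_0)
    moreover have "deriv (\<lambda>z::complex. sin (of_real pi * z)) (of_int k) = of_real pi * cos (of_real pi * of_int k)"
      by (rule DERIV_imp_deriv) (auto intro!: derivative_eq_intros)
    ultimately obtain C where C: "C holomorphic_on UNIV" "\<And>z. sin (of_real pi * z) = (z - of_int k) * C z"
      "C (of_int k) = of_real pi * cos (of_real pi * of_int k)"
      by (metis factor_zero)
    have "cos (of_real pi * complex_of_int k) \<noteq> 0"
      using sin_cos_squared_add[of "of_real pi * complex_of_int k"]
        \<open>sin (of_real pi * complex_of_int k) = 0\<close> by auto
    hence Ck: "C (of_int k) \<noteq> 0" using C(3) by simp
    have Cnz: "C w \<noteq> 0" if "w \<in> ball (of_int k) 1" for w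
    proof (cases "w = of_int k")
      case False
      have "w \<notin> \<int>"
      proof
        assume "w \<in> \<int>"
        then obtain j :: int where j: "w = of_int j" by (auto elim: Ints_cases)
        have "dist (complex_of_int k) (of_int j) = \<bar>of_int (k - j)\<bar>"
          by (metis dist_norm norm_of_int of_int_diff of_int_abs)
        hence "\<bar>k - j\<bar> < 1" using that j by simp
        then show False using False j by simp
      qed
      hence "sin (of_real pi * w) \<noteq> 0" using S0[of w] by (simp add: S_def)
      then show ?thesis using C(2)[of w] by auto
    qed (use Ck in simp)
    have "(\<lambda>w. A w / (C w)\<^sup>2) holomorphic_on ball (of_int k) 1"
      using Cnz by (intro holomorphic_intros holomorphic_on_subset[OF A(1)] holomorphic_on_subset[OF C(1)]) auto
    moreover have "f w = A w / (C w)\<^sup>2" if "w \<in> ball (of_int k) 1 - {of_int k}" for w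
      using that A1(2)[of w] A(2)[of w] C(2)[of w] by (simp add: f_def S_def power_mult_distrib power2_eq_square)
    ultimately show ?thesis by blast
  qed
  have holK: "K holomorphic_on UNIV" unfolding K_def
  proof (rule remove_sings_holomorphic)
    fix z0 :: complex
    show "\<exists>r>0. \<exists>g. g holomorphic_on ball z0 r \<and> (\<forall>w\<in>ball z0 r - {z0}. f w = g w)"
    proof (cases "z0 \<in> \<int>")
      case True
      then obtain k :: int where "z0 = of_int k" by (auto elim: Ints_cases)
      then show ?thesis using locint[of k] by (intro exI[of _ 1]) auto
    next
      case False
      have "open (- \<int> :: complex set)" using closed_Ints by (simp add: open_Compl)
      then obtain r where r: "r > 0" "ball z0 r \<subseteq> - \<int>" using False by (auto elim: openE)
      have "f holomorphic_on ball z0 r" unfolding f_def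
        using r S0 by (intro holomorphic_intros holS holomorphic_on_subset[OF hol]) auto
      then show ?thesis using r by blast
    qed
  qed
  have Kf: "K w = f w" if "w \<notin> \<int>" for w
  proof -
    have "open (- \<int> :: complex set)" using closed_Ints by (simp add: open_Compl)
    moreover have "f holomorphic_on - \<int>" unfolding f_def
      using S0 by (intro holomorphic_intros holS holomorphic_on_subset[OF hol]) auto
    ultimately have "f analytic_on {w}" using that by (auto simp: analytic_at)
    then show ?thesis by (simp add: K_def)
  qed
  have KS: "F w = K w * S w" for w
  proof (cases "w \<in> \<int>")
    case True
    then show ?thesis using S0[of w] zero(1) by (auto elim!: Ints_cases)
  next
    case False
    then show ?thesis using S0[of w] Kf[of w] by (simp add: f_def)
  qed
  have edge: "norm (K w) \<le> 8 * B" if "\<bar>Im w\<bar> \<ge> 1 \<or> (\<exists>k::int. Re w = of_int k + 1 / 2)" for w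
  proof -
    have low: "exp (2 * pi * \<bar>Im w\<bar>) / 8 \<le> norm (S w)"
      using sin_pi_lower_bound[OF that] by (simp add: S_def norm_power)
    have "norm (K w) * (exp (2 * pi * \<bar>Im w\<bar>) / 8) \<le> norm (K w) * norm (S w)"
      by (intro mult_left_mono low) auto
    also have "\<dots> \<le> B * exp (2 * pi * \<bar>Im w\<bar>)" using Fb[of w] KS[of w] by (simp add: norm_mult)
    finally have "norm (K w) * exp (2 * pi * \<bar>Im w\<bar>) \<le> (8 * B) * exp (2 * pi * \<bar>Im w\<bar>)" by simp
    then show ?thesis by (rule mult_right_le_imp_le) simp
  qed
  have "norm (K w) \<le> 8 * B" for w
  proof (cases "\<bar>Im w\<bar> \<ge> 1")
    case True then show ?thesis using edge by blast
  next
    case False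
    define k where "k = \<lfloor>Re w + 1 / 2\<rfloor>"
    have k: "of_int k - 1 / 2 \<le> Re w" "Re w \<le> of_int k + 1 / 2" unfolding k_def by linarith+
    define a b where "a = Complex (of_int k - 1 / 2) (-1)" and "b = Complex (of_int k + 1 / 2) 1"
    show ?thesis
    proof (rule maximum_modulus_frontier[of K "cbox a b"])
      show "K holomorphic_on interior (cbox a b)" using holK by (rule holomorphic_on_subset) auto
      show "continuous_on (closure (cbox a b)) K"
        using holomorphic_on_imp_continuous_on[OF holK] by (rule continuous_on_subset) auto
      show "w \<in> cbox a b" using k False by (auto simp: a_def b_def in_cbox_complex_iff)
      fix v assume "v \<in> frontier (cbox a b)"
      hence "v \<in> cbox a b" "v \<notin> box a b" by (auto simp: frontier_cbox)
      hence "\<bar>Im v\<bar> \<ge> 1 \<or> Re v = of_int k + 1 / 2 \<or> Re v = of_int (k - 1) + 1 / 2"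
        by (auto simp: a_def b_def in_cbox_complex_iff in_box_complex_iff)
      then show "norm (K v) \<le> 8 * B" using edge by blast
    qed auto
  qed
  then obtain c where c: "\<And>w. K w = c"
    using Liouville_theorem[OF holK] by (auto simp: bounded_iff constant_on_def)
  have "c = 0"
  proof (rule ccontr)
    assume "c \<noteq> 0"
    have one: "F (1 / 2 + of_int k) = c" for k :: int
    proof -
      have "S (1 / 2 + of_int k) = 1"
      proof -
        have "(cos (complex_of_real pi * (1 / 2 + of_int k))) = 0"
          by (auto simp: cos_eq_0 algebra_simps)
        then show ?thesis unfolding S_def
          using sin_cos_squared_add[of "complex_of_real pi * (1 / 2 + of_int k)"] by simp
      qed
      then show ?thesis using KS[of "1 / 2 + of_int k"] c by simp
    qed
    obtain N :: nat where N: "B < real N * norm c"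
      using \<open>c \<noteq> 0\<close> reals_Archimedean3[of "norm c"] by auto
    have "(\<Sum>k\<in>{1..int N}. norm (F (1 / 2 + of_int k))) \<le> B * exp (2 * pi * \<bar>Im (1 / 2)\<bar>)"
      by (rule shifts) simp
    then show False using N by (simp add: one)
  qed
  then show ?thesis using KS c by simp
qed

section \<open>The kernel of the interpolation formula\<close>

lemma nn_integral_power_exp:
  fixes a :: real
  assumes a: "a > 0"
  shows "(\<integral>\<^sup>+ y. ennreal (y ^ k * exp (- a * y)) * indicator {0<..} y \<partial>lborel) = ennreal (fact k / a ^ (k + 1))"
proof -
  have "ennreal (fact k) = (\<integral>\<^sup>+ x. ennreal (x ^ k * exp (- x)) * indicator {0..} x \<partial>lborel)"
    by (simp add: nn_intergal_power_times_exp_Ici)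
  also have "\<dots> = ennreal a * (\<integral>\<^sup>+ y. ennreal ((a * y) ^ k * exp (- (a * y))) * indicator {0..} (a * y) \<partial>lborel)"
    using nn_integral_real_affine[of "\<lambda>x. ennreal (x ^ k * exp (- x)) * indicator {0..} x" a 0] a by simp
  also have "(\<integral>\<^sup>+ y. ennreal ((a * y) ^ k * exp (- (a * y))) * indicator {0..} (a * y) \<partial>lborel) =
        (\<integral>\<^sup>+ y. ennreal (a ^ k) * (ennreal (y ^ k * exp (- a * y)) * indicator {0<..} y) \<partial>lborel)"
  proof (rule nn_integral_cong_AE, rule AE_mp[OF AE_lborel_singleton[of 0]], rule AE_I2, rule impI)
    fix y :: real assume "y \<noteq> 0"
    then show "ennreal ((a * y) ^ k * exp (- (a * y))) * indicator {0..} (a * y) =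
       ennreal (a ^ k) * (ennreal (y ^ k * exp (- a * y)) * indicator {0<..} y)"
      using a by (auto simp: indicator_def zero_le_mult_iff power_mult_distrib ennreal_mult' mult.assoc)
  qed
  also have "\<dots> = ennreal (a ^ k) * (\<integral>\<^sup>+ y. ennreal (y ^ k * exp (- a * y)) * indicator {0<..} y \<partial>lborel)"
    by (rule nn_integral_cmult) measurable
  finally have eq: "ennreal (fact k) = ennreal (a ^ (k + 1)) * (\<integral>\<^sup>+ y. ennreal (y ^ k * exp (- a * y)) * indicator {0<..} y \<partial>lborel)"
    using a by (simp add: ennreal_mult' mult.assoc)
  have "ennreal (fact k / a ^ (k + 1)) = ennreal (fact k) / ennreal (a ^ (k + 1))"
    using a by (simp add: divide_ennreal)
  also have "\<dots> = (\<integral>\<^sup>+ y. ennreal (y ^ k * exp (- a * y)) * indicator {0<..} y \<partial>lborel)"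
    unfolding eq mult.commute[of "ennreal (a ^ (k + 1))"] using a by (intro ennreal_mult_divide_eq) auto
  finally show ?thesis by simp
qed

lemma integrable_power_exp:
  fixes a :: real
  assumes "a > 0"
  shows "integrable lborel (\<lambda>y. indicator {0<..} y * (y ^ k * exp (- a * y)))"
proof (rule integrableI_nonneg)
  have "(\<integral>\<^sup>+ y. ennreal (indicator {0<..} y * (y ^ k * exp (- a * y))) \<partial>lborel) =
        (\<integral>\<^sup>+ y. ennreal (y ^ k * exp (- a * y)) * indicator {0<..} y \<partial>lborel)"
    by (intro nn_integral_cong) (auto simp: indicator_def)
  then show "(\<integral>\<^sup>+ y. ennreal (indicator {0<..} y * (y ^ k * exp (- a * y))) \<partial>lborel) < \<infinity>"
    using nn_integral_power_exp[OF assms, of k] by simp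
qed (auto simp: indicator_def)

text \<open>
A lower bound that is sharp up to constants both at 0 and at infinity.
\<close>

lemma cosh_minus_1_ge:
  assumes "x \<ge> (0::real)"
  shows "x\<^sup>2 * exp x / (2 * (1 + x)\<^sup>2) \<le> cosh x - 1"
proof -
  have "x / (1 + x) \<le> 1 - exp (- x)"
  proof -
    have "exp (- x) \<le> 1 / (1 + x)"
      using exp_ge_add_one_self[of x] assms by (simp add: exp_minus field_simps)
    also have "\<dots> = 1 - x / (1 + x)" using assms by (simp add: field_simps)
    finally show ?thesis by simp
  qed
  hence "(x / (1 + x))\<^sup>2 \<le> (1 - exp (- x))\<^sup>2" using assms by (intro power_mono) auto
  hence "(x / (1 + x))\<^sup>2 * (exp x / 2) \<le> (1 - exp (- x))\<^sup>2 * (exp x / 2)" by (intro mult_right_mono) auto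
  also have "(1 - exp (- x))\<^sup>2 * (exp x / 2) = cosh x - 1"
    by (simp add: cosh_field_def exp_minus power2_eq_square field_simps)
  finally show ?thesis by (simp add: power_divide mult_ac)
qed

lemma cosh_ge_half_exp: "exp x / 2 \<le> cosh (x::real)"
  by (simp add: cosh_field_def)

text \<open>
The parameters cover the minorant \<open>(2\<pi>, 1)\<close>, the majorant \<open>(2\<pi>, -1)\<close> and the best approximation
\<open>(\<pi>, 0)\<close>. For \<open>b = -1\<close> the denominator \<open>cosh (c y) + b\<close> vanishes to second order at 0, and
\<open>n > 0\<close> is what keeps the weight below integrable against \<open>1 / (x\<^sup>2 + y\<^sup>2)\<close> for \<open>x \<noteq> 0\<close>.
\<close>

locale interpolation_kernel =
  fixes n :: nat and c b :: real
  assumes c: "c > 0" and b: "(0 \<le> b \<and> b \<le> 1) \<or> (b = - 1 \<and> n > 0)"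
begin

definition \<phi> :: "real \<Rightarrow> real" where "\<phi> y = cosh (c * y) + b"
definition \<Phi> :: "complex \<Rightarrow> complex" where "\<Phi> z = cos (of_real c * z) + of_real b"
definition w :: "real \<Rightarrow> real" where "w y = 2 * y ^ (2 * n + 1) / \<phi> y"
definition Stieltjes :: "real \<Rightarrow> complex \<Rightarrow> complex" where
  "Stieltjes R u = (LINT y|lborel. indicator {R<..} y *\<^sub>R (of_real (w y) / (u + of_real (y\<^sup>2))))"

lemma b_bounds: "- 1 \<le> b" "b \<le> 1" using b by auto

lemma \<phi>_pos: "y > 0 \<Longrightarrow> \<phi> y > 0"
  unfolding \<phi>_def
  using b_bounds cosh_real_strict_mono[of 0 "c * y"] c by simp

lemma w_nonneg: "y \<ge> 0 \<Longrightarrow> w y \<ge> 0"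
  using \<phi>_pos[of y] by (cases "y = 0") (auto simp: w_def)

text \<open>
The lower power comes from \<open>b = -1\<close>, where the denominator has a double zero at 0. That case
requires \<open>n > 0\<close>, so the natural number \<open>2 n - 1\<close> is then a true difference.
\<close>

lemma w_bound:
  assumes y: "y > 0"
  shows "w y \<le> (8 / c\<^sup>2 + 8) * ((y ^ (2 * n - 1) + y ^ (2 * n + 1)) * exp (- c * y))"
proof -
  have A: "0 \<le> y ^ (2 * n - 1) * exp (- c * y)" "0 \<le> y ^ (2 * n + 1) * exp (- c * y)" using y by auto
  have cc: "8 / c\<^sup>2 > 0" using c by simp
  show ?thesis
  proof (cases "0 \<le> b")
    case True
    have "w y \<le> 2 * y ^ (2 * n + 1) / (exp (c * y) / 2)"
      unfolding w_def using cosh_ge_half_exp[of "c * y"] True y \<phi>_pos[OF y]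
      by (intro divide_left_mono) (auto simp: \<phi>_def)
    also have "\<dots> = 4 * (y ^ (2 * n + 1) * exp (- c * y))" by (simp add: exp_minus field_simps)
    also have "\<dots> \<le> (8 / c\<^sup>2 + 8) * ((y ^ (2 * n - 1) + y ^ (2 * n + 1)) * exp (- c * y))"
    proof (rule mult_mono)
      show "y ^ (2 * n + 1) * exp (- c * y) \<le> (y ^ (2 * n - 1) + y ^ (2 * n + 1)) * exp (- c * y)"
        using A by (simp only: distrib_right)
    qed (use A cc in auto)
    finally show ?thesis .
  next
    case False
    hence bn: "b = - 1" "n > 0" using b by auto
    define x where "x = c * y"
    have x: "x > 0" using c y by (simp add: x_def)
    have "x\<^sup>2 * exp x / (2 * (1 + x)\<^sup>2) \<le> \<phi> y"
    proof -
      have "\<phi> y = cosh x + b" by (simp only: \<phi>_def x_def)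
      then show ?thesis using cosh_minus_1_ge[of x] x bn(1) by linarith
    qed
    hence "w y \<le> 2 * y ^ (2 * n + 1) / (x\<^sup>2 * exp x / (2 * (1 + x)\<^sup>2))"
      unfolding w_def using x y \<phi>_pos[OF y] by (intro divide_left_mono) auto
    also have "\<dots> = 4 * y ^ (2 * n + 1) * (1 + x)\<^sup>2 / x\<^sup>2 * exp (- x)"
      using x by (simp add: exp_minus field_simps)
    also have "y ^ (2 * n + 1) = y ^ (2 * n - 1) * y\<^sup>2"
      using bn(2) by (simp flip: power_add)
    also have "4 * (y ^ (2 * n - 1) * y\<^sup>2) * (1 + x)\<^sup>2 / x\<^sup>2 * exp (- x) =
        (4 / c\<^sup>2) * (y ^ (2 * n - 1) * (1 + x)\<^sup>2 * exp (- x))"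
      using c y by (simp add: x_def power_mult_distrib field_simps)
    also have "\<dots> \<le> (4 / c\<^sup>2) * (y ^ (2 * n - 1) * (2 + 2 * x\<^sup>2) * exp (- x))"
    proof (intro mult_left_mono mult_right_mono)
      show "(1 + x)\<^sup>2 \<le> 2 + 2 * x\<^sup>2" using sum_squares_bound[of 1 x] by (simp add: power2_sum)
    qed (use y in auto)
    also have "\<dots> = 8 / c\<^sup>2 * (y ^ (2 * n - 1) * exp (- c * y)) + 8 * (y ^ (2 * n - 1) * y\<^sup>2 * exp (- c * y))"
      using c by (simp add: x_def field_simps power2_eq_square)
    also have "y ^ (2 * n - 1) * y\<^sup>2 = y ^ (2 * n + 1)" using bn(2) by (simp flip: power_add)
    also have "8 / c\<^sup>2 * (y ^ (2 * n - 1) * exp (- c * y)) + 8 * (y ^ (2 * n + 1) * exp (- c * y)) \<le>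
       (8 / c\<^sup>2 + 8) * ((y ^ (2 * n - 1) + y ^ (2 * n + 1)) * exp (- c * y))"
      using A cc by (simp add: distrib_right distrib_left)
    finally show ?thesis .
  qed
qed

lemma w_measurable [measurable]: "w \<in> borel_measurable borel"
  unfolding w_def[abs_def] \<phi>_def cosh_field_def by measurable

lemma w_integrable: "integrable lborel (\<lambda>y. indicator {0<..} y * w y)"
proof (rule Bochner_Integration.integrable_bound)
  show "integrable lborel (\<lambda>y. (8 / c\<^sup>2 + 8) * (indicator {0<..} y * (y ^ (2 * n - 1) * exp (- c * y)) +
      indicator {0<..} y * (y ^ (2 * n + 1) * exp (- c * y))))"
    by (intro integrable_mult_right Bochner_Integration.integrable_add integrable_power_exp c)
  show "AE y in lborel. norm (indicator {0<..} y * w y) \<le> norm ((8 / c\<^sup>2 + 8) *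
      (indicator {0<..} y * (y ^ (2 * n - 1) * exp (- c * y)) + indicator {0<..} y * (y ^ (2 * n + 1) * exp (- c * y))))"
  proof (rule AE_I2)
    fix y :: real
    show "norm (indicator {0<..} y * w y) \<le> norm ((8 / c\<^sup>2 + 8) *
      (indicator {0<..} y * (y ^ (2 * n - 1) * exp (- c * y)) + indicator {0<..} y * (y ^ (2 * n + 1) * exp (- c * y))))"
      using w_bound[of y] w_nonneg[of y] by (auto simp: indicator_def distrib_right intro: order_trans[OF _ abs_ge_self])
  qed
qed measurable

lemma w_continuous: "continuous_on {0..} w"
proof (cases "0 \<le> b")
  case True
  have "cosh (c * y) + b \<noteq> 0" for y using cosh_real_pos[of "c * y"] True by linarith
  then show ?thesis unfolding w_def[abs_def] \<phi>_def
    by (intro continuous_intros) auto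
next
  case False
  hence bn: "b = - 1" "n > 0" using b by auto
  have "isCont w y" if "y > 0" for y
    unfolding w_def[abs_def] using \<phi>_pos[OF that] unfolding \<phi>_def by (intro continuous_intros) auto
  moreover have "(w \<longlongrightarrow> w 0) (at 0 within {0..})"
  proof -
    have "((\<lambda>y. (8 / c\<^sup>2 + 8) * ((y ^ (2 * n - 1) + y ^ (2 * n + 1)) * exp (- c * y))) \<longlongrightarrow>
       (8 / c\<^sup>2 + 8) * ((0 ^ (2 * n - 1) + 0 ^ (2 * n + 1)) * exp (- c * 0))) (at 0 within {0..})"
      by (intro tendsto_intros)
    hence "((\<lambda>y. (8 / c\<^sup>2 + 8) * ((y ^ (2 * n - 1) + y ^ (2 * n + 1)) * exp (- c * y))) \<longlongrightarrow> 0) (at 0 within {0..})"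
      using bn by (simp add: zero_power)
    then have "(w \<longlongrightarrow> 0) (at 0 within {0..})"
    proof (rule Lim_null_comparison[rotated])
      show "\<forall>\<^sub>F y in at 0 within {0..}. norm (w y) \<le> (8 / c\<^sup>2 + 8) * ((y ^ (2 * n - 1) + y ^ (2 * n + 1)) * exp (- c * y))"
        unfolding eventually_at_filter
        by (rule always_eventually) (use w_bound w_nonneg in \<open>auto simp: less_le\<close>)
    qed
    then show ?thesis by (simp add: w_def)
  qed
  ultimately show ?thesis unfolding continuous_on_def
    by (metis atLeast_iff continuous_at_imp_continuous_at_within continuous_within less_eq_real_def)
qed

lemma kernel_bound_integrable:
  assumes R: "R \<ge> 0" and k[measurable]: "k \<in> borel_measurable borel"
    and bd: "\<And>y. y > R \<Longrightarrow> norm (k y :: complex) \<le> K"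
  shows "integrable lborel (\<lambda>y. indicator {R<..} y *\<^sub>R (of_real (w y) * k y))"
    and "norm (LINT y|lborel. indicator {R<..} y *\<^sub>R (of_real (w y) * k y)) \<le> K * (LINT y|lborel. indicator {0<..} y * w y)"
proof -
  have le: "norm (indicator {R<..} y *\<^sub>R (of_real (w y) * k y)) \<le> K * (indicator {0<..} y * w y)" for y
  proof (cases "y > R")
    case True
    then show ?thesis using R w_nonneg[of y] mult_left_mono[OF bd[OF True], of "w y"]
      by (simp add: norm_mult mult.commute)
  next
    case False
    have "K \<ge> 0" using bd[of "R + 1"] norm_ge_zero[of "k (R + 1)"] by (simp del: norm_ge_zero)
    then show ?thesis using False w_nonneg[of y] by (auto simp: indicator_def)
  qed
  show int: "integrable lborel (\<lambda>y. indicator {R<..} y *\<^sub>R (of_real (w y) * k y))"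
    by (rule Bochner_Integration.integrable_bound[OF integrable_mult_right[OF w_integrable, of K]])
       (use le in \<open>auto intro: order_trans[OF _ abs_ge_self]\<close>)
  have "norm (LINT y|lborel. indicator {R<..} y *\<^sub>R (of_real (w y) * k y)) \<le>
        (LINT y|lborel. norm (indicator {R<..} y *\<^sub>R (of_real (w y) * k y)))"
    by (rule integral_norm_bound)
  also have "\<dots> \<le> (LINT y|lborel. K * (indicator {0<..} y * w y))"
    by (intro integral_mono integrable_norm int integrable_mult_right w_integrable le)
  finally show "norm (LINT y|lborel. indicator {R<..} y *\<^sub>R (of_real (w y) * k y)) \<le> K * (LINT y|lborel. indicator {0<..} y * w y)"
    by simp
qed

text \<open>
The transform is considered as a function of \<open>u = z\<^sup>2\<close>; its singularities fill the ray to the left of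
\<open>-R\<^sup>2\<close>. Away from this ray \<open>u + y\<^sup>2\<close> is bounded away from 0 locally uniformly, and the difference
quotients are estimated directly.
\<close>

lemma Stieltjes_holomorphic:
  assumes R: "R \<ge> 0"
  shows "Stieltjes R holomorphic_on {u. Im u \<noteq> 0 \<or> Re u > - (R\<^sup>2)}" (is "_ holomorphic_on ?D")
proof -
  define W where "W = (LINT y|lborel. indicator {0<..} y * w y)"
  have opD: "open ?D"
    by (intro open_Collect_disj open_Collect_neq open_Collect_less continuous_intros)
  have "\<exists>f'. (Stieltjes R has_field_derivative f') (at u0)" if u0: "u0 \<in> ?D" for u0
  proof -
    obtain d where d: "d > 0" "ball u0 d \<subseteq> ?D" using opD u0 by (auto elim: openE)
    define \<delta> where "\<delta> = d / 2"
    have \<delta>: "\<delta> > 0" using d by (simp add: \<delta>_def)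
    have low: "norm (u + of_real (y\<^sup>2)) \<ge> \<delta>" if u: "u \<in> ball u0 \<delta>" and y: "y > R" for u y
    proof (rule ccontr)
      assume "\<not> ?thesis"
      hence "norm (u + of_real (y\<^sup>2)) < \<delta>" by simp
      hence "dist u (- of_real (y\<^sup>2)) < \<delta>" by (simp add: dist_norm)
      moreover have "dist u0 u < \<delta>" using u by simp
      ultimately have "dist u0 (- of_real (y\<^sup>2)) < d"
        using dist_triangle[of u0 "- of_real (y\<^sup>2)" u] by (simp add: \<delta>_def)
      hence "- of_real (y\<^sup>2) \<in> ?D" using d by auto
      moreover have "R\<^sup>2 \<le> y\<^sup>2" using y R by (intro power_mono) auto
      ultimately show False by simp
    qed
    have nz: "u + of_real (y\<^sup>2) \<noteq> 0" if "u \<in> ball u0 \<delta>" "y > R" for u y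
      using low[OF that] \<delta> by auto
    have int1: "integrable lborel (\<lambda>y. indicator {R<..} y *\<^sub>R (of_real (w y) / (u + of_real (y\<^sup>2))))"
      if u: "u \<in> ball u0 \<delta>" for u
    proof -
      have "integrable lborel (\<lambda>y. indicator {R<..} y *\<^sub>R (of_real (w y) * (1 / (u + of_real (y\<^sup>2)))))"
      proof (rule kernel_bound_integrable(1)[OF R])
        show "norm (1 / (u + of_real (y\<^sup>2))) \<le> 1 / \<delta>" if "y > R" for y
          unfolding norm_divide norm_one using low[OF u that] \<delta> by (intro frac_le) auto
      qed measurable
      then show ?thesis by simp
    qed
    have u0\<delta>: "u0 \<in> ball u0 \<delta>" using \<delta> by simp
    define k2 where "k2 = (\<lambda>y. - 1 / (u0 + of_real (y\<^sup>2))\<^sup>2)"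
    have [measurable]: "k2 \<in> borel_measurable borel" unfolding k2_def by measurable
    have int2: "integrable lborel (\<lambda>y. indicator {R<..} y *\<^sub>R (of_real (w y) * k2 y))"
    proof (rule kernel_bound_integrable(1)[OF R])
      show "norm (k2 y) \<le> 1 / \<delta>\<^sup>2" if "y > R" for y
        unfolding k2_def norm_divide norm_power norm_minus_cancel norm_one
        using low[OF u0\<delta> that] \<delta> by (intro frac_le power_mono) auto
    qed measurable
    define f' where "f' = (LINT y|lborel. indicator {R<..} y *\<^sub>R (of_real (w y) * k2 y))"
    have est: "norm ((Stieltjes R u - Stieltjes R u0) / (u - u0) - f') \<le> norm (u - u0) * (1 / \<delta> ^ 3 * W)"
      if u: "u \<in> ball u0 \<delta>" "u \<noteq> u0" for u
    proof -
      define k3 where "k3 = (\<lambda>y. (u - u0) / ((u + of_real (y\<^sup>2)) * (u0 + of_real (y\<^sup>2))\<^sup>2))"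
      have [measurable]: "k3 \<in> borel_measurable borel" unfolding k3_def by measurable
      have "(Stieltjes R u - Stieltjes R u0) / (u - u0) - f' =
        (LINT y|lborel. (indicator {R<..} y *\<^sub>R (of_real (w y) / (u + of_real (y\<^sup>2))) -
            indicator {R<..} y *\<^sub>R (of_real (w y) / (u0 + of_real (y\<^sup>2)))) / (u - u0) -
            indicator {R<..} y *\<^sub>R (of_real (w y) * k2 y))"
        unfolding Stieltjes_def f'_def using int1[OF u(1)] int1[OF u0\<delta>] int2 by simp
      also have "\<dots> = (LINT y|lborel. indicator {R<..} y *\<^sub>R (of_real (w y) * k3 y))"
      proof (intro Bochner_Integration.integral_cong refl)
        fix y :: real
        show "(indicator {R<..} y *\<^sub>R (of_real (w y) / (u + of_real (y\<^sup>2))) -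
            indicator {R<..} y *\<^sub>R (of_real (w y) / (u0 + of_real (y\<^sup>2)))) / (u - u0) -
            indicator {R<..} y *\<^sub>R (of_real (w y) * k2 y) = indicator {R<..} y *\<^sub>R (of_real (w y) * k3 y)"
        proof (cases "y > R")
          case True
          \<comment> \<open>an identity between rational functions of \<open>p\<close> and \<open>q\<close>, where \<open>u - u0 = p - q\<close>\<close>
          define p q where "p = u + of_real (y\<^sup>2)" and "q = u0 + of_real (y\<^sup>2)"
          have pq: "p \<noteq> 0" "q \<noteq> 0" "u - u0 = p - q" "p - q \<noteq> 0"
            using nz[OF u(1) True] nz[OF u0\<delta> True] u(2) by (auto simp: p_def q_def)
          have "(of_real (w y) / p - of_real (w y) / q) / (p - q) - of_real (w y) * (- 1 / q\<^sup>2) =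
                of_real (w y) * ((p - q) / (p * q\<^sup>2))"
            using pq by (simp add: divide_simps power2_eq_square) (simp add: algebra_simps)
          then show ?thesis
            unfolding k2_def k3_def p_def[symmetric] q_def[symmetric] pq(3) using True by simp
        qed simp
      qed
      also have "norm \<dots> \<le> (norm (u - u0) / \<delta> ^ 3) * W"
        unfolding W_def
      proof (rule kernel_bound_integrable(2)[OF R])
        fix y assume y: "y > R"
        have "\<delta> * \<delta>\<^sup>2 \<le> norm (u + of_real (y\<^sup>2)) * (norm (u0 + of_real (y\<^sup>2)))\<^sup>2"
          using low[OF u(1) y] low[OF u0\<delta> y] \<delta> by (intro mult_mono power_mono) auto
        then show "norm (k3 y) \<le> norm (u - u0) / \<delta> ^ 3"
          using \<delta> nz[OF u(1) y] nz[OF u0\<delta> y] unfolding k3_def norm_divide norm_mult norm_power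
          by (intro divide_left_mono mult_pos_pos) (auto simp: power3_eq_cube power2_eq_square mult_ac)
      qed measurable
      finally show ?thesis by simp
    qed
    have "((\<lambda>u. (Stieltjes R u - Stieltjes R u0) / (u - u0) - f') \<longlongrightarrow> 0) (at u0)"
    proof (rule Lim_null_comparison)
      have "((\<lambda>u. norm (u - u0) * (1 / \<delta> ^ 3 * W)) \<longlongrightarrow> norm (u0 - u0) * (1 / \<delta> ^ 3 * W)) (at u0)"
        by (intro tendsto_intros)
      then show "((\<lambda>u. norm (u - u0) * (1 / \<delta> ^ 3 * W)) \<longlongrightarrow> 0) (at u0)" by simp
      show "\<forall>\<^sub>F u in at u0. norm ((Stieltjes R u - Stieltjes R u0) / (u - u0) - f') \<le> norm (u - u0) * (1 / \<delta> ^ 3 * W)"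
        unfolding eventually_at using \<delta> est by (intro exI[of _ \<delta>]) (auto simp: dist_commute)
    qed
    hence "((\<lambda>u. (Stieltjes R u - Stieltjes R u0) / (u - u0)) \<longlongrightarrow> f') (at u0)"
      by (simp add: LIM_zero_iff)
    then show ?thesis by (auto simp: has_field_derivative_iff)
  qed
  then show ?thesis using opD by (simp add: holomorphic_on_open)
qed

text \<open>
The real form of the transform at \<open>x\<^sup>2\<close>: the error of the interpolant is \<open>(cos (c x) + b) J(x)\<close>.
\<close>

definition J :: "real \<Rightarrow> real" where
  "J x = (LINT y|lborel. indicator {0<..} y * (w y / (x\<^sup>2 + y\<^sup>2)))"

lemma Stieltjes_real: "Stieltjes 0 (of_real (x\<^sup>2)) = of_real (J x)"
proof -
  have "Stieltjes 0 (of_real (x\<^sup>2)) = (LINT y|lborel. complex_of_real (indicator {0<..} y * (w y / (x\<^sup>2 + y\<^sup>2))))"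
    unfolding Stieltjes_def by (intro Bochner_Integration.integral_cong) (auto simp: indicator_def)
  then show ?thesis by (simp only: integral_complex_of_real J_def)
qed

lemma kernel_real_integrable:
  assumes "x \<noteq> 0"
  shows "integrable lborel (\<lambda>y. indicator {0<..} y * (w y / (x\<^sup>2 + y\<^sup>2)))"
proof (rule Bochner_Integration.integrable_bound[OF integrable_mult_right[OF w_integrable, of "1 / x\<^sup>2"]])
  show "AE y in lborel. norm (indicator {0<..} y * (w y / (x\<^sup>2 + y\<^sup>2))) \<le> norm (1 / x\<^sup>2 * (indicator {0<..} y * w y))"
  proof (rule AE_I2)
    fix y :: real
    have "w y / (x\<^sup>2 + y\<^sup>2) \<le> w y / x\<^sup>2" if "y > 0"
      using that w_nonneg[of y] assms by (intro divide_left_mono) (auto simp: add_pos_nonneg)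
    then show "norm (indicator {0<..} y * (w y / (x\<^sup>2 + y\<^sup>2))) \<le> norm (1 / x\<^sup>2 * (indicator {0<..} y * w y))"
      using w_nonneg[of y] assms by (auto simp: indicator_def)
  qed
qed measurable

lemma J_nonneg: "J x \<ge> 0"
  unfolding J_def using w_nonneg by (intro integral_nonneg_AE) (auto simp: indicator_def)

text \<open>
By \<open>cos p - cos q = -2 sin ((p + q)/2) sin ((p - q)/2)\<close> the divided difference
\<open>(cos (c z) - cosh (c y)) / (z\<^sup>2 + y\<^sup>2)\<close> is, up to a constant, a product of two values of the entire function
\<open>s(z) = sin z / z\<close>, hence entire in \<open>z\<close> and jointly continuous. The constant \<open>b\<close> cancels in the
numerator.
\<close>

lemma divided_difference_integral:
  obtains A where "A holomorphic_on UNIV" "\<And>z. A (- z) = A z"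
    "\<And>x. x > 0 \<Longrightarrow> A (of_real x) =
       integral {0..R} (\<lambda>y. of_real (w y * (cos (c * x) + b) / (x\<^sup>2 + y\<^sup>2) - 2 * y ^ (2 * n + 1) / (x\<^sup>2 + y\<^sup>2)))"
proof -
  obtain s where s: "s holomorphic_on UNIV" "\<And>z::complex. sin z = (z - 0) * s z"
    using factor_zero[OF holomorphic_on_sin sin_zero] by metis
  have s_even: "s (- z) = s z" for z
  proof (cases "z = 0")
    case False
    have "(- z - 0) * s (- z) = - ((z - 0) * s z)"
      unfolding s(2)[symmetric] by simp
    hence "z * s (- z) = z * s z" by (simp only: diff_zero mult_minus_left neg_equal_iff_equal)
    then show ?thesis using False by (metis mult_left_cancel)
  qed simp
  define D where "D = (\<lambda>z y. - (of_real (c\<^sup>2) / 2) * s (of_real c * (z + \<i> * of_real y) / 2) * s (of_real c * (z - \<i> * of_real y) / 2))"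
  have D_eq: "cos (of_real c * z) - of_real (cosh (c * y)) = D z y * (z\<^sup>2 + of_real (y\<^sup>2))" for z :: complex and y :: real
  proof -
    define p where "p = of_real c * (z + \<i> * of_real y) / 2"
    define q where "q = of_real c * (z - \<i> * of_real y) / 2"
    have "of_real (cosh (c * y)) = cosh (complex_of_real (c * y))"
      by (simp add: cosh_field_def exp_of_real flip: of_real_minus of_real_mult)
    also have "\<dots> = cos (\<i> * of_real (c * y))" by (simp add: cosh_conv_cos)
    finally have "cos (of_real c * z) - of_real (cosh (c * y)) = cos (of_real c * z) - cos (\<i> * of_real (c * y))"
      by simp
    also have "\<dots> = 2 * sin ((of_real c * z + \<i> * of_real (c * y)) / 2) * sin ((\<i> * of_real (c * y) - of_real c * z) / 2)"
      by (rule cos_diff_cos)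
    also have "(of_real c * z + \<i> * of_real (c * y)) / 2 = of_real c * (z + \<i> * of_real y) / 2"
      by (simp add: algebra_simps)
    also have "(\<i> * of_real (c * y) - of_real c * z) / 2 = - (of_real c * (z - \<i> * of_real y) / 2)"
      by (simp add: field_simps)
    also note p_def[symmetric]
    also note q_def[symmetric]
    also have "2 * sin p * sin (- q) = - 2 * (p * q) * s p * s q"
      using s(2)[of p] s(2)[of q] by simp
    also have "p * q = of_real (c\<^sup>2) / 4 * (z\<^sup>2 + of_real (y\<^sup>2))"
      by (simp add: p_def q_def field_simps power2_eq_square)
    also have "- 2 * (of_real (c\<^sup>2) / 4 * (z\<^sup>2 + of_real (y\<^sup>2))) * s p * s q =
        - (of_real (c\<^sup>2) / 2) * s p * s q * (z\<^sup>2 + of_real (y\<^sup>2))" by (simp add: mult_ac)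
    finally show ?thesis by (simp only: D_def p_def q_def)
  qed
  define A where "A = (\<lambda>z. integral {0..R} (\<lambda>y. of_real (w y) * D z y))"
  have contw: "continuous_on {0..R} (\<lambda>y. complex_of_real (w y))"
    by (intro continuous_intros continuous_on_subset[OF w_continuous]) auto
  have conts: "continuous_on UNIV s" using s(1) by (rule holomorphic_on_imp_continuous_on)
  have hols': "deriv s holomorphic_on UNIV" by (rule holomorphic_deriv[OF s(1)]) simp
  have conts': "continuous_on UNIV (deriv s)" using hols' by (rule holomorphic_on_imp_continuous_on)
  define D' where "D' = (\<lambda>z y. - (of_real (c\<^sup>2) / 2) *
     (deriv s (of_real c * (z + \<i> * of_real y) / 2) * (of_real c / 2) * s (of_real c * (z - \<i> * of_real y) / 2)
      + deriv s (of_real c * (z - \<i> * of_real y) / 2) * (of_real c / 2) * s (of_real c * (z + \<i> * of_real y) / 2)))"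
  have derD: "((\<lambda>z. D z y) has_field_derivative D' z y) (at z)" for z y
  proof -
    have ders: "((\<lambda>z. s (of_real c * (z + a) / 2)) has_field_derivative
        deriv s (of_real c * (z + a) / 2) * (of_real c / 2)) (at z)" for a
    proof (rule DERIV_chain2[where f = s and g = "\<lambda>z. of_real c * (z + a) / 2"])
      show "(s has_field_derivative deriv s (of_real c * (z + a) / 2)) (at (of_real c * (z + a) / 2))"
        using s(1) by (simp add: holomorphic_derivI)
    qed (auto intro!: derivative_eq_intros)
    note 1 = ders[of "\<i> * of_real y"]
    note 2 = ders[of "- (\<i> * of_real y)", unfolded add_uminus_conv_diff]
    show ?thesis unfolding D_def D'_def mult.assoc[of "- (of_real (c\<^sup>2) / 2)"]
      by (intro DERIV_cmult DERIV_cong[OF DERIV_mult[OF 1 2]]) simp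
  qed
  have "(\<lambda>z. integral (cbox 0 R) (\<lambda>y. of_real (w y) * D z y)) holomorphic_on UNIV"
  proof (rule leibniz_rule_holomorphic)
    fix z :: complex and y :: real
    show "((\<lambda>z. of_real (w y) * D z y) has_field_derivative of_real (w y) * D' z y) (at z within UNIV)"
      using derD[of y z] by (intro DERIV_cmult) simp
  next
    fix z :: complex
    have "continuous_on {0..R} (\<lambda>y. of_real (w y) * D z y)"
      unfolding D_def by (intro continuous_intros contw continuous_on_compose2[OF conts]) auto
    then show "(\<lambda>y. of_real (w y) * D z y) integrable_on cbox 0 R"
      using integrable_continuous_real by simp
  next
    have "continuous_on (UNIV \<times> {0..R}) (\<lambda>p. of_real (w (snd p)) * D' (fst p) (snd p))"
      unfolding D'_def
      by (intro continuous_intros continuous_on_compose2[OF contw] continuous_on_compose2[OF conts] continuous_on_compose2[OF conts']) auto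
    then show "continuous_on (UNIV \<times> cbox 0 R) (\<lambda>(z, y). of_real (w y) * D' z y)"
      by (simp add: case_prod_unfold)
  qed simp
  hence holA: "A holomorphic_on UNIV" by (simp add: A_def)
  show thesis
  proof (rule that[OF holA])
    show "A (- z) = A z" for z
    proof -
      have "D (- z) y = D z y" for y
      proof -
        have "of_real c * (- z + \<i> * of_real y) / 2 = - (of_real c * (z - \<i> * of_real y) / 2)"
          by (simp add: field_simps)
        moreover have "of_real c * (- z - \<i> * of_real y) / 2 = - (of_real c * (z + \<i> * of_real y) / 2)"
          by (simp add: field_simps)
        ultimately show ?thesis by (simp only: D_def s_even mult_ac)
      qed
      then show ?thesis by (simp add: A_def)
    qed
  next
    fix x :: real assume x: "x > 0"
    show "A (of_real x) =
       integral {0..R} (\<lambda>y. of_real (w y * (cos (c * x) + b) / (x\<^sup>2 + y\<^sup>2) - 2 * y ^ (2 * n + 1) / (x\<^sup>2 + y\<^sup>2)))"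
      unfolding A_def
    proof (rule integral_cong)
      fix y assume y: "y \<in> {0..R}"
      have pos: "x\<^sup>2 + y\<^sup>2 > 0" using x by (simp add: add_pos_nonneg)
      have wy: "w y * \<phi> y = 2 * y ^ (2 * n + 1)"
        using \<phi>_pos[of y] y by (cases "y = 0") (auto simp: w_def)
      have "D (of_real x) y * of_real (x\<^sup>2 + y\<^sup>2) = of_real (cos (c * x) - cosh (c * y))"
        using D_eq[of "of_real x" y] by (simp flip: cos_of_real)
      hence "D (of_real x) y = of_real ((cos (c * x) - cosh (c * y)) / (x\<^sup>2 + y\<^sup>2))"
      proof -
        have nz: "complex_of_real (x\<^sup>2 + y\<^sup>2) \<noteq> 0" unfolding of_real_eq_0_iff using pos by (rule less_imp_neq[symmetric])
        assume "D (of_real x) y * of_real (x\<^sup>2 + y\<^sup>2) = of_real (cos (c * x) - cosh (c * y))"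
        then show ?thesis unfolding of_real_divide nonzero_eq_divide_eq[OF nz] .
      qed
      hence "of_real (w y) * D (of_real x) y = of_real (w y * ((cos (c * x) - cosh (c * y)) / (x\<^sup>2 + y\<^sup>2)))"
        by simp
      also have "w y * ((cos (c * x) - cosh (c * y)) / (x\<^sup>2 + y\<^sup>2)) =
          w y * (cos (c * x) + b) / (x\<^sup>2 + y\<^sup>2) - w y * \<phi> y / (x\<^sup>2 + y\<^sup>2)"
        by (simp add: \<phi>_def diff_divide_distrib[symmetric] algebra_simps)
      finally show "of_real (w y) * D (of_real x) y =
        of_real (w y * (cos (c * x) + b) / (x\<^sup>2 + y\<^sup>2) - 2 * y ^ (2 * n + 1) / (x\<^sup>2 + y\<^sup>2))"
        by (simp only: wy)
    qed
  qed
qed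

end

text \<open>
The polynomial part, in \<open>u = x\<^sup>2\<close>, of \<open>\<integral>\<^sub>0\<^sup>R 2 y\<^sup>2\<^sup>k\<^sup>+\<^sup>1 / (x\<^sup>2 + y\<^sup>2) dy\<close>; the recursion comes from
\<open>y\<^sup>2 = (x\<^sup>2 + y\<^sup>2) - x\<^sup>2\<close>.
\<close>

fun log_remainder :: "real \<Rightarrow> nat \<Rightarrow> complex \<Rightarrow> complex" where
  "log_remainder R 0 u = 0"
| "log_remainder R (Suc k) u = of_real (R ^ (2 * k + 2) / (real k + 1)) - u * log_remainder R k u"

lemma log_remainder_holomorphic: "log_remainder R k holomorphic_on S"
proof (induction k)
  case 0
  have "log_remainder R 0 = (\<lambda>_. 0)" by (rule ext) simp
  then show ?case by simp
next
  case (Suc k)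
  have "log_remainder R (Suc k) = (\<lambda>u. of_real (R ^ (2 * k + 2) / (real k + 1)) - u * log_remainder R k u)"
    by (rule ext) simp
  then show ?case using Suc by (auto intro!: holomorphic_intros)
qed

lemma integral_odd_power_over_sum_squares:
  assumes x: "x > 0" and R: "R \<ge> (0::real)"
  shows "((\<lambda>y. 2 * y ^ (2 * k + 1) / (x\<^sup>2 + y\<^sup>2)) has_integral
     Re (log_remainder R k (of_real (x\<^sup>2))) + (- 1) ^ k * x ^ (2 * k) * (ln (x\<^sup>2 + R\<^sup>2) - ln (x\<^sup>2))) {0..R}"
proof (induction k)
  case 0
  have "((\<lambda>y. 2 * y / (x\<^sup>2 + y\<^sup>2)) has_integral ln (x\<^sup>2 + R\<^sup>2) - ln (x\<^sup>2 + 0\<^sup>2)) {0..R}"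
  proof (rule fundamental_theorem_of_calculus[OF R])
    fix y :: real
    have "x\<^sup>2 + y\<^sup>2 > 0" using x by (simp add: add_pos_nonneg)
    then show "((\<lambda>y. ln (x\<^sup>2 + y\<^sup>2)) has_vector_derivative 2 * y / (x\<^sup>2 + y\<^sup>2)) (at y within {0..R})"
      unfolding has_real_derivative_iff_has_vector_derivative[symmetric]
      by (auto intro!: derivative_eq_intros simp: field_simps)
  qed
  then show ?case by simp
next
  case (Suc k)
  have "((\<lambda>y. y ^ (2 * k + 2) / (real k + 1)) has_real_derivative 2 * y ^ (2 * k + 1)) (at y within {0..R})" for y :: real
  proof (rule DERIV_cong[OF DERIV_cdivide[OF DERIV_pow]])
    have eq: "real (2 * k + 2) = 2 * (real k + 1)" by simp
    have "real k + 1 \<noteq> 0" by linarith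
    moreover have "(2 * d) * t / d = 2 * t" if "d \<noteq> 0" for d t :: real using that by simp
    moreover have e: "2 * k + 2 - Suc 0 = 2 * k + 1" by simp
    ultimately show "real (2 * k + 2) * y ^ (2 * k + 2 - Suc 0) / (real k + 1) = 2 * y ^ (2 * k + 1)"
      unfolding eq e by blast
  qed
  hence "((\<lambda>y. 2 * y ^ (2 * k + 1)) has_integral R ^ (2 * k + 2) / (real k + 1) - 0 ^ (2 * k + 2) / (real k + 1)) {0..R}"
    by (intro fundamental_theorem_of_calculus[OF R]) (simp add: has_real_derivative_iff_has_vector_derivative)
  from has_integral_diff[OF this has_integral_mult_right[OF Suc, of "x\<^sup>2"]]
  have "((\<lambda>y. 2 * y ^ (2 * k + 1) - x\<^sup>2 * (2 * y ^ (2 * k + 1) / (x\<^sup>2 + y\<^sup>2))) has_integral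
     R ^ (2 * k + 2) / (real k + 1) - 0 ^ (2 * k + 2) / (real k + 1) -
     x\<^sup>2 * (Re (log_remainder R k (of_real (x\<^sup>2))) + (- 1) ^ k * x ^ (2 * k) * (ln (x\<^sup>2 + R\<^sup>2) - ln (x\<^sup>2)))) {0..R}" .
  also have "(\<lambda>y. 2 * y ^ (2 * k + 1) - x\<^sup>2 * (2 * y ^ (2 * k + 1) / (x\<^sup>2 + y\<^sup>2))) =
             (\<lambda>y. 2 * y ^ (2 * Suc k + 1) / (x\<^sup>2 + y\<^sup>2))"
  proof
    fix y :: real
    have "x\<^sup>2 + y\<^sup>2 > 0" using x by (simp add: add_pos_nonneg)
    moreover have "s - a * (s / (a + d)) = d * s / (a + d)" if "a + d > 0" for s a d :: real
      using that by (simp add: field_simps)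
    moreover have "2 * y ^ (2 * Suc k + 1) = y\<^sup>2 * (2 * y ^ (2 * k + 1))" by (simp add: power2_eq_square)
    ultimately show "2 * y ^ (2 * k + 1) - x\<^sup>2 * (2 * y ^ (2 * k + 1) / (x\<^sup>2 + y\<^sup>2)) = 2 * y ^ (2 * Suc k + 1) / (x\<^sup>2 + y\<^sup>2)"
      by metis
  qed
  also have "R ^ (2 * k + 2) / (real k + 1) - 0 ^ (2 * k + 2) / (real k + 1) -
     x\<^sup>2 * (Re (log_remainder R k (of_real (x\<^sup>2))) + (- 1) ^ k * x ^ (2 * k) * (ln (x\<^sup>2 + R\<^sup>2) - ln (x\<^sup>2))) =
     Re (log_remainder R (Suc k) (of_real (x\<^sup>2))) + (- 1) ^ Suc k * x ^ (2 * Suc k) * (ln (x\<^sup>2 + R\<^sup>2) - ln (x\<^sup>2))"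
  proof -
    have "Re (complex_of_real (R ^ (2 * k + 2) / (real k + 1))) = R ^ (2 * k + 2) / (real k + 1)" by (rule Re_complex_of_real)
    moreover have "Re (of_real (x\<^sup>2) * log_remainder R k (of_real (x\<^sup>2))) = x\<^sup>2 * Re (log_remainder R k (of_real (x\<^sup>2)))"
      by (simp del: of_real_power)
    moreover have "x ^ (2 * Suc k) = x\<^sup>2 * x ^ (2 * k)" by (simp add: power2_eq_square)
    moreover have "A - p * (B + t * q * L) = (A - p * B) + (- 1 * t) * (p * q) * L" for A B p q t L :: real
      by (simp add: algebra_simps)
    ultimately show ?thesis
      unfolding log_remainder.simps minus_complex.simps by (simp del: of_real_power power_Suc add: power_Suc[of "- 1"])
  qed
  finally show ?case .
qed

lemma log_remainder_real: "log_remainder R k (of_real v) \<in> \<real>"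
  by (induction k) (auto intro!: Reals_diff Reals_mult simp del: of_real_divide)

section \<open>The interpolant is entire of exponential type\<close>

text \<open>
The identity theorem, with the centre of the ball as a limit point of the positive reals.
\<close>

lemma eq_on_ball_if_eq_on_positive_reals:
  fixes f g :: "complex \<Rightarrow> complex"
  assumes f: "f holomorphic_on ball 0 R" and g: "g holomorphic_on ball 0 R"
    and eq: "\<And>x. 0 < x \<Longrightarrow> x < R \<Longrightarrow> f (of_real x) = g (of_real x)"
    and z: "z \<in> ball 0 R"
  shows "f z = g z"
proof -
  have R: "R > 0" using z by (auto intro: le_less_trans[OF norm_ge_zero])
  have "f z - g z = 0"
  proof (rule analytic_continuation[of "\<lambda>z. f z - g z" "ball 0 R" "of_real ` {0<..<R}" 0])
    show "(0 :: complex) islimpt of_real ` {0<..<R}"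
      unfolding islimpt_approachable
    proof (intro allI impI)
      fix e :: real assume "e > 0"
      then show "\<exists>x'\<in>of_real ` {0<..<R}. x' \<noteq> 0 \<and> dist x' (0 :: complex) < e"
        using R by (intro bexI[of _ "of_real (min e R / 2)"] imageI) (auto simp: min_def)
    qed
  qed (use R z eq in \<open>auto intro!: holomorphic_intros f g\<close>)
  then show ?thesis by simp
qed

text \<open>
Extensions to balls of different radii agree by the identity theorem, so they glue to one entire
function.
\<close>

lemma even_entire_from_local_extensions:
  fixes g :: "real \<Rightarrow> complex"
  assumes local: "\<And>R. R > 0 \<Longrightarrow> \<exists>f. f holomorphic_on ball 0 R \<and> (\<forall>z. f (- z) = f z) \<and>
      (\<forall>x. 0 < x \<longrightarrow> x < R \<longrightarrow> f (of_real x) = g x)"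
  obtains E where "E holomorphic_on UNIV" "\<And>z. E (- z) = E z" "\<And>x. x > 0 \<Longrightarrow> E (of_real x) = g x"
proof -
  obtain f where f: "\<And>R. R > 0 \<Longrightarrow> f R holomorphic_on ball 0 R"
     "\<And>R z. R > 0 \<Longrightarrow> f R (- z) = f R z" "\<And>R x. R > 0 \<Longrightarrow> 0 < x \<Longrightarrow> x < R \<Longrightarrow> f R (of_real x) = g x"
    using local by metis
  have agree: "f R z = f R' z" if "0 < R" "R \<le> R'" "z \<in> ball 0 R" for R R' z
  proof (rule eq_on_ball_if_eq_on_positive_reals[where R = R and f = "f R" and g = "f R'"])
    show "f R' holomorphic_on ball 0 R"
      by (rule holomorphic_on_subset[OF f(1)[of R']]) (use that in auto)
  qed (use that f in auto)
  define E where "E = (\<lambda>z. f (norm z + 1) z)"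
  have one: "norm z + 1 > 0" for z :: complex by (simp add: add_nonneg_pos)
  have E_eq: "E z = f R z" if "z \<in> ball 0 R" for z R
  proof -
    have R: "R > 0" "norm z < R" using that by (auto intro: le_less_trans[OF norm_ge_zero])
    show ?thesis
    proof (cases "R \<le> norm z + 1")
      case True
      then show ?thesis using agree[of R "norm z + 1" z] R by (simp add: E_def)
    next
      case False
      then show ?thesis using agree[of "norm z + 1" R z] R by (simp add: E_def add_nonneg_pos)
    qed
  qed
  show thesis
  proof (rule that[of E])
    show "E holomorphic_on UNIV"
    proof -
      have "E field_differentiable at z" for z
      proof -
        have R: "norm z + 1 > 0" by (simp add: add_nonneg_pos)
        have "E holomorphic_on ball 0 (norm z + 1)"
          using f(1)[OF R] by (rule holomorphic_transform) (simp add: E_eq)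
        then show ?thesis by (rule holomorphic_on_imp_differentiable_at) auto
      qed
      then show ?thesis by (simp add: holomorphic_on_def field_differentiable_at_within)
    qed
    show "E (- z) = E z" for z using f(2)[OF one[of z]] by (simp add: E_def)
    show "E (of_real x) = g x" if "x > 0" for x
      using E_eq[of "of_real x" "x + 1"] f(3)[of "x + 1" x] that by simp
  qed
qed

lemma power_le_exp:
  fixes \<epsilon> :: real
  assumes "\<epsilon> > 0"
  obtains C where "C > 0" "\<And>r. r \<ge> 0 \<Longrightarrow> r ^ k \<le> C * exp (\<epsilon> * r)"
proof -
  \<comment> \<open>dividing by \<open>k + 1\<close> covers \<open>k = 0\<close>\<close>
  define \<delta> where "\<delta> = \<epsilon> / (real k + 1)"
  have \<delta>: "\<delta> > 0" "real k * \<delta> \<le> \<epsilon>" using assms by (auto simp: \<delta>_def field_simps)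
  show thesis
  proof (rule that[of "(1 / \<delta>) ^ k"])
    show "(1 / \<delta>) ^ k > 0" using \<delta> by simp
    fix r :: real assume r: "r \<ge> 0"
    have "\<delta> * r \<le> exp (\<delta> * r)" using exp_ge_add_one_self[of "\<delta> * r"] by linarith
    hence "r \<le> 1 / \<delta> * exp (\<delta> * r)" using \<delta> by (simp add: field_simps)
    hence "r ^ k \<le> (1 / \<delta> * exp (\<delta> * r)) ^ k" using r by (intro power_mono) auto
    also have "\<dots> = (1 / \<delta>) ^ k * exp (real k * \<delta> * r)"
    proof -
      have "exp (real k * \<delta> * r) = exp (\<delta> * r) ^ k"
        using exp_of_nat_mult[of k "\<delta> * r"] by (simp add: mult.assoc)
      then show ?thesis by (simp only: power_mult_distrib)
    qed
    also have "\<dots> \<le> (1 / \<delta>) ^ k * exp (\<epsilon> * r)"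
      using \<delta> r by (intro mult_left_mono) (auto intro!: mult_right_mono)
    finally show "r ^ k \<le> (1 / \<delta>) ^ k * exp (\<epsilon> * r)" .
  qed
qed

text \<open>
A bound that degenerates on the imaginary axis is as good as a uniform one. On the circle of
radius 2 about a point \<open>a\<close> of the imaginary axis one has \<open>\<bar>(v - a)\<^sup>2 + 4\<bar> = 4 \<bar>Re v\<bar>\<close>, so the
square of this factor compensates the weight on the circle, while it is at least 16 on the
horizontal line through the centre.
\<close>

lemma entire_exp_type_if_weighted_bound:
  assumes hol: "E holomorphic_on UNIV" and \<tau>: "\<tau> \<ge> 0"
    and bd: "\<And>\<epsilon>. \<epsilon> > 0 \<Longrightarrow> \<exists>C>0. \<forall>z. (Re z)\<^sup>2 * norm (E z) \<le> C * exp ((\<tau> + \<epsilon>) * norm z)"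
  shows "entire_exp_type \<tau> E"
  unfolding entire_exp_type_def
proof (intro conjI allI impI hol)
  fix \<epsilon> :: real assume \<epsilon>: "\<epsilon> > 0"
  obtain C where C: "C > 0" "\<And>z. (Re z)\<^sup>2 * norm (E z) \<le> C * exp ((\<tau> + \<epsilon>) * norm z)"
    using bd[OF \<epsilon>] by blast
  define C' where "C' = C * exp ((\<tau> + \<epsilon>) * 2)"
  have C': "C' \<ge> C" "C' > 0" using C \<tau> \<epsilon> by (auto simp: C'_def)
  have "norm (E z) \<le> C' * exp ((\<tau> + \<epsilon>) * norm z)" for z
  proof (cases "\<bar>Re z\<bar> \<ge> 1")
    case True
    hence "1 \<le> (Re z)\<^sup>2" by (metis abs_ge_self abs_square_le_1 dual_order.trans linorder_le_cases one_le_power power2_abs)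
    hence "norm (E z) \<le> (Re z)\<^sup>2 * norm (E z)" by (simp add: mult_le_cancel_right1)
    also have "\<dots> \<le> C' * exp ((\<tau> + \<epsilon>) * norm z)"
      by (rule order_trans[OF C(2)]) (use C' in auto)
    finally show ?thesis .
  next
    case False
    define a where "a = \<i> * of_real (Im z)"
    define f where "f = (\<lambda>v. E v * ((v - a)\<^sup>2 + 4)\<^sup>2)"
    have na: "norm a \<le> norm z" using abs_Im_le_cmod[of z] by (simp add: a_def norm_mult)
    have "norm (f z) \<le> 16 * C' * exp ((\<tau> + \<epsilon>) * norm z)"
    proof (rule maximum_modulus_frontier[of f "cball a 2"])
      show "f holomorphic_on interior (cball a 2)" unfolding f_def
        by (intro holomorphic_intros holomorphic_on_subset[OF hol]) auto
      have "f holomorphic_on UNIV" unfolding f_def by (intro holomorphic_intros hol)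
      then show "continuous_on (closure (cball a 2)) f"
        using holomorphic_on_imp_continuous_on continuous_on_subset by blast
      have "z - a = of_real (Re z)" by (simp add: a_def complex_eq_iff)
      hence "norm (z - a) = \<bar>Re z\<bar>" by simp
      then show "z \<in> cball a 2" using False by (simp add: dist_norm norm_minus_commute)
      fix v assume "v \<in> frontier (cball a 2)"
      hence va: "norm (v - a) = 2" by (simp add: dist_norm norm_minus_commute)
      define u where "u = v - a"
      have "u * cnj u = of_real ((norm u)\<^sup>2)" using complex_norm_square[of u] by simp
      also have "norm u = 2" using va by (simp add: u_def)
      finally have "u * cnj u = 4" by simp
      hence "u\<^sup>2 + 4 = u * (u + cnj u)" by (simp add: power2_eq_square algebra_simps)
      also have "u + cnj u = of_real (2 * Re v)" by (simp add: u_def a_def complex_eq_iff)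
      finally have "norm (u\<^sup>2 + 4) = 4 * \<bar>Re v\<bar>" using va by (simp add: norm_mult u_def)
      hence "norm (f v) = norm (E v) * (4 * \<bar>Re v\<bar>)\<^sup>2"
        by (simp add: f_def norm_mult norm_power u_def)
      also have "\<dots> = 16 * ((Re v)\<^sup>2 * norm (E v))" by (simp add: power_mult_distrib)
      also have "\<dots> \<le> 16 * (C * exp ((\<tau> + \<epsilon>) * norm v))" using C(2)[of v] by simp
      also have "\<dots> \<le> 16 * (C * exp ((\<tau> + \<epsilon>) * (norm z + 2)))"
      proof -
        have "norm v \<le> norm z + 2" using norm_triangle_ineq[of "v - a" a] va na by simp
        then show ?thesis using C(1) \<tau> \<epsilon> by simp
      qed
      also have "\<dots> = 16 * C' * exp ((\<tau> + \<epsilon>) * norm z)"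
        by (simp add: C'_def distrib_left exp_add)
      finally show "norm (f v) \<le> 16 * C' * exp ((\<tau> + \<epsilon>) * norm z)" .
    qed auto
    moreover have "norm (f z) \<ge> 16 * norm (E z)"
    proof -
      have za: "z - a = of_real (Re z)" by (simp add: a_def complex_eq_iff)
      have "((z - a)\<^sup>2 + 4)\<^sup>2 = of_real (((Re z)\<^sup>2 + 4)\<^sup>2)" unfolding za by simp
      hence "norm (f z) = norm (E z) * ((Re z)\<^sup>2 + 4)\<^sup>2"
        by (simp add: f_def norm_mult del: of_real_power)
      moreover have "((Re z)\<^sup>2 + 4)\<^sup>2 \<ge> 4\<^sup>2" by (intro power_mono) auto
      ultimately show ?thesis using mult_left_mono[of "4\<^sup>2" "((Re z)\<^sup>2 + 4)\<^sup>2" "norm (E z)"] by simp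
    qed
    ultimately show ?thesis by linarith
  qed
  then show "\<exists>C>0. \<forall>z. norm (E z) \<le> C * exp ((\<tau> + \<epsilon>) * norm z)" using C'(2) by blast
qed

text \<open>
The real-valued form of the approximated function. At 0 it takes the value 0, which for \<open>n = 0\<close>
differs from the true value \<open>\<infinity>\<close>; the two functions agree almost everywhere.
\<close>

definition log_monomial :: "nat \<Rightarrow> real \<Rightarrow> real" where
  "log_monomial n x = (- 1) ^ (n + 1) * x ^ (2 * n) * ln (x\<^sup>2)"

context interpolation_kernel
begin

abbreviation H :: "real \<Rightarrow> real" where "H \<equiv> log_monomial n"

lemma J_split:
  assumes x: "x > 0" and R: "R > 0"
  shows "J x = integral {0..R} (\<lambda>y. w y / (x\<^sup>2 + y\<^sup>2)) + (LINT y|lborel. indicator {R<..} y * (w y / (x\<^sup>2 + y\<^sup>2)))"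
    and "(\<lambda>y. w y / (x\<^sup>2 + y\<^sup>2)) integrable_on {0..R}"
proof -
  have nz: "x\<^sup>2 + y\<^sup>2 \<noteq> 0" for y using x by (simp add: add_pos_nonneg less_imp_neq[symmetric])
  have cont: "continuous_on {0..R} (\<lambda>y. w y / (x\<^sup>2 + y\<^sup>2))"
    by (intro continuous_intros continuous_on_subset[OF w_continuous]) (use nz in auto)
  show "(\<lambda>y. w y / (x\<^sup>2 + y\<^sup>2)) integrable_on {0..R}" using cont by (rule integrable_continuous_real)
  have si: "set_integrable lborel {0..R} (\<lambda>y. w y / (x\<^sup>2 + y\<^sup>2))"
    using cont by (rule borel_integrable_atLeastAtMost')
  have int0: "integrable lborel (\<lambda>y. indicator {0<..} y * (w y / (x\<^sup>2 + y\<^sup>2)))"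
    using kernel_real_integrable[of x] x by simp
  have int2: "integrable lborel (\<lambda>y. indicator {R<..} y * (w y / (x\<^sup>2 + y\<^sup>2)))"
  proof -
    have "(\<lambda>y. indicator {R<..} y * (w y / (x\<^sup>2 + y\<^sup>2))) = (\<lambda>y. indicator {R<..} y *\<^sub>R (indicator {0<..} y * (w y / (x\<^sup>2 + y\<^sup>2))))"
      using R by (auto simp: indicator_def)
    then show ?thesis using integrable_mult_indicator[OF _ int0, of "{R<..}"] by simp
  qed
  have "J x = (LINT y|lborel. indicator {0..R} y *\<^sub>R (w y / (x\<^sup>2 + y\<^sup>2)) + indicator {R<..} y * (w y / (x\<^sup>2 + y\<^sup>2)))"
    unfolding J_def
  proof (rule integral_cong_AE)
    show "AE y in lborel. indicator {0<..} y * (w y / (x\<^sup>2 + y\<^sup>2)) =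
       indicator {0..R} y *\<^sub>R (w y / (x\<^sup>2 + y\<^sup>2)) + indicator {R<..} y * (w y / (x\<^sup>2 + y\<^sup>2))"
      by (rule AE_mp[OF AE_lborel_singleton[of 0]]) (use R in \<open>auto simp: indicator_def\<close>)
  qed measurable
  also have "\<dots> = (LINT y|lborel. indicator {0..R} y *\<^sub>R (w y / (x\<^sup>2 + y\<^sup>2))) + (LINT y|lborel. indicator {R<..} y * (w y / (x\<^sup>2 + y\<^sup>2)))"
    using si int2 unfolding set_integrable_def by (rule Bochner_Integration.integral_add)
  also have "(LINT y|lborel. indicator {0..R} y *\<^sub>R (w y / (x\<^sup>2 + y\<^sup>2))) = integral {0..R} (\<lambda>y. w y / (x\<^sup>2 + y\<^sup>2))"
    using set_borel_integral_eq_integral(2)[OF si] by (simp add: set_lebesgue_integral_def)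
  finally show "J x = integral {0..R} (\<lambda>y. w y / (x\<^sup>2 + y\<^sup>2)) + (LINT y|lborel. indicator {R<..} y * (w y / (x\<^sup>2 + y\<^sup>2)))" .
qed

text \<open>
Split the integral \<open>J\<close> at \<open>R\<close>. The tail is holomorphic in the ball of radius \<open>R\<close>. In the initial part
replace \<open>\<Phi>(x)\<close> by the divided difference, which is entire, plus \<open>\<Phi>(iy)\<close>; the latter cancels the
denominator of the weight and leaves a polynomial plus
\<open>(-1)\<^sup>n x\<^sup>2\<^sup>n (log (x\<^sup>2 + R\<^sup>2) - log x\<^sup>2)\<close>. The singular logarithm cancels against that of \<open>H\<close>.
\<close>

lemma local_extension:
  assumes R: "R > 0"
  shows "\<exists>f. f holomorphic_on ball 0 R \<and> (\<forall>z. f (- z) = f z) \<and>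
      (\<forall>x. 0 < x \<longrightarrow> x < R \<longrightarrow> f (of_real x) = of_real (H x - (cos (c * x) + b) * J x))"
proof -
  obtain A where A: "A holomorphic_on UNIV" "\<And>z. A (- z) = A z"
    "\<And>x. x > 0 \<Longrightarrow> A (of_real x) =
       integral {0..R} (\<lambda>y. of_real (w y * (cos (c * x) + b) / (x\<^sup>2 + y\<^sup>2) - 2 * y ^ (2 * n + 1) / (x\<^sup>2 + y\<^sup>2)))"
    using divided_difference_integral[of R] by blast
  define f where "f = (\<lambda>z. - A z - log_remainder R n (z\<^sup>2) - (- 1) ^ n * z ^ (2 * n) * Ln (z\<^sup>2 + of_real (R\<^sup>2)) - \<Phi> z * Stieltjes R (z\<^sup>2))"
  have Re_sq: "Re (z\<^sup>2) > - (R\<^sup>2)" if "z \<in> ball 0 R" for z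
  proof -
    have "(norm z)\<^sup>2 < R\<^sup>2" using that by (intro power_strict_mono) auto
    moreover have "\<bar>Re (z\<^sup>2)\<bar> \<le> (norm z)\<^sup>2" using abs_Re_le_cmod[of "z\<^sup>2"] by (simp only: norm_power)
    ultimately show ?thesis by linarith
  qed
  have "f holomorphic_on ball 0 R"
  proof -
    have sq: "(\<lambda>z. z\<^sup>2) holomorphic_on ball 0 R" by (intro holomorphic_intros)
    have 1: "(\<lambda>z. log_remainder R n (z\<^sup>2)) holomorphic_on ball 0 R"
      by (rule holomorphic_on_compose_gen[OF sq log_remainder_holomorphic[of _ _ UNIV], unfolded o_def]) auto
    have 2: "(\<lambda>z. Stieltjes R (z\<^sup>2)) holomorphic_on ball 0 R"
      using R by (intro holomorphic_on_compose_gen[OF sq Stieltjes_holomorphic[of R], unfolded o_def])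
        (auto dest: Re_sq)
    have 3: "(\<lambda>z. Ln (z\<^sup>2 + of_real (R\<^sup>2))) holomorphic_on ball 0 R"
    proof (intro holomorphic_intros)
      fix z :: complex assume "z \<in> ball 0 R"
      from Re_sq[OF this] show "z\<^sup>2 + of_real (R\<^sup>2) \<notin> \<real>\<^sub>\<le>\<^sub>0"
        unfolding complex_nonpos_Reals_iff by simp
    qed
    show ?thesis unfolding f_def \<Phi>_def
      by (intro holomorphic_intros 1 2 3 holomorphic_on_subset[OF A(1)]) auto
  qed
  moreover have "f (- z) = f z" for z by (simp add: f_def A(2) \<Phi>_def)
  moreover have "f (of_real x) = of_real (H x - (cos (c * x) + b) * J x)" if x: "0 < x" for x
  proof -
    define p where "p = cos (c * x) + b"
    define I1 where "I1 = integral {0..R} (\<lambda>y. w y / (x\<^sup>2 + y\<^sup>2))"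
    define I2 where "I2 = (LINT y|lborel. indicator {R<..} y * (w y / (x\<^sup>2 + y\<^sup>2)))"
    define L where "L = Re (log_remainder R n (of_real (x\<^sup>2)))"
    have J: "J x = I1 + I2" using J_split(1)[OF x R] by (simp add: I1_def I2_def)
    have L: "log_remainder R n (of_real (x\<^sup>2)) = of_real L"
      using log_remainder_real[of R n "x\<^sup>2"] by (simp add: L_def of_real_Re del: of_real_power)
    have hi: "((\<lambda>y. w y * p / (x\<^sup>2 + y\<^sup>2) - 2 * y ^ (2 * n + 1) / (x\<^sup>2 + y\<^sup>2)) has_integral
       p * I1 - (L + (- 1) ^ n * x ^ (2 * n) * (ln (x\<^sup>2 + R\<^sup>2) - ln (x\<^sup>2)))) {0..R}"
    proof (rule has_integral_diff)
      show "((\<lambda>y. w y * p / (x\<^sup>2 + y\<^sup>2)) has_integral p * I1) {0..R}"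
        using has_integral_mult_right[OF integrable_integral[OF J_split(2)[OF x R]], of p]
        by (simp add: I1_def mult_ac)
      show "((\<lambda>y. 2 * y ^ (2 * n + 1) / (x\<^sup>2 + y\<^sup>2)) has_integral
          L + (- 1) ^ n * x ^ (2 * n) * (ln (x\<^sup>2 + R\<^sup>2) - ln (x\<^sup>2))) {0..R}"
        unfolding L_def by (rule integral_odd_power_over_sum_squares) (use x R in auto)
    qed
    have A': "A (of_real x) = of_real (p * I1 - (L + (- 1) ^ n * x ^ (2 * n) * (ln (x\<^sup>2 + R\<^sup>2) - ln (x\<^sup>2))))"
      unfolding A(3)[OF x] p_def[symmetric] by (rule integral_unique[OF has_integral_of_real[OF hi]])
    have S: "Stieltjes R (of_real (x\<^sup>2)) = of_real I2"
    proof -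
      have "Stieltjes R (of_real (x\<^sup>2)) = (LINT y|lborel. complex_of_real (indicator {R<..} y * (w y / (x\<^sup>2 + y\<^sup>2))))"
        unfolding Stieltjes_def by (intro Bochner_Integration.integral_cong) (auto simp: indicator_def)
      then show ?thesis by (simp only: integral_complex_of_real I2_def)
    qed
    have \<Phi>x: "\<Phi> (of_real x) = of_real p" by (simp add: \<Phi>_def p_def flip: cos_of_real)
    have Lnx: "Ln ((of_real x)\<^sup>2 + of_real (R\<^sup>2)) = of_real (ln (x\<^sup>2 + R\<^sup>2))"
      using x by (simp add: Ln_of_real add_pos_nonneg flip: of_real_power of_real_add)
    have sq: "(complex_of_real x)\<^sup>2 = of_real (x\<^sup>2)" by simp
    have "f (of_real x) = of_real (- (p * I1 - (L + (- 1) ^ n * x ^ (2 * n) * (ln (x\<^sup>2 + R\<^sup>2) - ln (x\<^sup>2)))) - L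
       - (- 1) ^ n * x ^ (2 * n) * ln (x\<^sup>2 + R\<^sup>2) - p * I2)"
      unfolding f_def A' \<Phi>x Lnx unfolding sq L S by simp
    also have "- (p * I1 - (L + (- 1) ^ n * x ^ (2 * n) * (ln (x\<^sup>2 + R\<^sup>2) - ln (x\<^sup>2)))) - L
       - (- 1) ^ n * x ^ (2 * n) * ln (x\<^sup>2 + R\<^sup>2) - p * I2 = H x - p * J x"
      by (simp add: log_monomial_def J algebra_simps)
    finally show ?thesis by (simp add: p_def)
  qed
  ultimately show ?thesis by blast
qed

lemma norm_\<Phi>_le: "norm (\<Phi> z) \<le> 2 * exp (c * norm z)"
proof -
  have e: "norm (exp v) \<le> exp (c * norm z)" if "norm v \<le> c * norm z" for v :: complex
    using norm_exp[of v] that by (meson exp_le_cancel_iff order_trans)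
  have "norm (cos (of_real c * z)) = norm (exp (\<i> * (of_real c * z)) + exp (- (\<i> * (of_real c * z)))) / 2"
    by (simp add: cos_exp_eq norm_divide)
  also have "\<dots> \<le> (exp (c * norm z) + exp (c * norm z)) / 2"
    using c by (intro divide_right_mono order_trans[OF norm_triangle_ineq] add_mono e) (auto simp: norm_mult)
  finally have "norm (cos (of_real c * z)) \<le> exp (c * norm z)" by simp
  moreover have "norm (complex_of_real b) \<le> exp (c * norm z)"
    using b_bounds c by (simp add: abs_le_iff order_trans[of _ 1])
  ultimately show ?thesis
    using norm_triangle_ineq[of "cos (of_real c * z)" "of_real b"] by (simp add: \<Phi>_def)
qed

text \<open>
Both factors of \<open>z\<^sup>2 + y\<^sup>2 = (z + iy) (z - iy)\<close> have modulus at least \<open>Re z\<close>.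
\<close>

lemma norm_Stieltjes_le:
  assumes "Re z > 0"
  shows "(Re z)\<^sup>2 * norm (Stieltjes 0 (z\<^sup>2)) \<le> (LINT y|lborel. indicator {0<..} y * w y)"
proof -
  have "norm (LINT y|lborel. indicator {0<..} y *\<^sub>R (of_real (w y) * (1 / (z\<^sup>2 + of_real (y\<^sup>2))))) \<le>
     1 / (Re z)\<^sup>2 * (LINT y|lborel. indicator {0<..} y * w y)"
  proof (rule kernel_bound_integrable(2)[of 0])
    fix y :: real
    have "z\<^sup>2 + of_real (y\<^sup>2) = (z + \<i> * of_real y) * (z - \<i> * of_real y)"
      by (simp add: power2_eq_square algebra_simps)
    moreover have "norm (z + \<i> * of_real y) \<ge> Re z" "norm (z - \<i> * of_real y) \<ge> Re z"
      using complex_Re_le_cmod[of "z + \<i> * of_real y"] complex_Re_le_cmod[of "z - \<i> * of_real y"] by auto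
    ultimately have "(Re z)\<^sup>2 \<le> norm (z\<^sup>2 + of_real (y\<^sup>2))"
      unfolding power2_eq_square[of "Re z"] using assms by (simp only: norm_mult) (intro mult_mono, auto)
    then show "norm (1 / (z\<^sup>2 + of_real (y\<^sup>2))) \<le> 1 / (Re z)\<^sup>2"
      using assms unfolding norm_divide norm_one by (intro frac_le) auto
  qed (use assms in auto)
  then show ?thesis using assms by (simp add: Stieltjes_def field_simps)
qed

lemma norm_Ln_bound:
  assumes "Re z > 0"
  shows "norm z * norm (Ln z) \<le> (norm z)\<^sup>2 + 1 + pi * norm z"
proof -
  define r where "r = norm z"
  have z: "z \<noteq> 0" using assms by auto
  have r: "r > 0" using z by (simp add: r_def)
  have "norm (Ln z) \<le> \<bar>ln r\<bar> + pi"
    using cmod_le[of "Ln z"] mpi_less_Im_Ln[OF z] Im_Ln_le_pi[OF z] z by (simp add: r_def)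
  hence "r * norm (Ln z) \<le> r * (\<bar>ln r\<bar> + pi)" using r by simp
  moreover have "r * \<bar>ln r\<bar> \<le> r\<^sup>2 + 1"
  proof (cases "r \<ge> 1")
    case True
    have "r * ln r \<le> r * r" using ln_le_minus_one[of r] r by (intro mult_left_mono) auto
    moreover have "\<bar>ln r\<bar> = ln r" using True by simp
    ultimately show ?thesis by (simp add: power2_eq_square)
  next
    case False
    have "ln (1 / r) \<le> 1 / r - 1" using r by (intro ln_le_minus_one) auto
    hence "r * (- ln r) \<le> r * (1 / r)" using r by (intro mult_left_mono) (auto simp: ln_div)
    moreover have "\<bar>ln r\<bar> = - ln r" using False r by simp
    ultimately show ?thesis using r by (simp add: add_increasing)
  qed
  ultimately show ?thesis by (simp add: r_def[symmetric] distrib_left mult.commute)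
qed

text \<open>
The local extensions glue to an even entire function. In the right half-plane it is given by the
defining formula with the principal logarithm, which yields exponential type \<open>c\<close> up to the weight
\<open>(Re z)\<^sup>2\<close>; evenness covers the left half-plane.
\<close>

theorem interpolant_exists:
  obtains E where "entire_exp_type c E" "\<And>x. x \<noteq> 0 \<Longrightarrow> E (of_real x) = of_real (H x - (cos (c * x) + b) * J x)"
proof -
  obtain E where E: "E holomorphic_on UNIV" "\<And>z. E (- z) = E z"
    "\<And>x. x > 0 \<Longrightarrow> E (of_real x) = of_real (H x - (cos (c * x) + b) * J x)"
    using even_entire_from_local_extensions[OF local_extension] by metis
  have Eneg: "E (of_real x) = of_real (H x - (cos (c * x) + b) * J x)" if "x \<noteq> 0" for x
  proof (cases "x > 0")
    case False
    hence "E (of_real (- x)) = of_real (H (- x) - (cos (c * (- x)) + b) * J (- x))" using that by (intro E(3)) auto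
    then show ?thesis using E(2)[of "of_real x"] by (simp add: log_monomial_def J_def)
  qed (use E(3) in auto)
  define W where "W = (LINT y|lborel. indicator {0<..} y * w y)"
  have form: "E z = (- 1) ^ (n + 1) * z ^ (2 * n) * (2 * Ln z) - \<Phi> z * Stieltjes 0 (z\<^sup>2)" if z: "Re z > 0" for z
  proof -
    define G where "G = (\<lambda>z. (- 1) ^ (n + 1) * z ^ (2 * n) * (2 * Ln z) - \<Phi> z * Stieltjes 0 (z\<^sup>2))"
    define S where "S = {z. Re z > 0}"
    have opS: "open S" unfolding S_def by (intro open_Collect_less continuous_intros)
    have conS: "connected S" unfolding S_def by (intro convex_connected convex_halfspace_Re_gt)
    have sq: "(\<lambda>z. z\<^sup>2) holomorphic_on S" by (intro holomorphic_intros)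
    have "(\<lambda>z. Stieltjes 0 (z\<^sup>2)) holomorphic_on S"
    proof (rule holomorphic_on_compose_gen[OF sq Stieltjes_holomorphic[of 0], unfolded o_def])
      show "(\<lambda>z. z\<^sup>2) ` S \<subseteq> {u. Im u \<noteq> 0 \<or> - (0\<^sup>2) < Re u}"
        by (auto simp: S_def Re_power2 Im_power2)
    qed simp
    hence holG: "G holomorphic_on S" unfolding G_def \<Phi>_def
      by (intro holomorphic_intros) (auto simp: S_def complex_nonpos_Reals_iff)
    have "E z - G z = 0"
    proof (rule analytic_continuation[of "\<lambda>z. E z - G z" S "of_real ` {0<..}" 1])
      show "(\<lambda>z. E z - G z) holomorphic_on S"
        by (intro holomorphic_intros holG holomorphic_on_subset[OF E(1)]) auto
      show "(1 :: complex) islimpt of_real ` {0<..}"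
        unfolding islimpt_approachable
      proof (intro allI impI)
        fix e :: real assume "e > 0"
        hence "dist (complex_of_real (1 + e / 2)) 1 = e / 2" "1 + e / 2 > 0" "complex_of_real (1 + e / 2) \<noteq> 1"
          by (simp_all add: dist_norm norm_divide)
        then show "\<exists>x'\<in>of_real ` {0<..}. x' \<noteq> 1 \<and> dist x' (1 :: complex) < e"
          using \<open>e > 0\<close> by (intro bexI[of _ "of_real (1 + e / 2)"] conjI imageI) simp_all
      qed
      fix v :: complex assume "v \<in> of_real ` {0<..}"
      then obtain x where x: "v = of_real x" "x > 0" by auto
      have "Ln (of_real x) = of_real (ln x)" using x by (simp add: Ln_of_real)
      moreover have "\<Phi> (of_real x) = of_real (cos (c * x) + b)" by (simp add: \<Phi>_def flip: cos_of_real)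
      moreover have "Stieltjes 0 ((of_real x)\<^sup>2) = of_real (J x)" using Stieltjes_real[of x] by simp
      moreover have "ln (x\<^sup>2) = 2 * ln x" using x by (simp add: ln_realpow)
      ultimately show "E v - G v = 0" using E(3)[OF x(2)] by (simp add: x(1) G_def log_monomial_def)
    qed (use opS conS z in \<open>auto simp: S_def\<close>)
    then show ?thesis by (simp add: G_def)
  qed
  have bound: "(Re z)\<^sup>2 * norm (E z) \<le>
       2 * (norm z ^ (2 * n + 3) + norm z ^ (2 * n + 1) + pi * norm z ^ (2 * n + 2)) + 2 * W * exp (c * norm z)"
    if z: "Re z > 0" for z
  proof -
    define r where "r = norm z"
    have "norm (E z) \<le> 2 * r ^ (2 * n) * norm (Ln z) + norm (\<Phi> z) * norm (Stieltjes 0 (z\<^sup>2))"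
      unfolding form[OF z] using norm_triangle_ineq4[of "(- 1) ^ (n + 1) * z ^ (2 * n) * (2 * Ln z)" "\<Phi> z * Stieltjes 0 (z\<^sup>2)"]
      by (simp add: norm_mult norm_power r_def)
    hence "(Re z)\<^sup>2 * norm (E z) \<le> (Re z)\<^sup>2 * (2 * r ^ (2 * n) * norm (Ln z) + norm (\<Phi> z) * norm (Stieltjes 0 (z\<^sup>2)))"
      by (intro mult_left_mono) auto
    also have "\<dots> = (Re z)\<^sup>2 * (2 * r ^ (2 * n) * norm (Ln z)) + norm (\<Phi> z) * ((Re z)\<^sup>2 * norm (Stieltjes 0 (z\<^sup>2)))"
      by (simp add: algebra_simps)
    also have "\<dots> \<le> r\<^sup>2 * (2 * r ^ (2 * n) * norm (Ln z)) + (2 * exp (c * r)) * W"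
    proof (intro add_mono mult_mono)
      show "(Re z)\<^sup>2 \<le> r\<^sup>2" using abs_Re_le_cmod[of z] unfolding r_def by (metis abs_le_square_iff abs_norm_cancel)
      show "norm (\<Phi> z) \<le> 2 * exp (c * r)" using norm_\<Phi>_le by (simp add: r_def)
      show "(Re z)\<^sup>2 * norm (Stieltjes 0 (z\<^sup>2)) \<le> W" using norm_Stieltjes_le[OF z] by (simp add: W_def)
    qed (auto simp: r_def)
    also have "r\<^sup>2 * (2 * r ^ (2 * n) * norm (Ln z)) = 2 * r ^ (2 * n + 1) * (r * norm (Ln z))"
      by (simp add: power2_eq_square)
    also have "\<dots> \<le> 2 * r ^ (2 * n + 1) * (r\<^sup>2 + 1 + pi * r)"
      using norm_Ln_bound[OF z] by (intro mult_left_mono) (auto simp: r_def)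
    also have "\<dots> = 2 * (r ^ (2 * n + 3) + r ^ (2 * n + 1) + pi * r ^ (2 * n + 2))"
      by (simp add: algebra_simps power2_eq_square power3_eq_cube power_add)
    finally show ?thesis by (simp add: r_def mult_ac)
  qed
  have "entire_exp_type c E"
  proof (rule entire_exp_type_if_weighted_bound[OF E(1)])
    show "c \<ge> 0" using c by simp
    fix \<epsilon> :: real assume \<epsilon>: "\<epsilon> > 0"
    have ce: "c + \<epsilon> > 0" using c \<epsilon> by simp
    obtain C1 where C1: "C1 > 0" "\<And>r. r \<ge> 0 \<Longrightarrow> r ^ (2 * n + 3) \<le> C1 * exp ((c + \<epsilon>) * r)"
      using power_le_exp[OF ce] by metis
    obtain C2 where C2: "C2 > 0" "\<And>r. r \<ge> 0 \<Longrightarrow> r ^ (2 * n + 1) \<le> C2 * exp ((c + \<epsilon>) * r)"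
      using power_le_exp[OF ce] by metis
    obtain C3 where C3: "C3 > 0" "\<And>r. r \<ge> 0 \<Longrightarrow> r ^ (2 * n + 2) \<le> C3 * exp ((c + \<epsilon>) * r)"
      using power_le_exp[OF ce] by metis
    have W0: "W \<ge> 0" unfolding W_def using w_nonneg by (intro integral_nonneg_AE) (auto simp: indicator_def)
    define C where "C = 2 * (C1 + C2 + pi * C3) + 2 * W"
    have C: "C > 0" using C1(1) C2(1) C3(1) W0 by (simp add: C_def add_pos_nonneg)
    have pos: "(Re z)\<^sup>2 * norm (E z) \<le> C * exp ((c + \<epsilon>) * norm z)" if z: "Re z > 0" for z
    proof -
      define e where "e = exp ((c + \<epsilon>) * norm z)"
      have "exp (c * norm z) \<le> e" using \<epsilon> by (simp add: e_def mult_right_mono)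
      hence "W * exp (c * norm z) \<le> W * e" using W0 by (intro mult_left_mono) auto
      moreover have "pi * norm z ^ (2 * n + 2) \<le> pi * (C3 * e)"
        using C3(2)[of "norm z"] by (intro mult_left_mono) (auto simp: e_def)
      ultimately have "2 * (norm z ^ (2 * n + 3) + norm z ^ (2 * n + 1) + pi * norm z ^ (2 * n + 2)) + 2 * W * exp (c * norm z)
         \<le> 2 * (C1 * e + C2 * e + pi * (C3 * e)) + 2 * (W * e)"
        using C1(2)[OF norm_ge_zero[of z]] C2(2)[OF norm_ge_zero[of z]] unfolding e_def[symmetric] by argo
      also have "\<dots> = C * e" by (simp add: C_def algebra_simps)
      finally show ?thesis using bound[OF z] by (simp add: e_def)
    qed
    have "(Re z)\<^sup>2 * norm (E z) \<le> C * exp ((c + \<epsilon>) * norm z)" for z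
    proof -
      consider "Re z > 0" | "Re z = 0" | "Re (- z) > 0" by fastforce
      then show ?thesis
      proof cases
        case 3 then show ?thesis using pos[of "- z"] E(2)[of z] by simp
      qed (use pos C in auto)
    qed
    then show "\<exists>C>0. \<forall>z. (Re z)\<^sup>2 * norm (E z) \<le> C * exp ((c + \<epsilon>) * norm z)" using C by blast
  qed
  then show thesis using that Eneg by blast
qed

end

section \<open>Poisson integrals over the upper half-plane\<close>

lemma Cauchy_kernel_integrable:
  fixes y :: real
  assumes "y > 0"
  shows "integrable lborel (\<lambda>x. 1 / (x\<^sup>2 + y\<^sup>2))"
proof -
  have "integrable lborel (\<lambda>x::real. inverse (1 + x\<^sup>2))"
    using integrable_inverse_1_plus_square by (simp add: set_integrable_def einterval_def)
  hence "integrable lborel (\<lambda>x::real. inverse (1 + (0 + (1 / y) * x)\<^sup>2))"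
    using assms by (intro lborel_integrable_real_affine) auto
  hence "integrable lborel (\<lambda>x::real. inverse (y\<^sup>2) * inverse (1 + (0 + (1 / y) * x)\<^sup>2))"
    by (rule integrable_mult_right)
  also have "(\<lambda>x::real. inverse (y\<^sup>2) * inverse (1 + (0 + (1 / y) * x)\<^sup>2)) = (\<lambda>x. 1 / (x\<^sup>2 + y\<^sup>2))"
    using assms by (auto simp: fun_eq_iff field_simps)
  finally show ?thesis .
qed

lemma Cauchy_kernel_bounded_integrable:
  fixes g :: "real \<Rightarrow> 'a :: {banach, second_countable_topology, real_normed_field}"
  assumes y: "y > 0" and [measurable]: "g \<in> borel_measurable borel" and B: "\<And>x. norm (g x) \<le> B"
  shows "integrable lborel (\<lambda>x. g x / of_real (x\<^sup>2 + y\<^sup>2))"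
proof (rule Bochner_Integration.integrable_bound[OF integrable_mult_right[OF Cauchy_kernel_integrable[OF y], of B]])
  show "AE x in lborel. norm (g x / of_real (x\<^sup>2 + y\<^sup>2)) \<le> norm (B * (1 / (x\<^sup>2 + y\<^sup>2)))"
  proof (rule AE_I2)
    fix x :: real
    have "x\<^sup>2 + y\<^sup>2 > 0" using y by (simp add: add_nonneg_pos)
    then show "norm (g x / of_real (x\<^sup>2 + y\<^sup>2)) \<le> norm (B * (1 / (x\<^sup>2 + y\<^sup>2)))"
      using B[of x] unfolding norm_divide norm_of_real
      by (simp add: divide_right_mono abs_mult order_trans[OF B abs_ge_self])
  qed
qed measurable

lemma symmetric_window_integral_tendsto:
  fixes f :: "real \<Rightarrow> complex"
  assumes "integrable lborel f"
  shows "(\<lambda>N. LINT x|lborel. indicator {- real N..real N} x *\<^sub>R f x) \<longlonglongrightarrow> (LINT x|lborel. f x)"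
proof (rule integral_dominated_convergence[where w = "\<lambda>x. norm (f x)"])
  show "AE x in lborel. (\<lambda>N. indicator {- real N..real N} x *\<^sub>R f x) \<longlonglongrightarrow> f x"
  proof (rule AE_I2)
    fix x :: real
    obtain N0 :: nat where N0: "\<bar>x\<bar> \<le> real N0" using real_arch_simple by blast
    have "\<forall>\<^sub>F N in sequentially. indicator {- real N..real N} x *\<^sub>R f x = f x"
      using eventually_ge_at_top[of N0]
    proof eventually_elim
      case (elim N)
      hence "x \<in> {- real N..real N}" using N0 by auto
      then show ?case by simp
    qed
    then show "(\<lambda>N. indicator {- real N..real N} x *\<^sub>R f x) \<longlonglongrightarrow> f x"
      by (rule tendsto_eventually)
  qed
qed (use assms in \<open>auto simp: indicator_def\<close>)

text \<open>
Cauchy's formula for \<open>f(z) / (z + iy)\<close> at \<open>iy\<close>, on rectangles over \<open>[-R, R]\<close> of height \<open>R\<close>: the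
three sides off the real axis have total length \<open>4 R\<close> and contribute \<open>O(1/R)\<close>.
\<close>

theorem Poisson_integral_half_plane:
  assumes hol: "f holomorphic_on {z. Im z > - \<epsilon>}" and \<epsilon>: "\<epsilon> > 0"
    and bd: "\<And>z. Im z \<ge> 0 \<Longrightarrow> norm (f z) \<le> B" and y: "y > 0"
  shows "integrable lborel (\<lambda>x. f (of_real x) / of_real (x\<^sup>2 + y\<^sup>2))"
    and "(LINT x|lborel. f (of_real x) / of_real (x\<^sup>2 + y\<^sup>2)) = of_real (pi / y) * f (\<i> * of_real y)"
proof -
  have contf: "continuous_on UNIV (\<lambda>x::real. f (of_real x))"
    by (rule continuous_on_compose2[OF holomorphic_on_imp_continuous_on[OF hol]])
       (use \<epsilon> in \<open>auto intro!: continuous_intros\<close>)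
  have [measurable]: "(\<lambda>x::real. f (of_real x)) \<in> borel_measurable borel"
    using contf by (rule borel_measurable_continuous_onI)
  have B0: "B \<ge> 0" using bd[of 0] norm_ge_zero[of "f 0"] by (simp del: norm_ge_zero)
  show int: "integrable lborel (\<lambda>x. f (of_real x) / of_real (x\<^sup>2 + y\<^sup>2))"
    by (rule Cauchy_kernel_bounded_integrable[OF y]) (auto intro: bd)
  define F where "F = (\<lambda>z. f z / (z\<^sup>2 + of_real (y\<^sup>2)))"
  define v where "v = of_real (pi / y) * f (\<i> * of_real y)"
  define S where "S = {z. Im z > - min \<epsilon> y}"
  have bound: "norm (v - (LINT x|lborel. indicator {- R..R} x *\<^sub>R (f (of_real x) / of_real (x\<^sup>2 + y\<^sup>2))))
      \<le> 4 * R * (B / (R\<^sup>2 - y\<^sup>2))" if R: "R > y" for R :: real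
  proof -
    define a1 a2 a3 a4 where "a1 = complex_of_real (- R)" and "a2 = complex_of_real R"
      and "a3 = Complex R R" and "a4 = Complex (- R) R"
    have R0: "R > 0" using R y by simp
    have R2: "R\<^sup>2 - y\<^sup>2 > 0" using R y by (simp add: power_strict_mono)
    have rect: "rectpath a1 a3 = linepath a1 a2 +++ linepath a2 a3 +++ linepath a3 a4 +++ linepath a4 a1"
      by (simp add: rectpath_def Let_def a1_def a2_def a3_def a4_def complex_of_real_def)
    have inbox: "\<i> * of_real y \<in> box a1 a3"
      using R y by (simp add: a1_def a3_def in_box_complex_iff)
    have "((\<lambda>w. (f w / (w + \<i> * of_real y)) / (w - \<i> * of_real y)) has_contour_integral
        (2 * pi * \<i> * winding_number (rectpath a1 a3) (\<i> * of_real y) * (f (\<i> * of_real y) / (\<i> * of_real y + \<i> * of_real y)))) (rectpath a1 a3)"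
    proof (rule Cauchy_integral_formula_convex_simple)
      show "convex S" unfolding S_def by (rule convex_halfspace_Im_gt)
      have opS: "open S" unfolding S_def by (intro open_Collect_less continuous_intros)
      show "(\<lambda>w. f w / (w + \<i> * of_real y)) holomorphic_on S"
        by (intro holomorphic_intros holomorphic_on_subset[OF hol]) (auto simp: S_def complex_eq_iff)
      show "\<i> * of_real y \<in> interior S" using opS y \<epsilon> by (simp add: interior_open S_def)
      show "path_image (rectpath a1 a3) \<subseteq> S - {\<i> * of_real y}"
      proof -
        have "path_image (rectpath a1 a3) = cbox a1 a3 - box a1 a3"
          using R0 by (intro path_image_rectpath_cbox_minus_box) (auto simp: a1_def a3_def)
        moreover have "cbox a1 a3 \<subseteq> S"
        proof
          fix p assume "p \<in> cbox a1 a3"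
          hence "0 \<le> Im p" by (simp add: in_cbox_complex_iff a1_def a3_def)
          moreover have "- min \<epsilon> y < 0" using y \<epsilon> by simp
          ultimately have "- min \<epsilon> y < Im p" by (rule less_le_trans[rotated])
          then show "p \<in> S" by (simp only: S_def mem_Collect_eq)
        qed
        ultimately show ?thesis using inbox by blast
      qed
    qed auto
    also have "(\<lambda>w. (f w / (w + \<i> * of_real y)) / (w - \<i> * of_real y)) = F"
    proof
      fix w :: complex
      have "w\<^sup>2 + of_real (y\<^sup>2) = (w + \<i> * of_real y) * (w - \<i> * of_real y)"
        by (simp add: power2_eq_square algebra_simps)
      then show "(f w / (w + \<i> * of_real y)) / (w - \<i> * of_real y) = F w" by (simp add: F_def)
    qed
    also have "2 * pi * \<i> * winding_number (rectpath a1 a3) (\<i> * of_real y) * (f (\<i> * of_real y) / (\<i> * of_real y + \<i> * of_real y)) = v"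
      using winding_number_rectpath[OF inbox] y by (simp add: v_def field_simps)
    finally have main: "(F has_contour_integral v) (rectpath a1 a3)" .
    hence ci: "F contour_integrable_on rectpath a1 a3" by (auto simp: contour_integrable_on_def)
    hence cis: "F contour_integrable_on linepath a1 a2" "F contour_integrable_on linepath a2 a3"
      "F contour_integrable_on linepath a3 a4" "F contour_integrable_on linepath a4 a1"
      unfolding rect by (auto simp: contour_integrable_join)
    have "v = contour_integral (rectpath a1 a3) F" using main by (simp add: contour_integral_unique)
    also have "\<dots> = contour_integral (linepath a1 a2) F + contour_integral (linepath a2 a3) F +
         contour_integral (linepath a3 a4) F + contour_integral (linepath a4 a1) F"
      unfolding rect using cis by simp
    finally have veq: "v - contour_integral (linepath a1 a2) F = contour_integral (linepath a2 a3) F +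
         contour_integral (linepath a3 a4) F + contour_integral (linepath a4 a1) F" by simp
    have Fb: "norm (F z) \<le> B / (R\<^sup>2 - y\<^sup>2)" if z: "Im z \<ge> 0" "norm z \<ge> R" for z
    proof -
      have "R\<^sup>2 \<le> (norm z)\<^sup>2" using z R0 by (intro power_mono) auto
      hence "R\<^sup>2 - y\<^sup>2 \<le> norm (z\<^sup>2) - norm (complex_of_real (y\<^sup>2))" by (simp add: norm_power)
      also have "\<dots> \<le> norm (z\<^sup>2 + of_real (y\<^sup>2))" by (rule norm_diff_ineq)
      finally have "R\<^sup>2 - y\<^sup>2 \<le> norm (z\<^sup>2 + of_real (y\<^sup>2))" .
      then show ?thesis unfolding F_def norm_divide using bd[OF z(1)] B0 R2 by (intro frac_le) auto
    qed
    have BR: "0 \<le> B / (R\<^sup>2 - y\<^sup>2)" using B0 R2 by simp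
    have side: "norm (contour_integral (linepath p q) F) \<le> B / (R\<^sup>2 - y\<^sup>2) * norm (q - p)"
      if "F contour_integrable_on linepath p q" "closed_segment p q \<subseteq> {z. Im z \<ge> 0 \<and> norm z \<ge> R}" for p q
      by (rule contour_integral_bound_linepath[OF that(1) BR]) (use that(2) Fb in auto)
    have seg: "closed_segment p q \<subseteq> {z. Im z \<ge> 0 \<and> norm z \<ge> R}"
      if "p \<in> T" "q \<in> T" "convex T" "T \<subseteq> {z. Im z \<ge> 0 \<and> norm z \<ge> R}" for p q T
      using that convex_contains_segment by blast
    have T1: "{z. Im z \<ge> 0} \<inter> {z. Re z \<ge> R} \<subseteq> {z. Im z \<ge> 0 \<and> norm z \<ge> R}"
      by (auto intro: order_trans[OF _ complex_Re_le_cmod])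
    have T2: "{z. Im z \<ge> R} \<subseteq> {z. Im z \<ge> 0 \<and> norm z \<ge> R}"
      using R0 by (auto intro: order_trans[OF _ order_trans[OF abs_ge_self abs_Im_le_cmod]])
    have T3: "{z. Im z \<ge> 0} \<inter> {z. Re z \<le> - R} \<subseteq> {z. Im z \<ge> 0 \<and> norm z \<ge> R}"
      using R0 by (auto intro: order_trans[OF _ order_trans[OF _ abs_Re_le_cmod]])
    have cs: "convex {z. Im z \<ge> u}" "convex {z. Re z \<ge> u}" "convex {z. Re z \<le> u}" for u
      by (auto intro: convex_halfspace_Im_ge convex_halfspace_Re_ge convex_halfspace_Re_le)
    have "a3 - a2 = \<i> * of_real R" "a4 - a3 = - of_real (2 * R)" "a1 - a4 = - (\<i> * of_real R)"
      by (simp_all add: complex_eq_iff a1_def a2_def a3_def a4_def)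
    hence lens: "norm (a3 - a2) = R" "norm (a4 - a3) = 2 * R" "norm (a1 - a4) = R"
      using R0 by (simp_all add: norm_mult)
    have "a2 \<in> {z. Im z \<ge> 0} \<inter> {z. Re z \<ge> R}" "a3 \<in> {z. Im z \<ge> 0} \<inter> {z. Re z \<ge> R}"
      using R0 by (simp_all add: a2_def a3_def)
    from side[OF cis(2) seg[OF this convex_Int[OF cs(1) cs(2)] T1]]
    have s1: "norm (contour_integral (linepath a2 a3) F) \<le> B / (R\<^sup>2 - y\<^sup>2) * R"
      unfolding lens .
    have "a3 \<in> {z. Im z \<ge> R}" "a4 \<in> {z. Im z \<ge> R}" by (simp_all add: a3_def a4_def)
    from side[OF cis(3) seg[OF this cs(1) T2]]
    have s2: "norm (contour_integral (linepath a3 a4) F) \<le> B / (R\<^sup>2 - y\<^sup>2) * (2 * R)"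
      unfolding lens .
    have "a4 \<in> {z. Im z \<ge> 0} \<inter> {z. Re z \<le> - R}" "a1 \<in> {z. Im z \<ge> 0} \<inter> {z. Re z \<le> - R}"
      using R0 by (simp_all add: a4_def a1_def)
    from side[OF cis(4) seg[OF this convex_Int[OF cs(1) cs(3)] T3]]
    have s3: "norm (contour_integral (linepath a4 a1) F) \<le> B / (R\<^sup>2 - y\<^sup>2) * R"
      unfolding lens .
    have "contour_integral (linepath a1 a2) F = integral {- R..R} (\<lambda>x. F (of_real x))"
      using contour_integral_linepath_Reals_eq[of a1 a2 F] R0 by (simp add: a1_def a2_def)
    also have "\<dots> = (LINT x|lborel. indicator {- R..R} x *\<^sub>R (f (of_real x) / of_real (x\<^sup>2 + y\<^sup>2)))"
    proof -
      have "set_integrable lborel {- R..R} (\<lambda>x. f (of_real x) / of_real (x\<^sup>2 + y\<^sup>2))"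
        unfolding set_integrable_def by (intro integrable_mult_indicator int) auto
      from set_borel_integral_eq_integral(2)[OF this] show ?thesis
        by (simp add: set_lebesgue_integral_def F_def)
    qed
    finally have "norm (v - (LINT x|lborel. indicator {- R..R} x *\<^sub>R (f (of_real x) / of_real (x\<^sup>2 + y\<^sup>2)))) =
        norm (contour_integral (linepath a2 a3) F + contour_integral (linepath a3 a4) F + contour_integral (linepath a4 a1) F)"
      using veq by simp
    also have "\<dots> \<le> B / (R\<^sup>2 - y\<^sup>2) * R + B / (R\<^sup>2 - y\<^sup>2) * (2 * R) + B / (R\<^sup>2 - y\<^sup>2) * R"
      by (intro order_trans[OF norm_triangle_ineq] add_mono s1 s2 s3)
    also have "\<dots> = 4 * R * (B / (R\<^sup>2 - y\<^sup>2))" by (simp add: algebra_simps)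
    finally show ?thesis .
  qed
  have "(\<lambda>N. v - (LINT x|lborel. indicator {- real N..real N} x *\<^sub>R (f (of_real x) / of_real (x\<^sup>2 + y\<^sup>2)))) \<longlonglongrightarrow> 0"
  proof (rule Lim_null_comparison)
    show "\<forall>\<^sub>F N in sequentially. norm (v - (LINT x|lborel. indicator {- real N..real N} x *\<^sub>R (f (of_real x) / of_real (x\<^sup>2 + y\<^sup>2))))
       \<le> 4 * real N * (B / ((real N)\<^sup>2 - y\<^sup>2))"
      using eventually_gt_at_top[of "nat \<lceil>y\<rceil>"]
    proof eventually_elim
      case (elim N)
      hence "real N > y" by linarith
      then show ?case by (rule bound)
    qed
    show "(\<lambda>N. 4 * real N * (B / ((real N)\<^sup>2 - y\<^sup>2))) \<longlonglongrightarrow> 0" by real_asymp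
  qed
  from tendsto_diff[OF tendsto_const[of v] this]
  have "(\<lambda>N. (LINT x|lborel. indicator {- real N..real N} x *\<^sub>R (f (of_real x) / of_real (x\<^sup>2 + y\<^sup>2)))) \<longlonglongrightarrow> v"
    by simp
  then show "(LINT x|lborel. f (of_real x) / of_real (x\<^sup>2 + y\<^sup>2)) = of_real (pi / y) * f (\<i> * of_real y)"
    using symmetric_window_integral_tendsto[OF int] unfolding v_def by (rule LIMSEQ_unique[rotated])
qed

lemma integral_cos_Cauchy_kernel:
  fixes c b y :: real
  assumes c: "c > 0" and y: "y > 0"
  shows "has_bochner_integral lborel (\<lambda>x. (cos (c * x) + b) / (x\<^sup>2 + y\<^sup>2)) (pi / y * (exp (- c * y) + b))"
proof -
  define f where "f = (\<lambda>z. exp (\<i> * of_real c * z) + of_real b)"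
  have bd: "norm (f z) \<le> 1 + \<bar>b\<bar>" if "Im z \<ge> 0" for z
  proof -
    have "norm (exp (\<i> * of_real c * z)) \<le> 1" using that c by simp
    then show ?thesis unfolding f_def
      by (metis add_right_mono norm_of_real norm_triangle_le)
  qed
  have hol: "f holomorphic_on {z. Im z > - 1}" unfolding f_def by (intro holomorphic_intros)
  note P = Poisson_integral_half_plane[OF hol zero_less_one bd y]
  have "has_bochner_integral lborel (\<lambda>x. f (of_real x) / of_real (x\<^sup>2 + y\<^sup>2)) (of_real (pi / y) * f (\<i> * of_real y))"
    using P by (simp add: has_bochner_integral_iff)
  from has_bochner_integral_Re[OF this]
  have "has_bochner_integral lborel (\<lambda>x. Re (f (of_real x) / of_real (x\<^sup>2 + y\<^sup>2))) (Re (of_real (pi / y) * f (\<i> * of_real y)))" .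
  moreover have "Re (f (of_real x) / of_real (x\<^sup>2 + y\<^sup>2)) = (cos (c * x) + b) / (x\<^sup>2 + y\<^sup>2)" for x
    unfolding Re_divide_of_real by (simp add: f_def Re_exp)
  moreover have "Re (of_real (pi / y) * f (\<i> * of_real y)) = pi / y * (exp (- c * y) + b)"
  proof -
    have "f (\<i> * of_real y) = of_real (exp (- c * y) + b)"
      by (simp add: f_def exp_of_real[symmetric] mult_ac)
    then show ?thesis by (simp only: of_real_mult[symmetric] Re_complex_of_real)
  qed
  ultimately show ?thesis by (simp only:)
qed

text \<open>
Near the unit circle this tends to \<open>\<pi>/4\<close> times the sign of \<open>Re z\<close>: the square wave is the boundary
value of the real part of a holomorphic function.
\<close>

lemma Re_Arctan_unit_disc:
  assumes "norm z < 1"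
  shows "Re (Arctan z) = arctan (2 * Re z / (1 - (norm z)\<^sup>2)) / 2"
proof -
  define q where "q = (1 - \<i> * z) / (1 + \<i> * z)"
  have nz: "1 + \<i> * z \<noteq> 0"
  proof
    assume "1 + \<i> * z = 0"
    hence "\<i> * z = - 1" by (simp add: eq_neg_iff_add_eq_0 add.commute)
    hence "norm (\<i> * z) = 1" by simp
    then show False using assms by (simp add: norm_mult)
  qed
  define d where "d = (norm (1 + \<i> * z))\<^sup>2"
  have d: "d > 0" using nz by (simp add: d_def)
  have n1: "1 - (norm z)\<^sup>2 > 0" using assms by (simp add: power_less_one_iff abs_square_less_1)
  have "q = (1 - \<i> * z) * cnj (1 + \<i> * z) / of_real d"
    using nz by (simp add: q_def d_def complex_div_cnj[of "1 - \<i> * z"] del: of_real_power)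
  also have "(1 - \<i> * z) * cnj (1 + \<i> * z) = Complex (1 - (norm z)\<^sup>2) (- 2 * Re z)"
    unfolding cmod_power2 by (simp add: complex_eq_iff power2_eq_square algebra_simps)
  finally have q: "Re q = (1 - (norm z)\<^sup>2) / d" "Im q = - 2 * Re z / d"
    by (simp_all add: Re_divide_of_real Im_divide_of_real)
  have "Re q > 0" using q d n1 by simp
  hence "Im (Ln q) = arctan (Im q / Re q)"
    by (metis Arg_eq_Im_Ln arg_conv_arctan complex_surj less_numeral_extra(3) zero_complex.simps(1))
  also have "Im q / Re q = - (2 * Re z / (1 - (norm z)\<^sup>2))" using q d n1 by simp
  finally have "Im (Ln q) = - arctan (2 * Re z / (1 - (norm z)\<^sup>2))" by (simp only: arctan_minus)
  then show ?thesis by (simp add: Arctan_def q_def[symmetric])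
qed

lemma norm_Arctan_le:
  assumes r: "r < 1" and z: "norm z \<le> r"
  shows "norm (Arctan z) \<le> norm z / (1 - r\<^sup>2)"
proof -
  have r0: "0 \<le> r" using z norm_ge_zero[of z] by linarith
  have r2: "1 - r\<^sup>2 > 0" using r r0 by (simp add: power_less_one_iff abs_square_less_1)
  have "norm (Arctan z - Arctan 0) \<le> 1 / (1 - r\<^sup>2) * norm (z - 0)"
  proof (rule field_differentiable_bound[of "cball 0 r"])
    fix w :: complex assume w: "w \<in> cball 0 r"
    hence nw: "norm w \<le> r" by simp
    have "\<bar>Im w\<bar> < 1" using abs_Im_le_cmod[of w] nw r by linarith
    then show "(Arctan has_field_derivative inverse (1 + w\<^sup>2)) (at w within cball 0 r)"
      by (rule has_field_derivative_at_within[OF has_field_derivative_Arctan])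
    have "(norm w)\<^sup>2 \<le> r\<^sup>2" using nw by (intro power_mono) auto
    hence "1 - r\<^sup>2 \<le> norm (1 + w\<^sup>2)"
      using norm_diff_ineq[of 1 "w\<^sup>2"] by (simp add: norm_power)
    from frac_le[OF zero_le_one order_refl r2 this] show "norm (inverse (1 + w\<^sup>2)) \<le> 1 / (1 - r\<^sup>2)"
      by (simp only: inverse_eq_divide norm_divide norm_one)
  qed (use z r0 in auto)
  then show ?thesis by simp
qed

text \<open>
The Poisson integral of \<open>cos (\<pi> z) Arctan (r exp (i\<pi>z))\<close>. This function is bounded in the upper
half-plane because the exponential decay of the second factor compensates the growth of the first.
\<close>

lemma integral_abs_cos_Cauchy_kernel_Abel:
  assumes r: "0 < r" "r < 1" and y: "y > 0"
  shows "(LINT x|lborel. cos (pi * x) * (arctan (2 * (r * cos (pi * x)) / (1 - r\<^sup>2)) / 2) / (x\<^sup>2 + y\<^sup>2))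
     = pi / y * (cosh (pi * y) * arctan (r * exp (- pi * y)))"
proof -
  define e where "e = (\<lambda>z. of_real r * exp (\<i> * of_real pi * z))"
  have ne: "norm (e z) = r * exp (- pi * Im z)" for z using r by (simp add: e_def norm_mult)
  define f where "f = (\<lambda>z. cos (of_real pi * z) * Arctan (e z))"
  define \<epsilon> where "\<epsilon> = - ln r / pi"
  have \<epsilon>: "\<epsilon> > 0" using r by (simp add: \<epsilon>_def divide_neg_pos)
  have small: "norm (e z) < 1" if "Im z > - \<epsilon>" for z
  proof -
    have "- pi * Im z < - ln r" using that pi_gt_zero by (simp add: \<epsilon>_def field_simps)
    hence "exp (- pi * Im z) < exp (- ln r)" by simp
    hence "r * exp (- pi * Im z) < r * exp (- ln r)" using r by simp
    then show ?thesis using r by (simp add: ne exp_minus)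
  qed
  have hol: "f holomorphic_on {z. Im z > - \<epsilon>}" unfolding f_def
  proof (intro holomorphic_intros)
    have "(\<lambda>z. Arctan (e z)) field_differentiable at z" if z: "Im z > - \<epsilon>" for z
    proof -
      have "\<bar>Im (e z)\<bar> < 1" using small[OF z] abs_Im_le_cmod[of "e z"] by linarith
      hence "Arctan field_differentiable at (e z)"
        using has_field_derivative_Arctan[of "e z"] by (auto simp: field_differentiable_def)
      moreover have "e field_differentiable at z" unfolding e_def
        by (intro holomorphic_on_imp_differentiable_at[of _ UNIV] holomorphic_intros) auto
      ultimately show ?thesis using field_differentiable_compose[of e z Arctan] by (simp add: o_def)
    qed
    then show "(\<lambda>z. Arctan (e z)) holomorphic_on {z. Im z > - \<epsilon>}"
      by (auto simp: holomorphic_on_def field_differentiable_at_within)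
  qed
  have bd: "norm (f z) \<le> r / (1 - r\<^sup>2)" if z: "Im z \<ge> 0" for z
  proof -
    have "norm (e z) \<le> r" using z r by (simp add: ne mult_left_le)
    hence "norm (Arctan (e z)) \<le> norm (e z) / (1 - r\<^sup>2)" using norm_Arctan_le[OF r(2)] by blast
    moreover have "norm (cos (of_real pi * z)) \<le> exp (pi * Im z)"
    proof -
      have "norm (cos (of_real pi * z)) = norm (exp (\<i> * (of_real pi * z)) + exp (- (\<i> * (of_real pi * z)))) / 2"
        by (simp add: cos_exp_eq norm_divide)
      also have "\<dots> \<le> (exp (- pi * Im z) + exp (pi * Im z)) / 2"
        by (intro divide_right_mono order_trans[OF norm_triangle_ineq]) auto
      also have "\<dots> \<le> exp (pi * Im z)" using z by simp
      finally show ?thesis .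
    qed
    ultimately have "norm (f z) \<le> exp (pi * Im z) * (norm (e z) / (1 - r\<^sup>2))"
      unfolding f_def norm_mult by (intro mult_mono) auto
    also have "\<dots> = r / (1 - r\<^sup>2)" by (simp add: ne exp_minus)
    finally show ?thesis .
  qed
  note P = Poisson_integral_half_plane[OF hol \<epsilon> bd y]
  have "Re (LINT x|lborel. f (of_real x) / of_real (x\<^sup>2 + y\<^sup>2)) = (LINT x|lborel. Re (f (of_real x) / of_real (x\<^sup>2 + y\<^sup>2)))"
    by (rule integral_Re[OF P(1), symmetric])
  also have "(\<lambda>x. Re (f (of_real x) / of_real (x\<^sup>2 + y\<^sup>2))) =
     (\<lambda>x. cos (pi * x) * (arctan (2 * (r * cos (pi * x)) / (1 - r\<^sup>2)) / 2) / (x\<^sup>2 + y\<^sup>2))"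
  proof
    fix x :: real
    have ex: "norm (e (of_real x)) = r" by (simp add: ne)
    have "Re (e (of_real x)) = r * cos (pi * x)" by (simp add: e_def Re_exp)
    hence re: "Re (Arctan (e (of_real x))) = arctan (2 * (r * cos (pi * x)) / (1 - r\<^sup>2)) / 2"
      using Re_Arctan_unit_disc[of "e (of_real x)"] ex r by simp
    have "cos (of_real pi * complex_of_real x) = of_real (cos (pi * x))" by (simp flip: cos_of_real)
    hence "Re (f (of_real x)) = cos (pi * x) * Re (Arctan (e (of_real x)))"
      unfolding f_def by simp
    then show "Re (f (of_real x) / of_real (x\<^sup>2 + y\<^sup>2)) =
       cos (pi * x) * (arctan (2 * (r * cos (pi * x)) / (1 - r\<^sup>2)) / 2) / (x\<^sup>2 + y\<^sup>2)"
      unfolding Re_divide_of_real by (simp only: re)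
  qed
  also have "Re (LINT x|lborel. f (of_real x) / of_real (x\<^sup>2 + y\<^sup>2)) = pi / y * (cosh (pi * y) * arctan (r * exp (- pi * y)))"
  proof -
    have 1: "cos (of_real pi * (\<i> * of_real y)) = complex_of_real (cosh (pi * y))"
      by (simp add: cos_exp_eq cosh_field_def exp_of_real[symmetric] mult_ac)
    have 2: "e (\<i> * of_real y) = of_real (r * exp (- pi * y))"
      by (simp add: e_def exp_of_real[symmetric] mult_ac)
    have "f (\<i> * of_real y) = of_real (cosh (pi * y) * arctan (r * exp (- pi * y)))"
      unfolding f_def 1 2 Arctan_of_real by (rule of_real_mult[symmetric])
    with P(2) have "(LINT x|lborel. f (of_real x) / of_real (x\<^sup>2 + y\<^sup>2)) =
        of_real (pi / y * (cosh (pi * y) * arctan (r * exp (- pi * y))))"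
      by (simp only: of_real_mult)
    then show ?thesis by (metis Re_complex_of_real)
  qed
  finally show ?thesis ..
qed

text \<open>
Let \<open>r\<close> tend to 1 in the Abel-regularized identity: the integrand tends to \<open>\<pi>/4\<close> times \<open>\<bar>cos (\<pi> x)\<bar>\<close>
against the kernel, dominated by a multiple of the kernel itself.
\<close>

lemma integral_abs_cos_Cauchy_kernel:
  assumes y: "y > 0"
  shows "has_bochner_integral lborel (\<lambda>x. \<bar>cos (pi * x)\<bar> / (x\<^sup>2 + y\<^sup>2)) (4 / y * (cosh (pi * y) * arctan (exp (- pi * y))))"
proof -
  define r where "r = (\<lambda>N::nat. 1 - 1 / (real N + 2))"
  have r: "0 < r N" "r N < 1" for N by (auto simp: r_def field_simps)
  have r_lim: "r \<longlonglongrightarrow> 1" unfolding r_def by real_asymp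
  define s where "s = (\<lambda>N x. cos (pi * x) * (arctan (2 * (r N * cos (pi * x)) / (1 - (r N)\<^sup>2)) / 2) / (x\<^sup>2 + y\<^sup>2))"
  have "(\<lambda>N. LINT x|lborel. s N x) \<longlonglongrightarrow> (LINT x|lborel. pi / 4 * (\<bar>cos (pi * x)\<bar> / (x\<^sup>2 + y\<^sup>2)))"
  proof (rule integral_dominated_convergence[where w = "\<lambda>x. pi / 4 * (1 / (x\<^sup>2 + y\<^sup>2))"])
    show "integrable lborel (\<lambda>x. pi / 4 * (1 / (x\<^sup>2 + y\<^sup>2)))"
      by (intro integrable_mult_right Cauchy_kernel_integrable y)
    have pos: "x\<^sup>2 + y\<^sup>2 > 0" for x using y by (simp add: add_nonneg_pos)
    show "AE x in lborel. norm (s N x) \<le> pi / 4 * (1 / (x\<^sup>2 + y\<^sup>2))" for N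
    proof (rule AE_I2)
      fix x :: real
      have "\<bar>arctan (2 * (r N * cos (pi * x)) / (1 - (r N)\<^sup>2)) / 2\<bar> \<le> pi / 4"
        using arctan_bounded[of "2 * (r N * cos (pi * x)) / (1 - (r N)\<^sup>2)"] by (auto simp: abs_le_iff)
      hence "\<bar>cos (pi * x) * (arctan (2 * (r N * cos (pi * x)) / (1 - (r N)\<^sup>2)) / 2)\<bar> \<le> 1 * (pi / 4)"
        unfolding abs_mult by (intro mult_mono) auto
      hence "\<bar>cos (pi * x) * (arctan (2 * (r N * cos (pi * x)) / (1 - (r N)\<^sup>2)) / 2)\<bar> / \<bar>x\<^sup>2 + y\<^sup>2\<bar> \<le> 1 * (pi / 4) / \<bar>x\<^sup>2 + y\<^sup>2\<bar>"
        by (intro divide_right_mono) auto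
      also have "\<dots> = pi / 4 * (1 / (x\<^sup>2 + y\<^sup>2))" using pos[of x] by simp
      finally show "norm (s N x) \<le> pi / 4 * (1 / (x\<^sup>2 + y\<^sup>2))"
        by (simp only: s_def real_norm_def abs_divide)
    qed
    show "AE x in lborel. (\<lambda>N. s N x) \<longlonglongrightarrow> pi / 4 * (\<bar>cos (pi * x)\<bar> / (x\<^sup>2 + y\<^sup>2))"
    proof (rule AE_I2)
      fix x :: real
      define u where "u = cos (pi * x)"
      have "(\<lambda>N. u * (arctan (2 * (r N * u) / (1 - (r N)\<^sup>2)) / 2)) \<longlonglongrightarrow> pi / 4 * \<bar>u\<bar>"
      proof -
        have "(\<lambda>N. arctan (2 * (r N * u) / (1 - (r N)\<^sup>2))) \<longlonglongrightarrow> sgn u * (pi / 2)"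
        proof (cases u "0 :: real" rule: linorder_cases)
          case less
          have "filterlim (\<lambda>N. 2 * (r N * u) / (1 - (r N)\<^sup>2)) at_bot sequentially"
            unfolding r_def using less by real_asymp
          from filterlim_compose[OF tendsto_arctan_at_bot this] show ?thesis using less by simp
        next
          case greater
          have "filterlim (\<lambda>N. 2 * (r N * u) / (1 - (r N)\<^sup>2)) at_top sequentially"
            unfolding r_def using greater by real_asymp
          from filterlim_compose[OF tendsto_arctan_at_top this] show ?thesis using greater by simp
        qed simp
        hence "(\<lambda>N. u * (arctan (2 * (r N * u) / (1 - (r N)\<^sup>2)) / 2)) \<longlonglongrightarrow> u * (sgn u * (pi / 2) / 2)"
          by (intro tendsto_intros) auto
        then show ?thesis by (simp add: abs_sgn mult_ac)
      qed
      hence "(\<lambda>N. u * (arctan (2 * (r N * u) / (1 - (r N)\<^sup>2)) / 2) / (x\<^sup>2 + y\<^sup>2)) \<longlonglongrightarrow> pi / 4 * \<bar>u\<bar> / (x\<^sup>2 + y\<^sup>2)"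
        using pos[of x] by (intro tendsto_divide tendsto_const) auto
      then show "(\<lambda>N. s N x) \<longlonglongrightarrow> pi / 4 * (\<bar>cos (pi * x)\<bar> / (x\<^sup>2 + y\<^sup>2))"
        by (simp add: s_def u_def)
    qed
  qed (unfold s_def, measurable)
  moreover have "(\<lambda>N. LINT x|lborel. s N x) \<longlonglongrightarrow> pi / y * (cosh (pi * y) * arctan (1 * exp (- pi * y)))"
    unfolding s_def integral_abs_cos_Cauchy_kernel_Abel[OF r y] by (intro tendsto_intros r_lim)
  ultimately have "(LINT x|lborel. pi / 4 * (\<bar>cos (pi * x)\<bar> / (x\<^sup>2 + y\<^sup>2))) = pi / y * (cosh (pi * y) * arctan (1 * exp (- pi * y)))"
    by (rule LIMSEQ_unique)
  hence "pi / 4 * (LINT x|lborel. \<bar>cos (pi * x)\<bar> / (x\<^sup>2 + y\<^sup>2)) = pi / y * (cosh (pi * y) * arctan (exp (- pi * y)))"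
    by (simp only: integral_mult_right_zero mult_1)
  hence "(LINT x|lborel. \<bar>cos (pi * x)\<bar> / (x\<^sup>2 + y\<^sup>2)) = 4 / y * (cosh (pi * y) * arctan (exp (- pi * y)))"
    using y by (simp add: field_simps)
  moreover have "integrable lborel (\<lambda>x. \<bar>cos (pi * x)\<bar> / of_real (x\<^sup>2 + y\<^sup>2))"
    by (rule Cauchy_kernel_bounded_integrable[OF y, of _ 1]) auto
  ultimately show ?thesis by (simp add: has_bochner_integral_iff)
qed

section \<open>Evaluation of the distances\<close>

lemma has_bochner_integral_power_exp:
  fixes a :: real
  assumes "a > 0"
  shows "has_bochner_integral lborel (\<lambda>y. indicator {0<..} y * (y ^ k * exp (- a * y))) (fact k / a ^ (k + 1))"
proof (rule has_bochner_integral_nn_integral)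
  have "(\<integral>\<^sup>+ y. ennreal (indicator {0<..} y * (y ^ k * exp (- a * y))) \<partial>lborel) =
        (\<integral>\<^sup>+ y. ennreal (y ^ k * exp (- a * y)) * indicator {0<..} y \<partial>lborel)"
    by (intro nn_integral_cong) (auto simp: indicator_def)
  then show "(\<integral>\<^sup>+ y. ennreal (indicator {0<..} y * (y ^ k * exp (- a * y))) \<partial>lborel) = ennreal (fact k / a ^ (k + 1))"
    using nn_integral_power_exp[OF assms, of k] by simp
qed (use assms in \<open>auto simp: indicator_def\<close>)

lemma riemann_zeta_sums:
  assumes "m \<ge> 1"
  shows "(\<lambda>j. 1 / real (j + 1) ^ (m + 1)) sums riemann_zeta (real m + 1)"
proof -
  have eq: "real (j + 1) powr (- (real m + 1)) = 1 / real (j + 1) ^ (m + 1)" for j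
  proof -
    have "real (j + 1) powr (- (real m + 1)) = inverse (real (j + 1) powr (real m + 1))" by (rule powr_minus)
    also have m1: "real m + 1 = real (m + 1)" by simp
    also have "real (j + 1) powr real (m + 1) = real (j + 1) ^ (m + 1)" by (rule powr_realpow) simp
    finally show ?thesis by (simp only: inverse_eq_divide m1)
  qed
  have "summable (\<lambda>j. real j powr (- (real m + 1)))" using assms by (simp add: summable_real_powr_iff)
  hence "summable (\<lambda>j. real (Suc j) powr (- (real m + 1)))" by (subst summable_Suc_iff)
  hence "summable (\<lambda>j. real (j + 1) powr (- (real m + 1)))" by simp
  from summable_sums[OF this] show ?thesis unfolding riemann_zeta_def eq .
qed

text \<open>
Expand into a geometric series with positive terms.
\<close>

lemma integral_Bose:
  fixes c :: real
  assumes c: "c > 0" and m: "m \<ge> 1"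
  shows "has_bochner_integral lborel (\<lambda>y. indicator {0<..} y * (y ^ m * exp (- c * y) / (1 - exp (- c * y))))
     (fact m / c ^ (m + 1) * riemann_zeta (real m + 1))"
proof (rule has_bochner_integral_nn_integral)
  define f where "f = (\<lambda>k y. indicator {0<..} y * (y ^ m * exp (- (c * real (k + 1)) * y)))"
  have f0: "f k y \<ge> 0" for k y by (auto simp: f_def indicator_def)
  have [measurable]: "f k \<in> borel_measurable borel" for k unfolding f_def by measurable
  have e1: "exp (- c * y) < 1" if "y > 0" for y using c that by simp
  have fs: "(\<lambda>k. f k y) sums (indicator {0<..} y * (y ^ m * exp (- c * y) / (1 - exp (- c * y))))" for y
  proof (cases "y > 0")
    case True
    have "(\<lambda>k. y ^ m * exp (- c * y) * exp (- c * y) ^ k) sums (y ^ m * exp (- c * y) * (1 / (1 - exp (- c * y))))"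
      using e1[OF True] by (intro sums_mult geometric_sums) simp
    moreover have "y ^ m * exp (- c * y) * exp (- c * y) ^ k = f k y" for k
      using True by (simp add: f_def exp_of_nat_mult[symmetric] exp_add[symmetric] algebra_simps)
    ultimately show ?thesis using True by simp
  qed (simp add: f_def)
  have "(\<integral>\<^sup>+ y. ennreal (indicator {0<..} y * (y ^ m * exp (- c * y) / (1 - exp (- c * y)))) \<partial>lborel) =
        (\<integral>\<^sup>+ y. (\<Sum>k. ennreal (f k y)) \<partial>lborel)"
    by (intro nn_integral_cong) (simp only: suminf_ennreal_eq[OF f0 fs])
  also have "\<dots> = (\<Sum>k. \<integral>\<^sup>+ y. ennreal (f k y) \<partial>lborel)"
    by (rule nn_integral_suminf) measurable
  also have "\<dots> = (\<Sum>k. ennreal (fact m / c ^ (m + 1) * (1 / real (k + 1) ^ (m + 1))))"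
  proof (intro suminf_cong)
    fix k :: nat
    have ck: "c * real (k + 1) > 0" using c by simp
    have "(\<integral>\<^sup>+ y. ennreal (f k y) \<partial>lborel) = ennreal (fact m / (c * real (k + 1)) ^ (m + 1))"
      using has_bochner_integral_power_exp[OF ck, of m] f0
      unfolding f_def has_bochner_integral_iff
      by (subst nn_integral_eq_integral) auto
    then show "(\<integral>\<^sup>+ y. ennreal (f k y) \<partial>lborel) = ennreal (fact m / c ^ (m + 1) * (1 / real (k + 1) ^ (m + 1)))"
      by (simp only: power_mult_distrib times_divide_times_eq mult_1_right)
  qed
  also have "\<dots> = ennreal (fact m / c ^ (m + 1) * riemann_zeta (real m + 1))"
    by (rule suminf_ennreal_eq[OF _ sums_mult[OF riemann_zeta_sums[OF m]]]) (use c in auto)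
  finally show "(\<integral>\<^sup>+ y. ennreal (indicator {0<..} y * (y ^ m * exp (- c * y) / (1 - exp (- c * y)))) \<partial>lborel) =
     ennreal (fact m / c ^ (m + 1) * riemann_zeta (real m + 1))" .
  have "riemann_zeta (real m + 1) \<ge> 0"
    using sums_le[OF _ sums_zero riemann_zeta_sums[OF m]] by simp
  then show "0 \<le> fact m / c ^ (m + 1) * riemann_zeta (real m + 1)" using c by simp
qed (use c in \<open>auto simp: indicator_def\<close>)

text \<open>
Since \<open>e / (1 + e) = e / (1 - e) - 2 e\<^sup>2 / (1 - e\<^sup>2)\<close>, the integral is a combination of two Bose
integrals, with rates \<open>c\<close> and \<open>2 c\<close>. Each of them diverges for \<open>m = 0\<close>.
\<close>

lemma integral_Fermi:
  fixes c :: real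
  assumes c: "c > 0" and m: "m \<ge> 1"
  shows "has_bochner_integral lborel (\<lambda>y. indicator {0<..} y * (y ^ m * exp (- c * y) / (1 + exp (- c * y))))
     (fact m / c ^ (m + 1) * ((1 - 1 / 2 ^ m) * riemann_zeta (real m + 1)))"
proof -
  define V where "V = fact m / c ^ (m + 1) * riemann_zeta (real m + 1)"
  have c2: "2 * c > 0" using c by simp
  have "has_bochner_integral lborel (\<lambda>y. indicator {0<..} y * (y ^ m * exp (- c * y) / (1 - exp (- c * y)))
      - 2 * (indicator {0<..} y * (y ^ m * exp (- (2 * c) * y) / (1 - exp (- (2 * c) * y)))))
     (fact m / c ^ (m + 1) * riemann_zeta (real m + 1) - 2 * (fact m / (2 * c) ^ (m + 1) * riemann_zeta (real m + 1)))"
    by (intro has_bochner_integral_diff has_bochner_integral_mult_right integral_Bose c c2 m)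
  moreover have "indicator {0<..} y * (y ^ m * exp (- c * y) / (1 - exp (- c * y)))
      - 2 * (indicator {0<..} y * (y ^ m * exp (- (2 * c) * y) / (1 - exp (- (2 * c) * y)))) =
      indicator {0<..} y * (y ^ m * exp (- c * y) / (1 + exp (- c * y)))" for y
  proof (cases "y > 0")
    case True
    define e where "e = exp (- c * y)"
    have e: "e > 0" "e < 1" using c True by (auto simp: e_def)
    have e2: "exp (- (2 * c) * y) = e * e" by (simp add: e_def exp_add[symmetric])
    have "e * e < 1" using mult_strict_mono[of e 1 e 1] e by simp
    hence nz: "1 - e * e \<noteq> 0" "1 - e \<noteq> 0" "1 + e \<noteq> 0" using e by auto
    have "1 - e * e = (1 - e) * (1 + e)" by (simp add: algebra_simps)
    hence "y ^ m * e / (1 - e) - 2 * (y ^ m * (e * e) / (1 - e * e)) = y ^ m * e / (1 + e)"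
      using nz by (simp add: divide_simps) (simp add: algebra_simps)
    then show ?thesis using True unfolding e2 e_def[symmetric] by simp
  qed simp
  moreover have "fact m / c ^ (m + 1) * riemann_zeta (real m + 1) - 2 * (fact m / (2 * c) ^ (m + 1) * riemann_zeta (real m + 1)) =
      fact m / c ^ (m + 1) * ((1 - 1 / 2 ^ m) * riemann_zeta (real m + 1))"
    using c by (simp add: power_mult_distrib field_simps)
  ultimately show ?thesis by (simp only:)
qed

lemma integral_Fermi_0:
  fixes c :: real
  assumes c: "c > 0"
  shows "has_bochner_integral lborel (\<lambda>y. indicator {0<..} y * (exp (- c * y) / (1 + exp (- c * y)))) (ln 2 / c)"
proof (rule has_bochner_integral_nn_integral)
  have p: "1 + exp (- c * y) > 0" for y by (simp add: add_pos_pos)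
  have "(\<integral>\<^sup>+ y. ennreal (indicator {0<..} y * (exp (- c * y) / (1 + exp (- c * y)))) \<partial>lborel) =
        (\<integral>\<^sup>+ y. ennreal (exp (- c * y) / (1 + exp (- c * y))) * indicator {0..} y \<partial>lborel)"
    by (rule nn_integral_cong_AE, rule AE_mp[OF AE_lborel_singleton[of 0]]) (auto simp: indicator_def)
  also have "\<dots> = ennreal (0 - (- ln (1 + exp (- c * 0)) / c))"
  proof (rule nn_integral_FTC_atLeast)
    fix y :: real
    show "DERIV (\<lambda>y. - ln (1 + exp (- c * y)) / c) y :> exp (- c * y) / (1 + exp (- c * y))"
    proof -
      have "DERIV (\<lambda>y. 1 + exp (- c * y)) y :> - c * exp (- c * y)" by (auto intro!: derivative_eq_intros)
      from DERIV_cdivide[OF DERIV_minus[OF DERIV_chain2[OF DERIV_ln[OF p] this]], of c]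
      show ?thesis by (rule DERIV_cong) (use c in \<open>simp add: divide_inverse\<close>)
    qed
    show "0 \<le> exp (- c * y) / (1 + exp (- c * y))" using p[of y] by simp
  next
    show "((\<lambda>y. - ln (1 + exp (- c * y)) / c) \<longlongrightarrow> 0) at_top" using c by real_asymp
  qed measurable
  finally show "(\<integral>\<^sup>+ y. ennreal (indicator {0<..} y * (exp (- c * y) / (1 + exp (- c * y)))) \<partial>lborel) = ennreal (ln 2 / c)"
    by simp
qed (use c in \<open>auto simp: indicator_def add_nonneg_nonneg\<close>)

text \<open>
The arctangent series may be integrated term by term: the integrals of the absolute values of its
terms are of the order of \<open>j\<close> to the power \<open>-(m + 2)\<close>.
\<close>

lemma integral_arctan_exp:
  "has_bochner_integral lborel (\<lambda>y. indicator {0<..} y * (y ^ m * arctan (exp (- pi * y))))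
     (fact m / pi ^ (m + 1) * L_chi (real m + 2))"
proof -
  define a where "a = (\<lambda>j::nat. (- 1) ^ j * (1 / real (2 * j + 1)))"
  define f where "f = (\<lambda>j y. indicator {0<..} y * (a j * (y ^ m * exp (- (pi * real (2 * j + 1)) * y))))"
  have pj: "pi * real (2 * j + 1) > 0" for j by simp
  have hb: "has_bochner_integral lborel (f j) (a j * (fact m / (pi * real (2 * j + 1)) ^ (m + 1)))" for j
    using has_bochner_integral_mult_right[OF has_bochner_integral_power_exp[OF pj[of j], of m], of "a j"]
    by (simp add: f_def mult_ac)
  have hbn: "has_bochner_integral lborel (\<lambda>y. norm (f j y)) (1 / real (2 * j + 1) * (fact m / (pi * real (2 * j + 1)) ^ (m + 1)))" for j
  proof -
    have "norm (f j y) = 1 / real (2 * j + 1) * (indicator {0<..} y * (y ^ m * exp (- (pi * real (2 * j + 1)) * y)))" for y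
      by (auto simp: f_def a_def indicator_def abs_mult power_abs)
    then show ?thesis
      using has_bochner_integral_mult_right[OF has_bochner_integral_power_exp[OF pj[of j], of m], of "1 / real (2 * j + 1)"]
      by simp
  qed
  have int: "integrable lborel (f j)" for j using hb by (simp add: has_bochner_integral_iff)
  have sums: "(\<lambda>j. f j y) sums (indicator {0<..} y * (y ^ m * arctan (exp (- pi * y))))"
    and abs: "summable (\<lambda>j. norm (f j y))" for y
  proof -
    define t where "t = exp (- pi * y)"
    have tj: "exp (- (pi * real (2 * j + 1)) * y) = t ^ (2 * j + 1)" for j
      by (simp only: t_def exp_of_nat_mult[symmetric]) (simp add: mult_ac)
    have "(\<lambda>j. f j y) sums (indicator {0<..} y * (y ^ m * arctan (exp (- pi * y)))) \<and> summable (\<lambda>j. norm (f j y))"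
    proof (cases "y > 0")
      case True
      have t: "0 < t" "t < 1" using True by (auto simp: t_def)
      have "\<bar>t\<bar> \<le> 1" using t by simp
      from arctan_series[OF this] summable_sums[OF summable_arctan_series[OF this]]
      have "(\<lambda>j. (- 1) ^ j * (1 / real (j * 2 + 1) * t ^ (j * 2 + 1))) sums arctan t" by simp
      from sums_mult[OF this, of "y ^ m"]
      have "(\<lambda>j. f j y) sums (y ^ m * arctan t)"
        using True unfolding f_def tj by (simp add: a_def mult_ac)
      moreover have "summable (\<lambda>j. norm (f j y))"
      proof (rule summable_comparison_test')
        have "summable (\<lambda>j. t ^ j)" using t by (intro summable_geometric) simp
        then show "summable (\<lambda>j. y ^ m * t ^ j)" by (rule summable_mult)
        fix j :: nat assume "j \<ge> 0"
        have "1 / real (2 * j + 1) * (y ^ m * t ^ (2 * j + 1)) \<le> 1 * (y ^ m * t ^ j)"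
          using t True by (intro mult_mono mult_left_mono power_decreasing) auto
        moreover have "norm (f j y) = 1 / real (2 * j + 1) * (y ^ m * t ^ (2 * j + 1))"
          using True t unfolding f_def tj by (simp add: a_def abs_mult power_abs)
        ultimately show "norm (norm (f j y)) \<le> y ^ m * t ^ j" by simp
      qed
      ultimately show ?thesis using True by (simp add: t_def)
    qed (simp add: f_def)
    then show "(\<lambda>j. f j y) sums (indicator {0<..} y * (y ^ m * arctan (exp (- pi * y))))"
      and "summable (\<lambda>j. norm (f j y))" by auto
  qed
  have eq1: "1 / real (2 * j + 1) * (fact m / (pi * real (2 * j + 1)) ^ (m + 1)) =
      fact m / pi ^ (m + 1) * real (2 * j + 1) powr (- (real m + 2))" for j
  proof -
    have "real (2 * j + 1) powr (- (real m + 2)) = inverse (real (2 * j + 1) powr (real m + 2))" by (rule powr_minus)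
    also have m2: "real m + 2 = real (m + 2)" by simp
    also have "real (2 * j + 1) powr real (m + 2) = real (2 * j + 1) ^ (m + 2)" by (rule powr_realpow) simp
    finally have e: "real (2 * j + 1) powr (- (real m + 2)) = 1 / real (2 * j + 1) ^ (m + 2)"
      by (simp only: inverse_eq_divide m2)
    define q where "q = real (2 * j + 1)"
    have "q > 0" by (simp add: q_def)
    moreover have "q powr (- (real m + 2)) = 1 / q ^ (m + 2)" unfolding q_def by (rule e)
    ultimately show ?thesis unfolding q_def[symmetric] by (simp only:) (simp add: power_mult_distrib field_simps)
  qed
  have summ: "summable (\<lambda>j. LINT y|lborel. norm (f j y))"
  proof -
    have "summable (\<lambda>j. real j powr (- 2))" by (simp add: summable_real_powr_iff)
    hence "summable (\<lambda>j. real (Suc j) powr (- 2))" by (subst summable_Suc_iff)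
    hence "summable (\<lambda>j. real (2 * j + 1) powr (- (real m + 2)))"
    proof (rule summable_comparison_test'[where N = 0])
      fix j :: nat
      have "real (2 * j + 1) powr (- (real m + 2)) \<le> real (2 * j + 1) powr (- 2)" by (intro powr_mono) auto
      also have "\<dots> \<le> real (Suc j) powr (- 2)" by (intro powr_mono2') auto
      finally show "norm (real (2 * j + 1) powr (- (real m + 2))) \<le> real (Suc j) powr (- 2)" by simp
    qed
    hence "summable (\<lambda>j. fact m / pi ^ (m + 1) * real (2 * j + 1) powr (- (real m + 2)))" by (rule summable_mult)
    moreover have "(LINT y|lborel. norm (f j y)) = fact m / pi ^ (m + 1) * real (2 * j + 1) powr (- (real m + 2))" for j
      using hbn[of j] unfolding eq1 by (rule has_bochner_integral_integral_eq)
    ultimately show ?thesis by simp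
  qed
  have F: "(\<lambda>y. \<Sum>j. f j y) = (\<lambda>y. indicator {0<..} y * (y ^ m * arctan (exp (- pi * y))))"
    using sums by (auto simp: sums_iff)
  have "AE y in lborel. summable (\<lambda>j. norm (f j y))" using abs by simp
  note S = integrable_suminf[OF int this summ] sums_integral[OF int this summ]
  have "(\<lambda>j. fact m / pi ^ (m + 1) * ((- 1) ^ j * real (2 * j + 1) powr (- (real m + 2)))) sums (LINT y|lborel. (\<Sum>j. f j y))"
  proof -
    have "(LINT y|lborel. f j y) = fact m / pi ^ (m + 1) * ((- 1) ^ j * real (2 * j + 1) powr (- (real m + 2)))" for j
    proof -
      have "(LINT y|lborel. f j y) = a j * (fact m / (pi * real (2 * j + 1)) ^ (m + 1))"
        using hb[of j] by (rule has_bochner_integral_integral_eq)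
      also have "\<dots> = (- 1) ^ j * (1 / real (2 * j + 1) * (fact m / (pi * real (2 * j + 1)) ^ (m + 1)))"
        by (simp only: a_def mult.assoc)
      finally show ?thesis unfolding eq1 by (simp only: mult.left_commute)
    qed
    then show ?thesis using S(2) by simp
  qed
  moreover have "summable (\<lambda>j. (- 1) ^ j * real (2 * j + 1) powr (- (real m + 2)))"
  proof (rule summable_norm_cancel)
    have "summable (\<lambda>j. fact m / pi ^ (m + 1) * real (2 * j + 1) powr (- (real m + 2)))"
      using summ has_bochner_integral_integral_eq[OF hbn] unfolding eq1 by simp
    hence "summable (\<lambda>j. real (2 * j + 1) powr (- (real m + 2)))"
      by (subst (asm) summable_cmult_iff) auto
    then show "summable (\<lambda>j. norm ((- 1) ^ j * real (2 * j + 1) powr (- (real m + 2))))"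
      by (simp add: abs_mult power_abs)
  qed
  hence "(\<lambda>j. fact m / pi ^ (m + 1) * ((- 1) ^ j * real (2 * j + 1) powr (- (real m + 2)))) sums (fact m / pi ^ (m + 1) * L_chi (real m + 2))"
    unfolding L_chi_def by (intro sums_mult summable_sums)
  ultimately have "(LINT y|lborel. (\<Sum>j. f j y)) = fact m / pi ^ (m + 1) * L_chi (real m + 2)"
    by (rule sums_unique2)
  then show ?thesis using S(1) unfolding F by (simp add: has_bochner_integral_iff)
qed

context interpolation_kernel
begin

lemma nn_integral_times_J:
  fixes g K :: "real \<Rightarrow> real"
  assumes [measurable]: "g \<in> borel_measurable borel" and g0: "\<And>x. g x \<ge> 0"
    and K: "\<And>y. y > 0 \<Longrightarrow> has_bochner_integral lborel (\<lambda>x. g x / (x\<^sup>2 + y\<^sup>2)) (K y)"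
  shows "(\<integral>\<^sup>+ x. ennreal (g x * J x) \<partial>lborel) = (\<integral>\<^sup>+ y. ennreal (indicator {0<..} y * (w y * K y)) \<partial>lborel)"
proof -
  define f where "f = (\<lambda>x y. ennreal (indicator {0<..} y * (g x * (w y / (x\<^sup>2 + y\<^sup>2)))))"
  have "(\<integral>\<^sup>+ x. ennreal (g x * J x) \<partial>lborel) = (\<integral>\<^sup>+ x. (\<integral>\<^sup>+ y. f x y \<partial>lborel) \<partial>lborel)"
  proof (rule nn_integral_cong_AE, rule AE_mp[OF AE_lborel_singleton[of 0]], rule AE_I2, rule impI)
    fix x :: real assume x: "x \<noteq> 0"
    have hb: "has_bochner_integral lborel (\<lambda>y. g x * (indicator {0<..} y * (w y / (x\<^sup>2 + y\<^sup>2)))) (g x * J x)"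
      unfolding J_def using kernel_real_integrable[OF x]
      by (intro has_bochner_integral_mult_right has_bochner_integral_integrable)
    have "(\<integral>\<^sup>+ y. ennreal (g x * (indicator {0<..} y * (w y / (x\<^sup>2 + y\<^sup>2)))) \<partial>lborel) = ennreal (g x * J x)"
      using hb g0[of x] w_nonneg unfolding has_bochner_integral_iff
      by (subst nn_integral_eq_integral) (auto simp: indicator_def)
    then show "ennreal (g x * J x) = (\<integral>\<^sup>+ y. f x y \<partial>lborel)" by (simp add: f_def mult_ac)
  qed
  also have "\<dots> = (\<integral>\<^sup>+ y. (\<integral>\<^sup>+ x. f x y \<partial>lborel) \<partial>lborel)"
    by (rule lborel_pair.Fubini'[symmetric]) (unfold f_def, measurable)
  also have "\<dots> = (\<integral>\<^sup>+ y. ennreal (indicator {0<..} y * (w y * K y)) \<partial>lborel)"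
  proof (rule nn_integral_cong)
    fix y :: real
    show "(\<integral>\<^sup>+ x. f x y \<partial>lborel) = ennreal (indicator {0<..} y * (w y * K y))"
    proof (cases "y > 0")
      case True
      have hb: "has_bochner_integral lborel (\<lambda>x. w y * (g x / (x\<^sup>2 + y\<^sup>2))) (w y * K y)"
        by (intro has_bochner_integral_mult_right K True)
      have "(\<integral>\<^sup>+ x. ennreal (w y * (g x / (x\<^sup>2 + y\<^sup>2))) \<partial>lborel) = ennreal (w y * K y)"
        using hb g0 w_nonneg[of y] True unfolding has_bochner_integral_iff
        by (subst nn_integral_eq_integral) auto
      then show ?thesis using True by (simp add: f_def mult_ac)
    qed (simp add: f_def)
  qed
  finally show ?thesis .
qed

end

text \<open>
With \<open>e = exp (-2\<pi>y)\<close> one has \<open>cosh (2\<pi>y) + 1 = (1 + e)\<^sup>2 / (2 e)\<close>, so one factor \<open>1 + e\<close> cancels against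
the integral over \<open>x\<close> and a Fermi integral remains.
\<close>

lemma nn_integral_minorant_gap:
  assumes "interpolation_kernel n (2 * pi) 1"
  shows "(\<integral>\<^sup>+ x. ennreal ((cos (2 * pi * x) + 1) * interpolation_kernel.J n (2 * pi) 1 x) \<partial>lborel) =
    ennreal (zeta_factor n * fact (2 * n) * (2 * pi) powi (- 2 * int n))"
    and "0 \<le> zeta_factor n * fact (2 * n) * (2 * pi) powi (- 2 * int n)"
proof -
  interpret interpolation_kernel n "2 * pi" 1 by (rule assms)
  define V where "V = zeta_factor n * fact (2 * n) * (2 * pi) powi (- 2 * int n)"
  have p: "2 * pi > 0" by simp
  have hb: "has_bochner_integral lborel (\<lambda>y. 4 * pi * (indicator {0<..} y * (y ^ (2 * n) * exp (- (2 * pi) * y) / (1 + exp (- (2 * pi) * y))))) V"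
  proof (cases "n = 0")
    case True
    have "4 * pi * (ln 2 / (2 * pi)) = V" using True by (simp add: V_def zeta_factor_def)
    then show ?thesis
      using has_bochner_integral_mult_right[OF integral_Fermi_0[OF p], of "4 * pi"] True by simp
  next
    case False
    have "4 * pi * (fact (2 * n) / (2 * pi) ^ (2 * n + 1) * ((1 - 1 / 2 ^ (2 * n)) * riemann_zeta (real (2 * n) + 1))) = V"
    proof -
      have "(2::real) powi (1 - 2 * int n) = 2 / 2 ^ (2 * n)"
        by (simp add: power_int_diff nat_mult_distrib power_int_def[of _ "2 * int n"])
      moreover have "(2 * pi) powi (- 2 * int n) = 1 / (2 * pi) ^ (2 * n)"
        by (simp add: power_int_minus power_int_def[of _ "2 * int n"] nat_mult_distrib inverse_eq_divide)
      ultimately show ?thesis using False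
        by (simp add: V_def zeta_factor_def power_mult_distrib field_simps)
    qed
    moreover have "2 * n \<ge> 1" using False by simp
    note has_bochner_integral_mult_right[OF integral_Fermi[OF p this], of "4 * pi"]
    ultimately show ?thesis by (simp only:)
  qed
  have nonneg: "0 \<le> 4 * pi * (indicator {0<..} y * (y ^ (2 * n) * exp (- (2 * pi) * y) / (1 + exp (- (2 * pi) * y))))" for y :: real
    by (auto simp: indicator_def add_nonneg_nonneg)
  have "0 \<le> V"
    unfolding has_bochner_integral_integral_eq[OF hb, symmetric] by (rule integral_nonneg_AE[OF AE_I2]) (rule nonneg)
  then show "0 \<le> zeta_factor n * fact (2 * n) * (2 * pi) powi (- 2 * int n)" by (simp only: V_def)
  have "(\<integral>\<^sup>+ x. ennreal ((cos (2 * pi * x) + 1) * J x) \<partial>lborel) =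
     (\<integral>\<^sup>+ y. ennreal (indicator {0<..} y * (w y * (pi / y * (exp (- (2 * pi) * y) + 1)))) \<partial>lborel)"
  proof (rule nn_integral_times_J)
    show "cos (2 * pi * x) + 1 \<ge> 0" for x using cos_ge_minus_one[of "2 * pi * x"] by linarith
  qed (use integral_cos_Cauchy_kernel[OF p] in auto)
  also have "(\<lambda>y. indicator {0<..} y * (w y * (pi / y * (exp (- (2 * pi) * y) + 1)))) =
     (\<lambda>y. 4 * pi * (indicator {0<..} y * (y ^ (2 * n) * exp (- (2 * pi) * y) / (1 + exp (- (2 * pi) * y)))))"
  proof
    fix y :: real
    show "indicator {0<..} y * (w y * (pi / y * (exp (- (2 * pi) * y) + 1))) =
       4 * pi * (indicator {0<..} y * (y ^ (2 * n) * exp (- (2 * pi) * y) / (1 + exp (- (2 * pi) * y))))"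
    proof (cases "y > 0")
      case True
      define e where "e = exp (- (2 * pi) * y)"
      have e: "e > 0" by (simp add: e_def)
      have "cosh (2 * pi * y) + 1 = (1 + e)\<^sup>2 / (2 * e)"
        by (simp add: e_def cosh_field_def exp_minus power2_eq_square field_simps)
      hence ph: "\<phi> y = (1 + e)\<^sup>2 / (2 * e)" by (simp only: \<phi>_def)
      show ?thesis unfolding w_def ph e_def[symmetric] using True e
        by (simp add: power2_eq_square divide_simps)
    qed simp
  qed
  also have "(\<integral>\<^sup>+ y. ennreal (4 * pi * (indicator {0<..} y * (y ^ (2 * n) * exp (- (2 * pi) * y) / (1 + exp (- (2 * pi) * y))))) \<partial>lborel) = ennreal V"
    using nn_integral_eq_integral[of lborel "\<lambda>y. 4 * pi * (indicator {0<..} y * (y ^ (2 * n) * exp (- (2 * pi) * y) / (1 + exp (- (2 * pi) * y))))"] hb nonneg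
    by (simp add: has_bochner_integral_iff)
  finally show "(\<integral>\<^sup>+ x. ennreal ((cos (2 * pi * x) + 1) * interpolation_kernel.J n (2 * pi) 1 x) \<partial>lborel) =
    ennreal (zeta_factor n * fact (2 * n) * (2 * pi) powi (- 2 * int n))"
    by (simp only: V_def)
qed

text \<open>
As for the minorant, with \<open>cosh (2\<pi>y) - 1 = (1 - e)\<^sup>2 / (2 e)\<close>, which leads to a Bose integral.
\<close>

lemma nn_integral_majorant_gap:
  assumes "interpolation_kernel n (2 * pi) (- 1)" and n: "n > 0"
  shows "(\<integral>\<^sup>+ x. ennreal ((1 - cos (2 * pi * x)) * interpolation_kernel.J n (2 * pi) (- 1) x) \<partial>lborel) =
    ennreal (2 * fact (2 * n) * (2 * pi) powi (- 2 * int n) * riemann_zeta (2 * real n + 1))"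
    and "0 \<le> 2 * fact (2 * n) * (2 * pi) powi (- 2 * int n) * riemann_zeta (2 * real n + 1)"
proof -
  interpret interpolation_kernel n "2 * pi" "- 1" by (rule assms(1))
  define V where "V = 2 * fact (2 * n) * (2 * pi) powi (- 2 * int n) * riemann_zeta (2 * real n + 1)"
  have p: "2 * pi > 0" by simp
  have hb: "has_bochner_integral lborel (\<lambda>y. 4 * pi * (indicator {0<..} y * (y ^ (2 * n) * exp (- (2 * pi) * y) / (1 - exp (- (2 * pi) * y))))) V"
  proof -
    have "4 * pi * (fact (2 * n) / (2 * pi) ^ (2 * n + 1) * riemann_zeta (real (2 * n) + 1)) = V"
    proof -
      have "(2 * pi) powi (- 2 * int n) = 1 / (2 * pi) ^ (2 * n)"
        by (simp add: power_int_minus power_int_def[of _ "2 * int n"] nat_mult_distrib inverse_eq_divide)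
      then show ?thesis by (simp add: V_def power_mult_distrib field_simps)
    qed
    moreover have "2 * n \<ge> 1" using n by simp
    note has_bochner_integral_mult_right[OF integral_Bose[OF p this], of "4 * pi"]
    ultimately show ?thesis
      by (simp only:)
  qed
  have nonneg: "0 \<le> 4 * pi * (indicator {0<..} y * (y ^ (2 * n) * exp (- (2 * pi) * y) / (1 - exp (- (2 * pi) * y))))" for y :: real
    by (auto simp: indicator_def add_nonneg_nonneg)
  have "0 \<le> V"
    unfolding has_bochner_integral_integral_eq[OF hb, symmetric] by (rule integral_nonneg_AE[OF AE_I2]) (rule nonneg)
  then show "0 \<le> 2 * fact (2 * n) * (2 * pi) powi (- 2 * int n) * riemann_zeta (2 * real n + 1)" by (simp only: V_def)
  have "(\<integral>\<^sup>+ x. ennreal ((1 - cos (2 * pi * x)) * J x) \<partial>lborel) =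
     (\<integral>\<^sup>+ y. ennreal (indicator {0<..} y * (w y * (pi / y * (1 - exp (- (2 * pi) * y))))) \<partial>lborel)"
  proof (rule nn_integral_times_J)
    fix y :: real assume y: "y > 0"
    from has_bochner_integral_minus[OF integral_cos_Cauchy_kernel[OF p y, of "- 1"]]
    show "has_bochner_integral lborel (\<lambda>x. (1 - cos (2 * pi * x)) / (x\<^sup>2 + y\<^sup>2)) (pi / y * (1 - exp (- (2 * pi) * y)))"
      by (simp add: minus_divide_left algebra_simps)
  qed auto
  also have "(\<lambda>y. indicator {0<..} y * (w y * (pi / y * (1 - exp (- (2 * pi) * y))))) =
     (\<lambda>y. 4 * pi * (indicator {0<..} y * (y ^ (2 * n) * exp (- (2 * pi) * y) / (1 - exp (- (2 * pi) * y)))))"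
  proof
    fix y :: real
    show "indicator {0<..} y * (w y * (pi / y * (1 - exp (- (2 * pi) * y)))) =
       4 * pi * (indicator {0<..} y * (y ^ (2 * n) * exp (- (2 * pi) * y) / (1 - exp (- (2 * pi) * y))))"
    proof (cases "y > 0")
      case True
      define e where "e = exp (- (2 * pi) * y)"
      have e: "e > 0" "e < 1" using True by (auto simp: e_def)
      have "cosh (2 * pi * y) + - 1 = (1 - e)\<^sup>2 / (2 * e)"
        by (simp add: e_def cosh_field_def exp_minus power2_eq_square field_simps)
      hence ph: "\<phi> y = (1 - e)\<^sup>2 / (2 * e)" by (simp only: \<phi>_def)
      show ?thesis unfolding w_def ph e_def[symmetric] using True e
        by (simp add: power2_eq_square divide_simps)
    qed simp
  qed
  also have "(\<integral>\<^sup>+ y. ennreal (4 * pi * (indicator {0<..} y * (y ^ (2 * n) * exp (- (2 * pi) * y) / (1 - exp (- (2 * pi) * y))))) \<partial>lborel) = ennreal V"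
    using nn_integral_eq_integral[of lborel "\<lambda>y. 4 * pi * (indicator {0<..} y * (y ^ (2 * n) * exp (- (2 * pi) * y) / (1 - exp (- (2 * pi) * y))))"] hb nonneg
    by (simp add: has_bochner_integral_iff)
  finally show "(\<integral>\<^sup>+ x. ennreal ((1 - cos (2 * pi * x)) * interpolation_kernel.J n (2 * pi) (- 1) x) \<partial>lborel) =
    ennreal (2 * fact (2 * n) * (2 * pi) powi (- 2 * int n) * riemann_zeta (2 * real n + 1))"
    by (simp only: V_def)
qed

text \<open>
The factor \<open>cosh (\<pi> y)\<close> produced by the integral over \<open>x\<close> cancels the denominator of the weight.
\<close>

lemma nn_integral_best_approximation_gap:
  assumes "interpolation_kernel n pi 0"
  shows "(\<integral>\<^sup>+ x. ennreal (\<bar>cos (pi * x)\<bar> * interpolation_kernel.J n pi 0 x) \<partial>lborel) =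
    ennreal (2 / pi * fact (2 * n) * (2 * pi) powi (- 2 * int n) * (2 ^ (2 + 2 * n) * L_chi (2 + 2 * real n)))"
    and "0 \<le> 2 / pi * fact (2 * n) * (2 * pi) powi (- 2 * int n) * (2 ^ (2 + 2 * n) * L_chi (2 + 2 * real n))"
proof -
  interpret interpolation_kernel n pi 0 by (rule assms)
  define V where "V = 2 / pi * fact (2 * n) * (2 * pi) powi (- 2 * int n) * (2 ^ (2 + 2 * n) * L_chi (2 + 2 * real n))"
  have hb: "has_bochner_integral lborel (\<lambda>y. 8 * (indicator {0<..} y * (y ^ (2 * n) * arctan (exp (- pi * y))))) V"
  proof -
    have "8 * (fact (2 * n) / pi ^ (2 * n + 1) * L_chi (real (2 * n) + 2)) = V"
    proof -
      have "(2 * pi) powi (- 2 * int n) = 1 / (2 * pi) ^ (2 * n)"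
        by (simp add: power_int_minus power_int_def[of _ "2 * int n"] nat_mult_distrib inverse_eq_divide)
      moreover have "real (2 * n) + 2 = 2 + 2 * real n" by simp
      ultimately show ?thesis by (simp add: V_def power_mult_distrib power_add field_simps)
    qed
    then show ?thesis
      using has_bochner_integral_mult_right[OF integral_arctan_exp[of "2 * n"], of 8] by simp
  qed
  have nonneg: "0 \<le> 8 * (indicator {0<..} y * (y ^ (2 * n) * arctan (exp (- pi * y))))" for y :: real
    by (auto simp: indicator_def add_nonneg_nonneg)
  have "0 \<le> V"
    unfolding has_bochner_integral_integral_eq[OF hb, symmetric] by (rule integral_nonneg_AE[OF AE_I2]) (rule nonneg)
  then show "0 \<le> 2 / pi * fact (2 * n) * (2 * pi) powi (- 2 * int n) * (2 ^ (2 + 2 * n) * L_chi (2 + 2 * real n))" by (simp only: V_def)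
  have "(\<integral>\<^sup>+ x. ennreal (\<bar>cos (pi * x)\<bar> * J x) \<partial>lborel) =
     (\<integral>\<^sup>+ y. ennreal (indicator {0<..} y * (w y * (4 / y * (cosh (pi * y) * arctan (exp (- pi * y)))))) \<partial>lborel)"
    by (rule nn_integral_times_J) (use integral_abs_cos_Cauchy_kernel in auto)
  also have "(\<lambda>y. indicator {0<..} y * (w y * (4 / y * (cosh (pi * y) * arctan (exp (- pi * y)))))) =
     (\<lambda>y. 8 * (indicator {0<..} y * (y ^ (2 * n) * arctan (exp (- pi * y)))))"
  proof
    fix y :: real
    have "cosh (pi * y) > 0" by (rule cosh_real_pos)
    then show "indicator {0<..} y * (w y * (4 / y * (cosh (pi * y) * arctan (exp (- pi * y))))) =
       8 * (indicator {0<..} y * (y ^ (2 * n) * arctan (exp (- pi * y))))"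
      by (auto simp: w_def \<phi>_def indicator_def)
  qed
  also have "(\<integral>\<^sup>+ y. ennreal (8 * (indicator {0<..} y * (y ^ (2 * n) * arctan (exp (- pi * y))))) \<partial>lborel) = ennreal V"
    using nn_integral_eq_integral[of lborel "\<lambda>y. 8 * (indicator {0<..} y * (y ^ (2 * n) * arctan (exp (- pi * y))))"] hb nonneg
    by (simp add: has_bochner_integral_iff)
  finally show "(\<integral>\<^sup>+ x. ennreal (\<bar>cos (pi * x)\<bar> * interpolation_kernel.J n pi 0 x) \<partial>lborel) =
    ennreal (2 / pi * fact (2 * n) * (2 * pi) powi (- 2 * int n) * (2 ^ (2 + 2 * n) * L_chi (2 + 2 * real n)))"
    by (simp only: V_def)
qed

section \<open>One-sided optimality\<close>

lemma AE_nonneg_imp_nonneg_at_continuity_point: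
  fixes f :: "real \<Rightarrow> real"
  assumes ae: "AE x in lborel. 0 \<le> f x" and cont: "isCont f a"
  shows "0 \<le> f a"
proof (rule ccontr)
  assume "\<not> 0 \<le> f a"
  hence "\<forall>\<^sub>F x in nhds a. f x < 0"
    using cont by (intro order_tendstoD(2)[of f "f a"]) (auto simp: isCont_def tendsto_at_iff_tendsto_nhds)
  then obtain d where d: "d > 0" "\<And>x. dist x a < d \<Longrightarrow> f x < 0" by (auto simp: eventually_nhds_metric)
  have "AE x in lborel. x \<notin> {a - d<..<a + d}"
    using ae
  proof eventually_elim
    case (elim x)
    have "x \<notin> {a - d<..<a + d}"
    proof
      assume "x \<in> {a - d<..<a + d}"
      hence "dist x a < d" by (auto simp: dist_real_def)
      then show False using d(2)[of x] elim by simp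
    qed
    then show ?case .
  qed
  hence "{a - d<..<a + d} \<in> null_sets lborel" by (subst AE_iff_null_sets) auto
  hence "emeasure lborel {a - d<..<a + d} = 0" by auto
  then show False using d(1) by simp
qed

text \<open>
For \<open>n > 0\<close> the derivative at 0 exists and vanishes, since \<open>x log x\<^sup>2\<close> tends to 0. This makes 0 an
admissible point of interpolation for the majorant.
\<close>

lemma log_monomial_at_0:
  assumes n: "n > 0"
  shows "log_monomial n differentiable (at 0)"
proof -
  have "((\<lambda>x. (log_monomial n x - log_monomial n 0) / (x - 0)) \<longlongrightarrow> 0) (at 0)"
  proof (rule Lim_null_comparison)
    show "((\<lambda>x::real. \<bar>x * ln (x\<^sup>2)\<bar>) \<longlongrightarrow> 0) (at 0)"
      unfolding at_eq_sup_left_right by (intro filterlim_sup; real_asymp)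
    show "\<forall>\<^sub>F x in at 0. norm ((log_monomial n x - log_monomial n 0) / (x - 0)) \<le> \<bar>x * ln (x\<^sup>2)\<bar>"
      unfolding eventually_at
    proof (intro exI[of _ 1] conjI ballI impI)
      fix x :: real assume x: "x \<noteq> 0 \<and> dist x 0 < 1"
      have "\<bar>x\<bar> ^ (2 * n - 1) \<le> \<bar>x\<bar> ^ 1" using x n by (intro power_decreasing) auto
      have pw: "x ^ (2 * n) = x * x ^ (2 * n - 1)" using n by (metis Suc_diff_1 nat_0_less_mult_iff power_Suc zero_less_numeral)
      have "log_monomial n x / x = (- 1) ^ (n + 1) * x ^ (2 * n - 1) * ln (x\<^sup>2)"
        unfolding log_monomial_def pw using x by simp
      hence "\<bar>log_monomial n x / x\<bar> = \<bar>x\<bar> ^ (2 * n - 1) * \<bar>ln (x\<^sup>2)\<bar>"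
        by (simp add: abs_mult power_abs)
      also have "\<dots> \<le> \<bar>x\<bar> ^ 1 * \<bar>ln (x\<^sup>2)\<bar>" by (intro mult_right_mono) (fact, simp)
      finally show "norm ((log_monomial n x - log_monomial n 0) / (x - 0)) \<le> \<bar>x * ln (x\<^sup>2)\<bar>"
        by (simp add: abs_mult log_monomial_def[of n 0])
    qed simp
  qed
  hence "(log_monomial n has_real_derivative 0) (at 0)" by (simp add: has_field_derivative_iff)
  then show ?thesis using real_differentiable_def by blast
qed

lemma log_monomial_differentiable:
  assumes "x \<noteq> 0"
  shows "log_monomial n differentiable (at x)"
proof -
  have "\<exists>D. (log_monomial n has_real_derivative D) (at x)"
    unfolding log_monomial_def[abs_def] using assms
    by (auto intro!: derivative_eq_intros exI)
  then show ?thesis using real_differentiable_def by blast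
qed

lemma log_monomial_measurable [measurable]: "log_monomial n \<in> borel_measurable borel"
  unfolding log_monomial_def[abs_def] by measurable

lemma h_eq_log_monomial: "x \<noteq> 0 \<Longrightarrow> h n x = ereal (log_monomial n x)"
  by (simp add: h_def log_monomial_def)

lemma h_pos_eq_log_monomial: "n > 0 \<Longrightarrow> h n x = ereal (log_monomial n x)"
  by (simp add: h_def log_monomial_def)

lemma l1_dist_h: "l1_dist F (h n) = (\<integral>\<^sup>+ x. ennreal (norm (F (of_real x) - of_real (log_monomial n x))) \<partial>lborel)"
  unfolding l1_dist_def
  by (rule nn_integral_cong_AE, rule AE_mp[OF AE_lborel_singleton[of 0]]) (auto simp: h_eq_log_monomial)

lemma entire_measurable_on_reals:
  assumes "entire_exp_type \<tau> F"
  shows "(\<lambda>x::real. F (of_real x)) \<in> borel_measurable borel"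
  using continuous_on_line[OF entire_exp_type_cont[OF assms], of UNIV 0]
  by (intro borel_measurable_continuous_onI) simp

lemma finite_l1_dist_integrable:
  assumes F: "entire_exp_type \<tau> F" and fin: "l1_dist F (h n) < \<infinity>"
  shows "integrable lborel (\<lambda>x. F (of_real x) - of_real (log_monomial n x))"
proof (rule integrableI_bounded)
  note entire_measurable_on_reals[OF F, measurable]
  show "(\<lambda>x. F (of_real x) - of_real (log_monomial n x)) \<in> borel_measurable lborel" by measurable
qed (use fin in \<open>simp add: l1_dist_h\<close>)

lemma integrable_diff_of_approximants:
  assumes F: "entire_exp_type \<tau> F" "l1_dist F (h n) < \<infinity>"
    and G: "entire_exp_type \<tau> G" "l1_dist G (h n) < \<infinity>"
  shows "integrable lborel (\<lambda>x. F (of_real x) - G (of_real x))"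
  using Bochner_Integration.integrable_diff[OF finite_l1_dist_integrable[OF F] finite_l1_dist_integrable[OF G]] by simp

lemma deriv_eq_0_of_real_valued:
  assumes hol: "D holomorphic_on UNIV" and real: "\<And>x::real. D (of_real x) \<in> \<real>"
    and der: "((\<lambda>x. Re (D (of_real x))) has_real_derivative 0) (at a)"
  shows "deriv D (of_real a) = 0"
proof -
  have "(D has_field_derivative deriv D (of_real a)) (at (of_real a))"
    using hol by (simp add: holomorphic_derivI)
  from has_vector_derivative_real_field[OF this]
  have vd: "((\<lambda>x. D (of_real x)) has_vector_derivative deriv D (of_real a)) (at a)" .
  have "((\<lambda>x. of_real (Re (D (of_real x))) :: complex) has_vector_derivative of_real 0) (at a)"
    using der by (intro has_vector_derivative_of_real) (simp add: has_real_derivative_iff_has_vector_derivative)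
  also have "(\<lambda>x. of_real (Re (D (of_real x)))) = (\<lambda>x. D (of_real x))" using real by (simp add: of_real_Re)
  finally show ?thesis using vector_derivative_unique_at[OF vd] by simp
qed

lemma entire_on_reals_differentiable:
  assumes hol: "F holomorphic_on UNIV"
  shows "(\<lambda>x. Re (F (of_real x))) differentiable (at (a::real))"
proof -
  have "(F has_field_derivative deriv F (of_real a)) (at (of_real a))"
    using hol by (simp add: holomorphic_derivI)
  from has_vector_derivative_real_field[OF this]
  have vd: "((\<lambda>x. F (of_real x)) has_vector_derivative deriv F (of_real a)) (at a)" .
  have "((\<lambda>x. Re (F (of_real x))) has_vector_derivative Re (deriv F (of_real a))) (at a)"
    using bounded_linear.has_vector_derivative[OF bounded_linear_Re vd] .
  then show ?thesis by (auto simp: has_real_derivative_iff_has_vector_derivative[symmetric] real_differentiable_def)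
qed

lemma double_zeros_at_shifted_integers_imp_zero:
  assumes F: "entire_exp_type (2 * pi) F" and int: "integrable lborel (\<lambda>x. F (of_real x))"
    and zero: "\<And>k::int. F (of_real (a + of_int k)) = 0" "\<And>k::int. deriv F (of_real (a + of_int k)) = 0"
  shows "F z = 0"
proof -
  define G where "G = (\<lambda>z. F (of_real 1 * z + of_real a))"
  have "G (z - of_real a) = 0"
  proof (rule double_zeros_at_integers_imp_zero[where F = G])
    show "entire_exp_type (2 * pi) G"
      using entire_exp_type_affine[OF F, of 1 "of_real a"] by (simp add: G_def)
    show "integrable lborel (\<lambda>x. G (of_real x))"
      using lborel_integrable_real_affine[OF int, of 1 a] by (simp add: G_def add.commute)
    fix k :: int
    show "G (of_int k) = 0" using zero(1)[of k] by (simp add: G_def add.commute)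
    have "(F has_field_derivative deriv F (of_int k + of_real a)) (at (of_int k + of_real a))"
      using entire_exp_typeD(1)[OF F] by (simp add: holomorphic_derivI)
    hence "(G has_field_derivative deriv F (of_int k + of_real a)) (at (of_int k))"
      unfolding G_def using DERIV_shift[of F _ "of_int k" "of_real a"] by simp
    then show "deriv G (of_int k) = 0" using zero(2)[of k] by (simp add: DERIV_imp_deriv add.commute)
  qed
  then show ?thesis by (simp add: G_def)
qed

text \<open>
The sign \<open>s\<close> is 1 for minorants and -1 for majorants. By the quadrature formula the integral of
\<open>s (L - G)\<close> is the sum of its values at the points of interpolation, where \<open>L\<close> agrees with the target and
the values are therefore nonnegative. If the integral vanishes, then so do these values; the
error functions of \<open>L\<close> and of \<open>G\<close> then both have local minima there, so their derivatives agree and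
\<open>L - G\<close> has double zeros.
\<close>

lemma one_sided_optimality:
  fixes s a :: real and L G :: "complex \<Rightarrow> complex"
  defines "X \<equiv> {x. x \<noteq> 0 \<or> (\<exists>k::int. x = a + of_int k)}"
  assumes s: "s = 1 \<or> s = - 1"
    and L: "entire_exp_type (2 * pi) L" "l1_dist L (h n) < \<infinity>" "\<And>x::real. L (of_real x) \<in> \<real>"
    and L_side: "\<And>x. x \<in> X \<Longrightarrow> s * (log_monomial n x - Re (L (of_real x))) \<ge> 0"
    and L_eq: "\<And>k::int. Re (L (of_real (a + of_int k))) = log_monomial n (a + of_int k)"
    and diff: "\<And>k::int. log_monomial n differentiable (at (a + of_int k))"
    and G: "entire_exp_type (2 * pi) G" "\<And>x::real. G (of_real x) \<in> \<real>"
    and G_side: "\<And>x. x \<in> X \<Longrightarrow> s * (log_monomial n x - Re (G (of_real x))) \<ge> 0"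
  shows "l1_dist L (h n) \<le> l1_dist G (h n)"
    and "l1_dist G (h n) = l1_dist L (h n) \<Longrightarrow> G = L"
proof -
  have main: "l1_dist L (h n) \<le> l1_dist G (h n) \<and> (l1_dist G (h n) = l1_dist L (h n) \<longrightarrow> G = L)"
    if fin: "l1_dist G (h n) < \<infinity>"
  proof -
    define D where "D = (\<lambda>z. L z - G z)"
    define d where "d = (\<lambda>x. s * Re (D (of_real x)))"
    have D: "entire_exp_type (2 * pi) D" unfolding D_def by (rule entire_exp_type_diff[OF L(1) G(1)])
    have Dint: "integrable lborel (\<lambda>x. D (of_real x))"
      unfolding D_def by (rule integrable_diff_of_approximants[OF L(1,2) G(1) fin])
    have Dreal: "D (of_real x) \<in> \<real>" for x using L(3) G(2) by (simp add: D_def)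
    have ssq: "s * s = 1" using s by auto
    have d_node: "d (a + of_int k) = s * (log_monomial n (a + of_int k) - Re (G (of_real (a + of_int k))))" for k :: int
      using L_eq[of k] by (simp only: d_def D_def minus_complex.simps)
    have d_nonneg: "d (a + of_int k) \<ge> 0" for k :: int
      unfolding d_node by (rule G_side) (auto simp: X_def)
    have psum: "(\<Sum>\<^sub>\<infinity>k::int. D (of_real a + of_int k)) = (LINT x|lborel. D (of_real x))"
      by (rule Poisson_summation_type_2pi[OF D Dint])
    have sm: "(\<lambda>k::int. D (of_real a + of_int k)) summable_on UNIV"
      by (rule abs_summable_summable) (rule shifts_abs_summable[OF D _ Dint], simp)
    have dsum: "((\<lambda>k::int. d (a + of_int k)) has_sum (LINT x|lborel. d x)) UNIV"
    proof -
      have "((\<lambda>k::int. D (of_real a + of_int k)) has_sum (LINT x|lborel. D (of_real x))) UNIV"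
        using has_sum_infsum[OF sm] by (simp only: psum)
      from has_sum_cmult_right[OF has_sum_Re[OF this], of s]
      have "((\<lambda>k::int. s * Re (D (of_real a + of_int k))) has_sum s * Re (LINT x|lborel. D (of_real x))) UNIV" .
      also have "s * Re (LINT x|lborel. D (of_real x)) = (LINT x|lborel. d x)"
        unfolding d_def using Dint by (simp add: integral_Re)
      finally show ?thesis by (simp add: d_def)
    qed
    have d_int: "integrable lborel d" unfolding d_def by (intro integrable_mult_right integrable_Re Dint)
    have I_nonneg: "(LINT x|lborel. d x) \<ge> 0"
      using has_sum_nonneg[OF dsum] d_nonneg by simp
    define e where "e = (\<lambda>(F :: complex \<Rightarrow> complex) x. s * (log_monomial n x - Re (F (of_real x))))"
    have e_int: "integrable lborel (e F)" and e_dist: "l1_dist F (h n) = ennreal (LINT x|lborel. e F x)" "(LINT x|lborel. e F x) \<ge> 0"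
      if F: "entire_exp_type (2 * pi) F" "l1_dist F (h n) < \<infinity>" "\<And>x::real. F (of_real x) \<in> \<real>"
        and side: "\<forall>x\<in>X. e F x \<ge> 0" for F
    proof -
      have "integrable lborel (\<lambda>x. - s * Re (F (of_real x) - of_real (log_monomial n x)))"
        by (intro integrable_mult_right integrable_Re finite_l1_dist_integrable[OF F(1,2)])
      also have "(\<lambda>x. - s * Re (F (of_real x) - of_real (log_monomial n x))) = e F"
        by (simp add: e_def algebra_simps)
      finally show int: "integrable lborel (e F)" .
      have ae: "AE x in lborel. 0 \<le> e F x"
        by (rule AE_mp[OF AE_lborel_singleton[of 0]]) (use side in \<open>auto simp: X_def\<close>)
      have "l1_dist F (h n) = (\<integral>\<^sup>+ x. ennreal (e F x) \<partial>lborel)"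
        unfolding l1_dist_h
      proof (rule nn_integral_cong_AE, use ae in eventually_elim)
        fix x assume x: "0 \<le> e F x"
        have "F (of_real x) - of_real (log_monomial n x) = of_real (Re (F (of_real x)) - log_monomial n x)"
          using F(3)[of x] by (simp add: of_real_Re)
        hence "norm (F (of_real x) - of_real (log_monomial n x)) = \<bar>e F x\<bar>"
          using s by (auto simp: e_def norm_of_real simp del: of_real_diff)
        then show "ennreal (norm (F (of_real x) - of_real (log_monomial n x))) = ennreal (e F x)" using x by simp
      qed
      also have "\<dots> = ennreal (LINT x|lborel. e F x)" by (rule nn_integral_eq_integral[OF int ae])
      finally show "l1_dist F (h n) = ennreal (LINT x|lborel. e F x)" .
      show "(LINT x|lborel. e F x) \<ge> 0" by (rule integral_nonneg_AE[OF ae])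
    qed
    have LS: "\<forall>x\<in>X. e L x \<ge> 0" and GS: "\<forall>x\<in>X. e G x \<ge> 0"
      using L_side G_side by (auto simp: e_def)
    note eL = e_int[OF L LS] e_dist[OF L LS]
    note eG = e_int[OF G(1) fin G(2) GS] e_dist[OF G(1) fin G(2) GS]
    have "e G = (\<lambda>x. e L x + d x)" by (simp add: fun_eq_iff e_def d_def D_def algebra_simps)
    hence I_eq: "(LINT x|lborel. e G x) = (LINT x|lborel. e L x) + (LINT x|lborel. d x)"
      using eL(1) d_int by simp
    have le: "l1_dist L (h n) \<le> l1_dist G (h n)"
      unfolding eL(2) eG(2) using I_eq I_nonneg by (intro ennreal_leI) simp
    moreover have "G = L" if eq: "l1_dist G (h n) = l1_dist L (h n)"
    proof -
      have "(LINT x|lborel. e G x) = (LINT x|lborel. e L x)"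
        using eq unfolding eL(2) eG(2) using eL(3) eG(3) by simp
      hence I0: "(LINT x|lborel. d x) = 0" using I_eq by simp
      have d0: "d (a + of_int k) = 0" for k :: int
      proof (rule nonneg_infsum_le_0D[of "\<lambda>k::int. d (a + of_int k)" UNIV])
        show "infsum (\<lambda>k::int. d (a + of_int k)) UNIV \<le> 0" using infsumI[OF dsum] I0 by simp
        show "(\<lambda>k::int. d (a + of_int k)) summable_on UNIV" using dsum by (auto simp: summable_on_def)
      qed (use d_nonneg in auto)
      have z0: "D (of_real (a + of_int k)) = 0" for k :: int
      proof -
        have "Re (D (of_real (a + of_int k))) = 0" using d0[of k] s by (auto simp: d_def)
        then show ?thesis using Dreal[of "a + of_int k"] by (metis complex_is_Real_iff complex_eqI zero_complex.simps)
      qed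
      have z1: "deriv D (of_real (a + of_int k)) = 0" for k :: int
      proof (rule deriv_eq_0_of_real_valued[OF entire_exp_typeD(1)[OF D] Dreal])
        define p where "p = a + of_int k"
        have crit: "(e F has_real_derivative 0) (at p)"
          if F: "F holomorphic_on UNIV" and side: "\<forall>x\<in>X. e F x \<ge> 0" and Fp: "e F p = 0" for F
        proof -
          have "e F differentiable (at p)" unfolding e_def p_def
            by (intro derivative_intros diff entire_on_reals_differentiable F)
          then obtain \<delta> where \<delta>: "(e F has_real_derivative \<delta>) (at p)" by (auto simp: real_differentiable_def)
          \<comment> \<open>the origin may lie outside \<open>X\<close>; the neighbourhood avoids it unless it is the centre\<close>
          define r where "r = (if p = 0 then 1 else \<bar>p\<bar>)"
          have "r > 0" by (simp add: r_def)
          moreover have "e F p \<le> e F x" if "\<bar>p - x\<bar> < r" for x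
          proof (cases "x = 0 \<and> p \<noteq> 0")
            case True then show ?thesis using that by (simp add: r_def)
          next
            case False
            hence "x \<in> X" using p_def by (auto simp: X_def)
            then show ?thesis using side Fp by simp
          qed
          ultimately have "\<delta> = 0" using DERIV_local_min[OF \<delta>] by blast
          then show ?thesis using \<delta> by simp
        qed
        have eLp: "e L p = 0" using L_eq[of k] by (simp add: e_def p_def)
        have dp: "d p = 0" using d0[of k] by (simp add: p_def)
        have eGp: "e G p = 0" using \<open>e G = (\<lambda>x. e L x + d x)\<close> eLp dp by simp
        have "((\<lambda>x. s * (e G x - e L x)) has_real_derivative s * (0 - 0)) (at p)"
          by (intro DERIV_cmult DERIV_diff crit[OF entire_exp_typeD(1)[OF G(1)] GS eGp] crit[OF entire_exp_typeD(1)[OF L(1)] LS eLp])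
        also have "(\<lambda>x. s * (e G x - e L x)) = (\<lambda>x. Re (D (of_real x)))"
          using ssq by (simp add: fun_eq_iff e_def D_def right_diff_distrib mult.assoc[symmetric])
        finally show "((\<lambda>x. Re (D (of_real x))) has_real_derivative 0) (at (a + of_int k))" by (simp add: p_def)
      qed
      have "D z = 0" for z by (rule double_zeros_at_shifted_integers_imp_zero[OF D Dint z0 z1])
      then show "G = L" by (simp add: D_def fun_eq_iff)
    qed
    ultimately show ?thesis by blast
  qed
  show "l1_dist L (h n) \<le> l1_dist G (h n)"
    using main by (cases "l1_dist G (h n) = \<infinity>") (auto simp: less_top)
  show "l1_dist G (h n) = l1_dist L (h n) \<Longrightarrow> G = L"
    using main L(2) by auto
qed

section \<open>Optimality of best approximation\<close>

lemma half_integer_nonzero: "of_int k + 1 / 2 \<noteq> (0 :: real)"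
proof
  assume "of_int k + 1 / 2 = (0 :: real)"
  hence "of_int (2 * k + 1) = (0 :: real)" by simp
  hence "2 * k + 1 = 0" by (simp only: of_int_eq_0_iff)
  then show False by presburger
qed

lemma cos_pi_half_integer: "cos (pi * (of_int k + 1 / 2)) = 0"
proof -
  have "pi * (of_int k + 1 / 2) = of_int k * pi + pi / 2" by (simp add: algebra_simps)
  then show ?thesis by (simp add: cos_add sin_int_times_real mult.commute)
qed

lemma integral_sgn_cos_period:
  "(LINT t|lborel. indicator {0..<1::real} t *\<^sub>R (complex_of_real (sgn (cos (pi * (2 * t)))) * C)) = 0"
proof -
  define g where "g = (\<lambda>t::real. complex_of_real (sgn (cos (pi * (2 * t)))) * C)"
  have [measurable]: "g \<in> borel_measurable borel" unfolding g_def by measurable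
  have anti: "g (1 / 2 + t) = - g t" for t
  proof -
    have "cos (pi * (2 * (1 / 2 + t))) = cos (pi * (2 * t) + pi)" by (simp add: algebra_simps)
    also have "\<dots> = - cos (pi * (2 * t))" by simp
    finally show ?thesis by (simp add: g_def)
  qed
  have int: "integrable lborel (\<lambda>t. indicator {u..<v} t *\<^sub>R g t)" for u v :: real
  proof (rule Bochner_Integration.integrable_bound[of lborel "\<lambda>t. indicator {u..<v} t * norm C"])
    show "integrable lborel (\<lambda>t. indicator {u..<v} t * norm C)" by (cases "u \<le> v") (auto intro!: integrable_mult_left)
    have "norm (g t) \<le> norm C" for t
    proof -
      have "\<bar>sgn (cos (pi * (2 * t)))\<bar> \<le> 1" by (simp add: sgn_if)
      then show ?thesis unfolding g_def norm_mult norm_of_real by (intro mult_left_le_one_le) auto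
    qed
    then show "AE t in lborel. norm (indicator {u..<v} t *\<^sub>R g t) \<le> norm (indicator {u..<v} t * norm C)"
      by (auto simp: indicator_def)
  qed measurable
  have "(LINT t|lborel. indicator {0..<1} t *\<^sub>R g t) =
        (LINT t|lborel. indicator {0..<1/2} t *\<^sub>R g t + indicator {1/2..<1} t *\<^sub>R g t)"
    by (intro Bochner_Integration.integral_cong) (auto simp: indicator_def)
  also have "\<dots> = (LINT t|lborel. indicator {0..<1/2} t *\<^sub>R g t) + (LINT t|lborel. indicator {1/2..<1} t *\<^sub>R g t)"
    by (intro Bochner_Integration.integral_add int)
  also have "(LINT t|lborel. indicator {1/2..<1} t *\<^sub>R g t) =
      (LINT t|lborel. indicator {1/2..<1} (1 / 2 + 1 * t) *\<^sub>R g (1 / 2 + 1 * t))"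
    using lborel_integral_real_affine[of 1 "\<lambda>t. indicator {1/2..<1} t *\<^sub>R g t" "1 / 2"] by simp
  also have "\<dots> = (LINT t|lborel. - (indicator {0..<1/2} t *\<^sub>R g t))"
    using anti by (intro Bochner_Integration.integral_cong) (auto simp: indicator_def)
  also have "\<dots> = - (LINT t|lborel. indicator {0..<1/2} t *\<^sub>R g t)" by simp
  finally show ?thesis by (simp add: g_def)
qed

text \<open>
In the variable \<open>x = 2 t\<close> the function \<open>F\<close> has type \<open>2\<pi>\<close> and the sign has period 1. The periodization of
\<open>F\<close> is constant, and the sign has mean 0 over a period.
\<close>

theorem sgn_cos_orthogonal:
  assumes F: "entire_exp_type pi F" and int: "integrable lborel (\<lambda>x. F (of_real x))"
  shows "integrable lborel (\<lambda>x. of_real (sgn (cos (pi * x))) * F (of_real x))"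
    and "(LINT x|lborel. of_real (sgn (cos (pi * x))) * F (of_real x)) = 0"
proof -
  note [measurable] = entire_measurable_on_reals[OF F]
  show intS: "integrable lborel (\<lambda>x. of_real (sgn (cos (pi * x))) * F (of_real x))"
    by (rule Bochner_Integration.integrable_bound[OF int]) (auto simp: norm_mult sgn_if)
  define F2 where "F2 = (\<lambda>z. F (of_real 2 * z))"
  have F2: "entire_exp_type (2 * pi) F2"
    using entire_exp_type_affine[OF F, of 2 0] by (simp add: F2_def)
  have int2: "integrable lborel (\<lambda>x. F2 (of_real x))"
    using lborel_integrable_real_affine[OF int, of 2 0] by (simp add: F2_def)
  define C where "C = (LINT x|lborel. F2 (of_real x))"
  define M where "M = (LINT x|lborel. norm (F2 (of_real x)))"
  have M: "line_norm F2 0 \<le> ennreal M" "M \<ge> 0"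
    using line_norm_eq_integral[OF int2] by (auto simp: M_def)
  define B where "B = 2 * M * exp (2 * pi * (\<bar>Im 0\<bar> + 1))"
  define f where "f = (\<lambda>x::real. of_real (sgn (cos (pi * (2 * x)))) * F2 (of_real x))"
  have f_int: "integrable lborel f" and f_eq: "(LINT x|lborel. of_real (sgn (cos (pi * x))) * F (of_real x)) = 2 *\<^sub>R (LINT x|lborel. f x)"
    using lborel_integrable_real_affine[OF intS, of 2 0]
      lborel_integral_real_affine[of 2 "\<lambda>x. of_real (sgn (cos (pi * x))) * F (of_real x)" 0]
    by (auto simp: f_def F2_def)
  define P where "P = (\<lambda>(N::nat) (t::real). \<Sum>k\<in>{- int N..int N}. F2 (of_real t + of_int k))"
  have sumf: "(\<Sum>k\<in>{- int N..int N}. f (t + of_int k)) = of_real (sgn (cos (pi * (2 * t)))) * P N t" for N t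
  proof -
    have "cos (pi * (2 * (t + of_int k))) = cos (pi * (2 * t))" for k :: int
    proof -
      have "cos (pi * (2 * (t + of_int k))) = cos (pi * (2 * t) + 2 * pi * of_int k)" by (simp add: algebra_simps)
      also have "\<dots> = cos (pi * (2 * t))" by (simp only: cos_add cos_int_2pin sin_int_2pin mult_1_right mult_zero_right diff_zero)
      finally show ?thesis .
    qed
    then show ?thesis by (simp add: f_def P_def sum_distrib_left)
  qed
  have PB: "norm (P N t) \<le> B" for N t
    unfolding P_def B_def using sum_shifts_le[OF F2 _ M, of "{- int N..int N}" "of_real t"]
    by (intro order_trans[OF norm_sum]) auto
  have PC: "(\<lambda>N. P N t) \<longlonglongrightarrow> C" for t
    unfolding P_def C_def Poisson_summation_type_2pi[OF F2 int2, of t, symmetric]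
    by (rule symmetric_partial_sums_tendsto) (rule shifts_abs_summable[OF F2 _ int2], simp)
  have P_meas [measurable]: "P N \<in> borel_measurable borel" for N
  proof -
    note [measurable] = borel_measurable_continuous_onI[OF entire_exp_type_cont[OF F2]]
    show ?thesis unfolding P_def by measurable
  qed
  have "(\<lambda>N. LINT t|lborel. indicator {0..<1} t *\<^sub>R (of_real (sgn (cos (pi * (2 * t)))) * P N t)) \<longlonglongrightarrow>
        (LINT t|lborel. indicator {0..<1::real} t *\<^sub>R (of_real (sgn (cos (pi * (2 * t)))) * C))"
  proof (rule integral_dominated_convergence[where w = "\<lambda>t. indicator {0..<1::real} t * B"])
    show "integrable lborel (\<lambda>t. indicator {0..<1::real} t * B)" by (intro integrable_mult_left) simp
    show "AE t in lborel. (\<lambda>N. indicator {0..<1} t *\<^sub>R (of_real (sgn (cos (pi * (2 * t)))) * P N t)) \<longlonglongrightarrow>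
        indicator {0..<1::real} t *\<^sub>R (of_real (sgn (cos (pi * (2 * t)))) * C)"
      by (intro AE_I2 tendsto_intros PC)
    show "AE t in lborel. norm (indicator {0..<1::real} t *\<^sub>R (of_real (sgn (cos (pi * (2 * t)))) * P N t)) \<le> indicator {0..<1} t * B" for N
    proof (rule AE_I2)
      fix t :: real
      have "\<bar>sgn (cos (pi * (2 * t)))\<bar> * norm (P N t) \<le> 1 * B"
        using PB[of N t] by (intro mult_mono) (auto simp: sgn_if)
      then show "norm (indicator {0..<1::real} t *\<^sub>R (of_real (sgn (cos (pi * (2 * t)))) * P N t)) \<le> indicator {0..<1} t * B"
        by (auto simp: indicator_def norm_mult)
    qed
  qed measurable
  moreover have "(\<lambda>N. LINT t|lborel. indicator {0..<1} t *\<^sub>R (of_real (sgn (cos (pi * (2 * t)))) * P N t)) \<longlonglongrightarrow> (LINT t|lborel. f t)"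
    using integral_window_sums_tendsto[OF f_int] by (simp only: sumf)
  ultimately have "(LINT t|lborel. indicator {0..<1::real} t *\<^sub>R (of_real (sgn (cos (pi * (2 * t)))) * C)) = (LINT t|lborel. f t)"
    by (rule LIMSEQ_unique)
  hence "(LINT t|lborel. f t) = 0" unfolding integral_sgn_cos_period by (rule sym)
  then show "(LINT x|lborel. of_real (sgn (cos (pi * x))) * F (of_real x)) = 0" by (simp add: f_eq)
qed

text \<open>
To the left and to the right of a half-integer \<open>cos (\<pi> x)\<close> has opposite signs, and so has \<open>q\<close>.
\<close>

lemma value_0_at_alternating_sign:
  fixes q :: "real \<Rightarrow> real"
  assumes sgn: "\<And>x. x \<noteq> 0 \<Longrightarrow> 0 \<le> cos (pi * x) * q x"
    and a: "a = of_int m + 1 / 2" and cont: "isCont q a"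
  shows "q a = 0"
proof -
  define \<epsilon> where "\<epsilon> = sin (pi * a)"
  have c0: "cos (pi * a) = 0" unfolding a by (rule cos_pi_half_integer)
  have "\<epsilon>\<^sup>2 = 1" using sin_cos_squared_add[of "pi * a"] c0 by (simp add: \<epsilon>_def)
  hence \<epsilon>: "\<epsilon> = 1 \<or> \<epsilon> = - 1" by (simp add: power2_eq_1_iff)
  have a0: "a \<noteq> 0" unfolding a by (rule half_integer_nonzero)
  define r where "r = min \<bar>a\<bar> 1"
  have r: "r > 0" using a0 by (simp add: r_def)
  have sp: "sin (pi * t) > 0" if "0 < t" "t < r" for t
    using that by (intro sin_gt_zero) (auto simp: r_def)
  have 1: "0 \<le> - \<epsilon> * q (a + t)" and 2: "0 \<le> \<epsilon> * q (a - t)" if t: "0 < t" "t < r" for t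
  proof -
    have nz: "a + t \<noteq> 0" "a - t \<noteq> 0" using t by (auto simp: r_def)
    have "cos (pi * (a + t)) = - \<epsilon> * sin (pi * t)" "cos (pi * (a - t)) = \<epsilon> * sin (pi * t)"
      by (simp_all add: distrib_left right_diff_distrib cos_add cos_diff c0 \<epsilon>_def)
    with sgn[OF nz(1)] sgn[OF nz(2)]
    have "0 \<le> sin (pi * t) * (- \<epsilon> * q (a + t))" "0 \<le> sin (pi * t) * (\<epsilon> * q (a - t))"
      by (simp_all add: mult_ac)
    moreover have "0 \<le> u" if "0 \<le> sin (pi * t) * u" for u
      using mult_le_cancel_left_pos[OF sp[OF t], of 0 u] that by simp
    ultimately show "0 \<le> - \<epsilon> * q (a + t)" "0 \<le> \<epsilon> * q (a - t)" by blast+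
  qed
  have ev: "\<forall>\<^sub>F t in at_right 0. 0 < t \<and> t < r"
    using r by (auto simp: eventually_at_right_field)
  have l1: "((\<lambda>t. q (a + t)) \<longlongrightarrow> q (a + 0)) (at_right 0)" and l2: "((\<lambda>t. q (a - t)) \<longlongrightarrow> q (a - 0)) (at_right 0)"
    using cont by (intro isCont_tendsto_compose[of _ q] tendsto_intros; simp)+
  have ev1: "\<forall>\<^sub>F t in at_right 0. 0 \<le> - \<epsilon> * q (a + t)"
    using ev by (rule eventually_mono) (use 1 in blast)
  have ev2: "\<forall>\<^sub>F t in at_right 0. 0 \<le> \<epsilon> * q (a - t)"
    using ev by (rule eventually_mono) (use 2 in blast)
  have "0 \<le> - \<epsilon> * q (a + 0)"
    by (rule tendsto_lowerbound[OF tendsto_mult[OF tendsto_const l1] ev1]) simp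
  moreover have "0 \<le> \<epsilon> * q (a - 0)"
    by (rule tendsto_lowerbound[OF tendsto_mult[OF tendsto_const l2] ev2]) simp
  ultimately show ?thesis using \<epsilon> by auto
qed

text \<open>
The integral of \<open>sgn (cos (\<pi> x)) (H - G)\<close> does not depend on \<open>G\<close>; for \<open>G = L\<close> it is the distance itself,
for any other \<open>G\<close> it is at most the distance. Equality forces \<open>sgn (cos (\<pi> x)) (H - G)\<close> to be real
and nonnegative almost everywhere, hence by continuity off the origin, so \<open>G\<close> interpolates as well.
The simple zeros of \<open>L - G\<close> are double zeros of its square, which has type \<open>2\<pi>\<close>.
\<close>

lemma best_approximation_optimality:
  assumes L: "entire_exp_type pi L" "l1_dist L (h n) < \<infinity>" "\<And>x::real. L (of_real x) \<in> \<real>"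
    and L_sgn: "\<And>x. x \<noteq> 0 \<Longrightarrow> 0 \<le> sgn (cos (pi * x)) * (log_monomial n x - Re (L (of_real x)))"
    and L_eq: "\<And>m::int. Re (L (of_real (of_int m + 1 / 2))) = log_monomial n (of_int m + 1 / 2)"
    and G: "entire_exp_type pi G"
  shows "l1_dist L (h n) \<le> l1_dist G (h n)"
    and "l1_dist G (h n) = l1_dist L (h n) \<Longrightarrow> G = L"
proof -
  have main: "l1_dist L (h n) \<le> l1_dist G (h n) \<and> (l1_dist G (h n) = l1_dist L (h n) \<longrightarrow> G = L)"
    if fin: "l1_dist G (h n) < \<infinity>"
  proof -
    define \<sigma> where "\<sigma> = (\<lambda>x::real. sgn (cos (pi * x)))"
    have \<sigma>1: "\<bar>\<sigma> x\<bar> \<le> 1" for x by (simp add: \<sigma>_def sgn_if)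
    define D where "D = (\<lambda>z. L z - G z)"
    have D: "entire_exp_type pi D" unfolding D_def by (rule entire_exp_type_diff[OF L(1) G])
    have Dint: "integrable lborel (\<lambda>x. D (of_real x))"
      unfolding D_def by (rule integrable_diff_of_approximants[OF L(1,2) G fin])
    define e where "e = (\<lambda>(F :: complex \<Rightarrow> complex) x. of_real (\<sigma> x) * (of_real (log_monomial n x) - F (of_real x)))"
    have e_int: "integrable lborel (e F)" and e_le: "norm (e F x) \<le> norm (F (of_real x) - of_real (log_monomial n x))"
      if F: "entire_exp_type pi F" "l1_dist F (h n) < \<infinity>" for F x
    proof -
      note entire_measurable_on_reals[OF F(1), measurable]
      have le: "norm (e F x) \<le> norm (F (of_real x) - of_real (log_monomial n x))" for x
        using \<sigma>1[of x] unfolding e_def norm_mult norm_of_real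
        by (subst norm_minus_commute) (intro mult_left_le_one_le, auto)
      then show "norm (e F x) \<le> norm (F (of_real x) - of_real (log_monomial n x))" .
      show "integrable lborel (e F)"
      proof (rule Bochner_Integration.integrable_bound[OF finite_l1_dist_integrable[OF F]])
        show "e F \<in> borel_measurable lborel" unfolding e_def \<sigma>_def by measurable
      qed (use le in auto)
    qed
    have eG_eq: "(LINT x|lborel. e G x) = (LINT x|lborel. e L x)"
    proof -
      have "e G = (\<lambda>x. e L x + of_real (sgn (cos (pi * x))) * D (of_real x))"
        by (simp add: fun_eq_iff e_def D_def \<sigma>_def algebra_simps)
      then show ?thesis
        using e_int[OF L(1,2)] sgn_cos_orthogonal[OF D Dint] by simp
    qed
    have eL: "e L x = of_real (norm (L (of_real x) - of_real (log_monomial n x)))" if "x \<noteq> 0" for x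
    proof -
      have "L (of_real x) = of_real (Re (L (of_real x)))" using L(3)[of x] by (simp add: of_real_Re)
      hence 1: "e L x = of_real (\<sigma> x * (log_monomial n x - Re (L (of_real x))))"
        and 2: "norm (L (of_real x) - of_real (log_monomial n x)) = \<bar>log_monomial n x - Re (L (of_real x))\<bar>"
        unfolding e_def by (metis of_real_diff of_real_mult, metis norm_of_real of_real_diff abs_minus_commute)
      have "\<sigma> x * (log_monomial n x - Re (L (of_real x))) = \<bar>log_monomial n x - Re (L (of_real x))\<bar>"
      proof (cases "\<sigma> x = 0")
        case True
        hence "cos (pi * x) = 0" by (simp add: \<sigma>_def sgn_zero_iff)
        then obtain m :: int where "odd m" "pi * x = of_int m * (pi / 2)" unfolding cos_zero_iff_int by auto
        then obtain k :: int where "m = 2 * k + 1" "x = of_int m / 2" by (auto elim!: oddE simp: field_simps)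
        hence "x = of_int k + 1 / 2" by (simp add: field_simps)
        then show ?thesis using L_eq[of k] by simp
      next
        case False
        hence "\<sigma> x = 1 \<or> \<sigma> x = - 1" by (auto simp: \<sigma>_def sgn_if)
        moreover have "0 \<le> \<sigma> x * (log_monomial n x - Re (L (of_real x)))"
          unfolding \<sigma>_def by (rule L_sgn[OF that])
        ultimately show ?thesis by auto
      qed
      then show ?thesis unfolding 1 2 by simp
    qed
    define V where "V = (LINT x|lborel. norm (L (of_real x) - of_real (log_monomial n x)))"
    have nint: "integrable lborel (\<lambda>x. norm (F (of_real x) - of_real (log_monomial n x)))"
      and ndist: "l1_dist F (h n) = ennreal (LINT x|lborel. norm (F (of_real x) - of_real (log_monomial n x)))"
      if F: "entire_exp_type pi F" "l1_dist F (h n) < \<infinity>" for F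
    proof -
      show int: "integrable lborel (\<lambda>x. norm (F (of_real x) - of_real (log_monomial n x)))"
        by (intro integrable_norm finite_l1_dist_integrable[OF F])
      show "l1_dist F (h n) = ennreal (LINT x|lborel. norm (F (of_real x) - of_real (log_monomial n x)))"
        unfolding l1_dist_h by (rule nn_integral_eq_integral[OF int]) simp
    qed
    have IL: "(LINT x|lborel. e L x) = of_real V"
    proof -
      note entire_measurable_on_reals[OF L(1), measurable]
      have "(LINT x|lborel. e L x) = (LINT x|lborel. complex_of_real (norm (L (of_real x) - of_real (log_monomial n x))))"
      proof (rule integral_cong_AE)
        show "e L \<in> borel_measurable lborel" using e_int[OF L(1,2)] by auto
        show "AE x in lborel. e L x = complex_of_real (norm (L (of_real x) - of_real (log_monomial n x)))"
          by (rule AE_mp[OF AE_lborel_singleton[of 0]]) (use eL in auto)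
      qed measurable
      then show ?thesis by (simp only: integral_complex_of_real V_def)
    qed
    define W where "W = (LINT x|lborel. norm (G (of_real x) - of_real (log_monomial n x)))"
    have ReG: "(LINT x|lborel. Re (e G x)) = V"
      using eG_eq IL by (simp add: integral_Re[OF e_int[OF G fin]])
    have Re_int: "integrable lborel (\<lambda>x. Re (e G x))" by (intro integrable_Re e_int G fin)
    have Re_le: "Re (e G x) \<le> norm (G (of_real x) - of_real (log_monomial n x))" for x
      using complex_Re_le_cmod[of "e G x"] e_le[OF G fin, of x] by linarith
    have VW: "V \<le> W" unfolding ReG[symmetric] W_def by (intro integral_mono Re_int nint G fin Re_le)
    have "l1_dist L (h n) \<le> l1_dist G (h n)"
      unfolding ndist[OF L(1,2)] ndist[OF G fin] using VW by (intro ennreal_leI) (simp add: V_def W_def)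
    moreover have "G = L" if eq: "l1_dist G (h n) = l1_dist L (h n)"
    proof -
      have "W = V"
        using eq unfolding ndist[OF L(1,2)] ndist[OF G fin] V_def[symmetric] W_def[symmetric]
        by (subst (asm) ennreal_inj) (auto simp: V_def W_def intro!: integral_nonneg_AE)
      hence "(LINT x|lborel. norm (G (of_real x) - of_real (log_monomial n x)) - Re (e G x)) = 0"
        using ReG nint[OF G fin] Re_int by (simp add: W_def)
      hence ae: "AE x in lborel. norm (G (of_real x) - of_real (log_monomial n x)) - Re (e G x) = 0"
        using Re_le by (subst (asm) integral_nonneg_eq_0_iff_AE)
          (auto intro!: Bochner_Integration.integrable_diff nint G fin Re_int)
      have pt: "Im (G (of_real x)) = 0 \<and> 0 \<le> cos (pi * x) * (log_monomial n x - Re (G (of_real x)))"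
        if x: "norm (G (of_real x) - of_real (log_monomial n x)) - Re (e G x) = 0" for x :: real
      proof -
        have n1: "norm (e G x) \<le> Re (e G x)" using e_le[OF G fin, of x] x by simp
        have I0: "Im (e G x) = 0"
        proof -
          have "(Re (e G x))\<^sup>2 + (Im (e G x))\<^sup>2 = (norm (e G x))\<^sup>2" by (simp add: cmod_power2)
          also have "\<dots> \<le> (Re (e G x))\<^sup>2" using n1 by (intro power_mono) auto
          finally have "(Im (e G x))\<^sup>2 \<le> 0" by simp
          then show ?thesis by simp
        qed
        have R0: "Re (e G x) \<ge> 0" using n1 norm_ge_zero[of "e G x"] by linarith
        have Im: "Im (e G x) = - \<sigma> x * Im (G (of_real x))" and Re: "Re (e G x) = \<sigma> x * (log_monomial n x - Re (G (of_real x)))"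
          by (simp_all add: e_def)
        have "Im (G (of_real x)) = 0"
        proof (cases "\<sigma> x = 0")
          case True
          hence "norm (G (of_real x) - of_real (log_monomial n x)) = 0" using x Re by simp
          then show ?thesis by (metis Im_complex_of_real eq_iff_diff_eq_0 norm_eq_zero)
        next
          case False then show ?thesis using I0 Im by simp
        qed
        moreover have "cos (pi * x) * (log_monomial n x - Re (G (of_real x))) = \<bar>cos (pi * x)\<bar> * Re (e G x)"
          unfolding Re \<sigma>_def by (simp add: abs_sgn mult_ac sgn_mult_self_eq)
            (metis (no_types, opaque_lifting) mult.left_commute mult_sgn_abs sgn_mult_abs abs_mult_sgn)
        ultimately show ?thesis using R0 by simp
      qed
      have ae': "AE x in lborel. Im (G (of_real x)) = 0 \<and> 0 \<le> cos (pi * x) * (log_monomial n x - Re (G (of_real x)))"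
        using ae by (rule eventually_mono) (rule pt)
      have contG: "isCont (\<lambda>x. G (of_real x)) (x::real)" for x
        using continuous_on_line[OF entire_exp_type_cont[OF G], of UNIV 0] by (simp add: continuous_on_eq_continuous_at)
      have contH: "isCont (log_monomial n) x" if "x \<noteq> 0" for x
        using log_monomial_differentiable[OF that] by (rule differentiable_imp_continuous_within)
      have ImG: "Im (G (of_real x)) = 0" for x :: real
      proof -
        have p: "AE x in lborel. 0 \<le> Im (G (of_real x))" and m: "AE x in lborel. 0 \<le> - Im (G (of_real x))"
          using ae' by (auto elim!: eventually_mono)
        have c: "isCont (\<lambda>x. Im (G (of_real x))) x" by (rule isCont_Im[OF contG])
        show ?thesis
          using AE_nonneg_imp_nonneg_at_continuity_point[OF p c]
            AE_nonneg_imp_nonneg_at_continuity_point[OF m isCont_minus[OF c]] by simp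
      qed
      define q where "q = (\<lambda>x. log_monomial n x - Re (G (of_real x)))"
      have contq: "isCont q x" if "x \<noteq> 0" for x
        unfolding q_def by (intro isCont_diff isCont_Re contH contG that)
      have q_sgn: "0 \<le> cos (pi * x) * q x" if "x \<noteq> 0" for x
      proof (rule AE_nonneg_imp_nonneg_at_continuity_point[where f = "\<lambda>x. cos (pi * x) * q x"])
        show "AE x in lborel. 0 \<le> cos (pi * x) * q x"
          using ae' by (auto elim!: eventually_mono simp: q_def)
        have "isCont (\<lambda>x. cos (pi * x)) x" by (intro continuous_intros)
        then show "isCont (\<lambda>x. cos (pi * x) * q x) x" by (rule isCont_mult[OF _ contq[OF that]])
      qed
      have D0: "D (of_real (1 / 2 + of_int m)) = 0" for m :: int
      proof -
        define a where "a = of_int m + (1 / 2 :: real)"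
        have a0: "a \<noteq> 0" unfolding a_def by (rule half_integer_nonzero)
        have "q a = 0" by (rule value_0_at_alternating_sign[OF q_sgn a_def contq[OF a0]])
        hence "Re (G (of_real a)) = Re (L (of_real a))" using L_eq[of m] by (simp add: q_def a_def)
        moreover have "Im (L (of_real a)) = 0" using L(3)[of a] by (simp add: complex_is_Real_iff)
        ultimately have "D (of_real a) = 0" using ImG[of a] by (simp add: D_def complex_eq_iff)
        then show ?thesis by (simp add: a_def add.commute)
      qed
      have "D z * D z = 0" for z
      proof (rule double_zeros_at_shifted_integers_imp_zero[where F = "\<lambda>z. D z * D z" and a = "1 / 2"])
        show "entire_exp_type (2 * pi) (\<lambda>z. D z * D z)" using entire_exp_type_mult[OF D D] by simp
        define M where "M = (LINT x|lborel. norm (D (of_real x)))"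
        have M: "line_norm D 0 \<le> ennreal M" "M \<ge> 0"
          using line_norm_eq_integral[OF Dint] by (auto simp: M_def)
        define B where "B = 2 * M * exp (pi * (\<bar>Im 0\<bar> + 1))"
        have DB: "norm (D (of_real x)) \<le> B" for x :: real
          using sum_shifts_le[OF D _ M, of "{0}" "of_real x"] by (simp add: B_def)
        show "integrable lborel (\<lambda>x. D (of_real x) * D (of_real x))"
        proof (rule Bochner_Integration.integrable_bound[OF integrable_mult_right[OF integrable_norm[OF Dint], of B]])
          note entire_measurable_on_reals[OF D, measurable]
          show "(\<lambda>x. D (of_real x) * D (of_real x)) \<in> borel_measurable lborel" by measurable
          show "AE x in lborel. norm (D (of_real x) * D (of_real x)) \<le> norm (B * norm (D (of_real x)))"
            using DB by (intro AE_I2) (auto simp: norm_mult abs_mult intro!: mult_right_mono order_trans[OF DB abs_ge_self])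
        qed
        fix k :: int
        show "D (of_real (1 / 2 + of_int k)) * D (of_real (1 / 2 + of_int k)) = 0" using D0[of k] by simp
        have "(D has_field_derivative deriv D (of_real (1 / 2 + of_int k))) (at (of_real (1 / 2 + of_int k)))"
          using entire_exp_typeD(1)[OF D] by (simp add: holomorphic_derivI)
        from DERIV_mult[OF this this] show "deriv (\<lambda>z. D z * D z) (of_real (1 / 2 + of_int k)) = 0"
          unfolding D0 by (auto dest!: DERIV_imp_deriv)
      qed
      then show "G = L" by (simp add: D_def fun_eq_iff)
    qed
    ultimately show ?thesis by blast
  qed
  show "l1_dist L (h n) \<le> l1_dist G (h n)"
    using main by (cases "l1_dist G (h n) = \<infinity>") (auto simp: less_top)
  show "l1_dist G (h n) = l1_dist L (h n) \<Longrightarrow> G = L"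
    using main L(2) by auto
qed

section \<open>The extremal functions\<close>

lemma h_measurable [measurable]: "h n \<in> borel_measurable borel"
  unfolding h_def[abs_def] by measurable

context interpolation_kernel
begin

lemma interpolant_real:
  assumes E: "entire_exp_type c E" "\<And>x. x \<noteq> 0 \<Longrightarrow> E (of_real x) = of_real (H x - (cos (c * x) + b) * J x)"
  shows "E (of_real x) \<in> \<real>"
proof -
  have cont: "isCont (\<lambda>x. E (of_real x)) x"
    using continuous_on_line[OF entire_exp_type_cont[OF E(1)], of UNIV 0] by (simp add: continuous_on_eq_continuous_at)
  have c: "isCont (\<lambda>x. Im (E (of_real x))) x" by (rule isCont_Im[OF cont])
  have "AE x in lborel. Im (E (of_real x)) = 0"
    by (rule AE_mp[OF AE_lborel_singleton[of 0]]) (simp add: E(2))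
  hence p: "AE x in lborel. 0 \<le> Im (E (of_real x))" and m: "AE x in lborel. 0 \<le> - Im (E (of_real x))"
    by (auto elim!: eventually_mono)
  show ?thesis
    using AE_nonneg_imp_nonneg_at_continuity_point[OF p c]
      AE_nonneg_imp_nonneg_at_continuity_point[OF m isCont_minus[OF c]] by (simp add: complex_is_Real_iff)
qed

lemma interpolant_l1_dist:
  assumes E: "\<And>x. x \<noteq> 0 \<Longrightarrow> E (of_real x) = of_real (H x - (cos (c * x) + b) * J x)"
  shows "l1_dist E (h n) = (\<integral>\<^sup>+ x. ennreal (\<bar>cos (c * x) + b\<bar> * J x) \<partial>lborel)"
  unfolding l1_dist_h
proof (rule nn_integral_cong_AE, rule AE_mp[OF AE_lborel_singleton[of 0]], rule AE_I2, rule impI)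
  fix x :: real assume x: "x \<noteq> 0"
  have "E (of_real x) - of_real (H x) = of_real (- ((cos (c * x) + b) * J x))" by (simp add: E[OF x])
  hence "norm (E (of_real x) - of_real (H x)) = \<bar>cos (c * x) + b\<bar> * J x"
    using J_nonneg[of x] by (simp only: norm_of_real) (simp add: abs_mult)
  then show "ennreal (norm (E (of_real x) - of_real (H x))) = ennreal (\<bar>cos (c * x) + b\<bar> * J x)" by simp
qed

lemma interpolant_side_at_0:
  fixes s :: real
  assumes E: "entire_exp_type c E" and n: "n > 0"
    and side: "\<And>x. x \<noteq> 0 \<Longrightarrow> \<bar>x\<bar> < 1 / 2 \<Longrightarrow> 0 \<le> s * (H x - Re (E (of_real x)))"
  shows "0 \<le> s * (H 0 - Re (E 0))"
proof -
  have cont: "isCont (\<lambda>x. E (of_real x)) (0::real)"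
    using continuous_on_line[OF entire_exp_type_cont[OF E], of UNIV 0] by (simp add: continuous_on_eq_continuous_at)
  have "isCont H 0" using log_monomial_at_0[OF n] by (rule differentiable_imp_continuous_within)
  hence "isCont (\<lambda>x. s * (H x - Re (E (of_real x)))) 0"
    by (intro isCont_mult isCont_diff continuous_const isCont_Re cont)
  hence "((\<lambda>x. s * (H x - Re (E (of_real x)))) \<longlongrightarrow> s * (H 0 - Re (E (of_real 0)))) (at 0)"
    by (rule isContD)
  moreover have "\<forall>\<^sub>F x in at 0. 0 \<le> s * (H x - Re (E (of_real x)))"
    unfolding eventually_at by (intro exI[of _ "1 / 2"]) (use side in auto)
  ultimately have "0 \<le> s * (H 0 - Re (E (of_real 0)))"
    by (rule tendsto_lowerbound) simp
  then show ?thesis by simp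
qed

text \<open>
Needed for the majorant, where \<open>J\<close> may be unbounded at 0 and only the double zero of
\<open>1 - cos (2\<pi>x)\<close> makes the error vanish there.
\<close>

lemma x_squared_J_tendsto_0: "(\<lambda>N. (1 / (real N + 1))\<^sup>2 * J (1 / (real N + 1))) \<longlonglongrightarrow> 0"
proof -
  define x where "x = (\<lambda>N::nat. 1 / (real N + 1))"
  have x0: "x N > 0" for N by (simp add: x_def)
  have x_lim: "x \<longlonglongrightarrow> 0" unfolding x_def by real_asymp
  have "(\<lambda>N. LINT y|lborel. (x N)\<^sup>2 * (indicator {0<..} y * (w y / ((x N)\<^sup>2 + y\<^sup>2)))) \<longlonglongrightarrow> (LINT y|(lborel :: real measure). (0::real))"
  proof (rule integral_dominated_convergence[where w = "\<lambda>y. indicator {0<..} y * w y"])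
    show "AE y in lborel. (\<lambda>N. (x N)\<^sup>2 * (indicator {0<..} y * (w y / ((x N)\<^sup>2 + y\<^sup>2)))) \<longlonglongrightarrow> 0"
    proof (rule AE_I2)
      fix y :: real
      show "(\<lambda>N. (x N)\<^sup>2 * (indicator {0<..} y * (w y / ((x N)\<^sup>2 + y\<^sup>2)))) \<longlonglongrightarrow> 0"
      proof (cases "y > 0")
        case True
        have "(\<lambda>N. (x N)\<^sup>2 * (w y / ((x N)\<^sup>2 + y\<^sup>2))) \<longlonglongrightarrow> 0\<^sup>2 * (w y / (0\<^sup>2 + y\<^sup>2))"
          using True by (intro tendsto_intros x_lim) auto
        then show ?thesis using True by simp
      qed simp
    qed
    show "AE y in lborel. norm ((x N)\<^sup>2 * (indicator {0<..} y * (w y / ((x N)\<^sup>2 + y\<^sup>2)))) \<le> indicator {0<..} y * w y" for N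
    proof (rule AE_I2)
      fix y :: real
      show "norm ((x N)\<^sup>2 * (indicator {0<..} y * (w y / ((x N)\<^sup>2 + y\<^sup>2)))) \<le> indicator {0<..} y * w y"
      proof (cases "y > 0")
        case True
        have q: "(x N)\<^sup>2 + y\<^sup>2 > 0" using True by (simp add: add_nonneg_pos)
        have "(x N)\<^sup>2 * w y \<le> ((x N)\<^sup>2 + y\<^sup>2) * w y" using w_nonneg[of y] True by (intro mult_right_mono) auto
        hence "(x N)\<^sup>2 * (w y / ((x N)\<^sup>2 + y\<^sup>2)) \<le> w y" using q by (simp add: field_simps)
        moreover have "0 \<le> (x N)\<^sup>2 * (w y / ((x N)\<^sup>2 + y\<^sup>2))" using q w_nonneg[of y] True by simp
        ultimately show ?thesis using True by simp
      qed simp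
    qed
  qed (use w_integrable in auto)
  hence "(\<lambda>N. (x N)\<^sup>2 * J (x N)) \<longlonglongrightarrow> 0"
    unfolding J_def by (simp only: integral_mult_right_zero Bochner_Integration.integral_zero)
  then show ?thesis by (simp only: x_def)
qed

end

lemma kernel_instances:
  "interpolation_kernel n (2 * pi) 1" "n > 0 \<Longrightarrow> interpolation_kernel n (2 * pi) (- 1)" "interpolation_kernel n pi 0"
  by (unfold_locales, auto)

lemma cos_2pi_half_integer: "cos (2 * pi * (1 / 2 + of_int k)) = - 1"
proof -
  have "cos (2 * pi * (1 / 2 + of_int k)) = cos (2 * pi * of_int k + pi)" by (simp add: algebra_simps)
  also have "\<dots> = - cos (2 * pi * of_int k)" by simp
  finally show ?thesis by (simp only: cos_int_2pin)
qed

lemma has_bochner_integral_gap: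
  fixes s V :: real
  assumes E: "entire_exp_type \<tau> E" and side: "\<And>x. x \<noteq> 0 \<Longrightarrow> 0 \<le> s * (log_monomial n x - Re (E (of_real x)))"
    and real: "\<And>x::real. E (of_real x) \<in> \<real>" and s: "\<bar>s\<bar> = 1" and V: "l1_dist E (h n) = ennreal V" "0 \<le> V"
  shows "has_bochner_integral lborel (\<lambda>x. s * (log_monomial n x - Re (E (of_real x)))) V"
proof (rule has_bochner_integral_nn_integral)
  note entire_measurable_on_reals[OF E, measurable]
  show "(\<lambda>x. s * (log_monomial n x - Re (E (of_real x)))) \<in> borel_measurable lborel" by measurable
  show ae: "AE x in lborel. 0 \<le> s * (log_monomial n x - Re (E (of_real x)))"
    by (rule AE_mp[OF AE_lborel_singleton[of 0]]) (use side in auto)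
  have "(\<integral>\<^sup>+ x. ennreal (s * (log_monomial n x - Re (E (of_real x)))) \<partial>lborel) = l1_dist E (h n)"
    unfolding l1_dist_h
  proof (rule nn_integral_cong_AE, use ae in eventually_elim)
    fix x assume x: "0 \<le> s * (log_monomial n x - Re (E (of_real x)))"
    have "E (of_real x) - of_real (log_monomial n x) = of_real (Re (E (of_real x)) - log_monomial n x)"
      using real[of x] by (simp add: of_real_Re)
    hence "norm (E (of_real x) - of_real (log_monomial n x)) = \<bar>log_monomial n x - Re (E (of_real x))\<bar>"
      by (simp only: norm_of_real abs_minus_commute)
    also have "\<dots> = \<bar>s * (log_monomial n x - Re (E (of_real x)))\<bar>" using s by (simp add: abs_mult)
    finally show "ennreal (s * (log_monomial n x - Re (E (of_real x)))) = ennreal (norm (E (of_real x) - of_real (log_monomial n x)))"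
      using x by simp
  qed
  then show "(\<integral>\<^sup>+ x. ennreal (s * (log_monomial n x - Re (E (of_real x)))) \<partial>lborel) = ennreal V" using V by simp
qed (rule V)

lemma extremal_minorant_solution:
  obtains E where "extremal_minorant (2 * pi) (h n) E"
    and "\<And>G. extremal_minorant (2 * pi) (h n) G \<Longrightarrow> G = E"
    and "interpolates_at E (h n) half_integers"
    and "has_bochner_integral lborel (\<lambda>x. real_of_ereal (h n x - ereal (Re (E (of_real x)))))
           (zeta_factor n * fact (2 * n) * (2 * pi) powi (- 2 * int n))"
proof -
  interpret interpolation_kernel n "2 * pi" 1 by (rule kernel_instances)
  define V where "V = zeta_factor n * fact (2 * n) * (2 * pi) powi (- 2 * int n)"
  note gap = nn_integral_minorant_gap[OF kernel_instances(1), of n, folded V_def]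
  obtain E where E: "entire_exp_type (2 * pi) E"
    "\<And>x. x \<noteq> 0 \<Longrightarrow> E (of_real x) = of_real (H x - (cos (2 * pi * x) + 1) * J x)"
    using interpolant_exists by blast
  have Ereal: "E (of_real x) \<in> \<real>" for x by (rule interpolant_real[OF E])
  have c1: "cos t + 1 \<ge> 0" for t :: real using cos_ge_minus_one[of t] by linarith
  have side: "0 \<le> 1 * (H x - Re (E (of_real x)))" if "x \<noteq> 0" for x
    using c1[of "2 * pi * x"] J_nonneg[of x] by (simp add: E(2)[OF that])
  have dist: "l1_dist E (h n) = ennreal V"
    using interpolant_l1_dist[of E] E(2) c1 gap(1) by simp
  have node: "Re (E (of_real (1 / 2 + of_int k))) = H (1 / 2 + of_int k)" for k :: int
  proof -
    have nz: "1 / 2 + of_int k \<noteq> (0 :: real)" using half_integer_nonzero[of k] by (simp only: add.commute) simp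
    have "Re (E (of_real (1 / 2 + of_int k))) = H (1 / 2 + of_int k) - (- 1 + 1) * J (1 / 2 + of_int k)"
      unfolding E(2)[OF nz] cos_2pi_half_integer by (rule Re_complex_of_real)
    then show ?thesis by simp
  qed
  \<comment> \<open>for \<open>n = 0\<close> the target is infinite at 0, so a minorant is unconstrained there\<close>
  have le_h: "ereal (Re (F (of_real x))) \<le> h n x \<longleftrightarrow> (x = 0 \<and> n = 0) \<or> 0 \<le> 1 * (H x - Re (F (of_real x)))" for F x
    by (cases "n = 0"; cases "x = 0") (simp_all add: h_pos_eq_log_monomial h_def[of 0] log_monomial_def[of 0])
  have minE: "minorant (2 * pi) (h n) E"
    unfolding minorant_def
  proof (intro conjI allI E(1) Ereal)
    fix x :: real
    show "ereal (Re (E (of_real x))) \<le> h n x"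
      unfolding le_h using side interpolant_side_at_0[OF E(1), of 1] by (cases "x = 0") auto
  qed
  have nz: "x \<noteq> 0" if "x \<in> {x. x \<noteq> 0 \<or> (\<exists>k::int. x = 1 / 2 + of_int k)}" for x :: real
  proof -
    from that consider "x \<noteq> 0" | k :: int where "x = 1 / 2 + of_int k" by blast
    then show ?thesis
    proof cases
      case 2
      then show ?thesis using half_integer_nonzero[of k] by (simp only: add.commute) simp
    qed
  qed
  have opt: "l1_dist E (h n) \<le> l1_dist G (h n)" "l1_dist G (h n) = l1_dist E (h n) \<Longrightarrow> G = E"
    if G: "minorant (2 * pi) (h n) G" for G
  proof -
    have G': "entire_exp_type (2 * pi) G" "\<And>x::real. G (of_real x) \<in> \<real>" using G by (auto simp: minorant_def)
    have Gside: "0 \<le> 1 * (H x - Re (G (of_real x)))" if "x \<in> {x. x \<noteq> 0 \<or> (\<exists>k::int. x = 1 / 2 + of_int k)}" for x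
    proof -
      have "x \<noteq> 0" using that by (rule nz)
      then show ?thesis using G le_h[of G x] by (auto simp: minorant_def)
    qed
    have Eside: "0 \<le> 1 * (H x - Re (E (of_real x)))" if "x \<in> {x. x \<noteq> 0 \<or> (\<exists>k::int. x = 1 / 2 + of_int k)}" for x
    proof -
      have "x \<noteq> 0" using that by (rule nz)
      then show ?thesis by (rule side)
    qed
    have fin: "l1_dist E (h n) < \<infinity>" by (simp add: dist)
    have diff: "H differentiable (at (1 / 2 + of_int k))" for k :: int
      by (rule log_monomial_differentiable, rule nz) blast
    note O = one_sided_optimality[of 1 E n "1 / 2" G, OF _ E(1) fin Ereal Eside node diff G' Gside]
    show "l1_dist E (h n) \<le> l1_dist G (h n)" by (rule O(1)) simp_all
    show "G = E" if "l1_dist G (h n) = l1_dist E (h n)" by (rule O(2)[OF _ _ _ that]) simp_all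
  qed
  show thesis
  proof (rule that[of E])
    show ext: "extremal_minorant (2 * pi) (h n) E" using minE opt by (auto simp: extremal_minorant_def)
    show "G = E" if "extremal_minorant (2 * pi) (h n) G" for G
      using that opt ext by (metis antisym extremal_minorant_def)
    show "interpolates_at E (h n) half_integers"
      unfolding interpolates_at_def half_integers_def
    proof (intro ballI conjI Ereal)
      fix x :: real assume "x \<in> (\<lambda>m. of_int m + 1 / 2) ` UNIV"
      then obtain k :: int where k: "x = of_int k + 1 / 2" by auto
      then show "ereal (Re (E (of_real x))) = h n x"
        using node[of k] half_integer_nonzero[of k] by (simp add: h_eq_log_monomial add.commute)
    qed
    have "has_bochner_integral lborel (\<lambda>x. 1 * (H x - Re (E (of_real x)))) V"
      by (rule has_bochner_integral_gap[OF E(1) side Ereal _ dist gap(2)]) simp_all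
    then show "has_bochner_integral lborel (\<lambda>x. real_of_ereal (h n x - ereal (Re (E (of_real x)))))
           (zeta_factor n * fact (2 * n) * (2 * pi) powi (- 2 * int n))"
      unfolding V_def[symmetric]
    proof (rule has_bochner_integralI_AE)
      note entire_measurable_on_reals[OF E(1), measurable]
      show "(\<lambda>x. real_of_ereal (h n x - ereal (Re (E (of_real x))))) \<in> borel_measurable lborel" by measurable
      show "AE x in lborel. 1 * (H x - Re (E (of_real x))) = real_of_ereal (h n x - ereal (Re (E (of_real x))))"
        by (rule AE_mp[OF AE_lborel_singleton[of 0]]) (auto simp: h_eq_log_monomial)
    qed
  qed
qed

lemma extremal_majorant_solution:
  assumes n: "n > 0"
  obtains E where "extremal_majorant (2 * pi) (h n) E"
    and "\<And>G. extremal_majorant (2 * pi) (h n) G \<Longrightarrow> G = E"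
    and "interpolates_at E (h n) \<int>"
    and "has_bochner_integral lborel (\<lambda>x. real_of_ereal (ereal (Re (E (of_real x))) - h n x))
           (2 * fact (2 * n) * (2 * pi) powi (- 2 * int n) * riemann_zeta (2 * real n + 1))"
proof -
  interpret interpolation_kernel n "2 * pi" "- 1" by (rule kernel_instances(2)[OF n])
  define V where "V = 2 * fact (2 * n) * (2 * pi) powi (- 2 * int n) * riemann_zeta (2 * real n + 1)"
  note gap = nn_integral_majorant_gap[OF kernel_instances(2)[OF n] n, folded V_def]
  obtain E where E: "entire_exp_type (2 * pi) E"
    "\<And>x. x \<noteq> 0 \<Longrightarrow> E (of_real x) = of_real (H x - (cos (2 * pi * x) + - 1) * J x)"
    using interpolant_exists by blast
  have Ereal: "E (of_real x) \<in> \<real>" for x by (rule interpolant_real[OF E])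
  have side0: "0 \<le> - 1 * (H x - Re (E (of_real x)))" if "x \<noteq> 0" for x
    using cos_le_one[of "2 * pi * x"] J_nonneg[of x] by (simp add: E(2)[OF that] mult_nonpos_nonneg)
  \<comment> \<open>the error formula holds off the origin, so the value at 0 is found by continuity\<close>
  have E0: "Re (E 0) = 0"
  proof -
    define x where "x = (\<lambda>N::nat. 1 / (real N + 1))"
    have x0: "x N \<noteq> 0" for N by (simp add: x_def)
    have x_lim: "x \<longlonglongrightarrow> 0" unfolding x_def by real_asymp
    have cH: "isCont H 0" using log_monomial_at_0[OF n] by (rule differentiable_imp_continuous_within)
    have cE: "isCont (\<lambda>x. E (of_real x)) (0::real)"
      using continuous_on_line[OF entire_exp_type_cont[OF E(1)], of UNIV 0] by (simp add: continuous_on_eq_continuous_at)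
    have l1: "(\<lambda>N. H (x N) - Re (E (of_real (x N)))) \<longlonglongrightarrow> H 0 - Re (E (of_real 0))"
      by (rule isCont_tendsto_compose[OF isCont_diff[OF cH isCont_Re[OF cE]] x_lim])
    have "(\<lambda>N. H (x N) - Re (E (of_real (x N)))) \<longlonglongrightarrow> 0"
    proof (rule Lim_null_comparison)
      show "(\<lambda>N. 2 * pi\<^sup>2 * ((x N)\<^sup>2 * J (x N))) \<longlonglongrightarrow> 0"
        using tendsto_mult_right_zero[OF x_squared_J_tendsto_0, of "2 * pi\<^sup>2"] by (simp add: x_def)
      show "\<forall>\<^sub>F N in sequentially. norm (H (x N) - Re (E (of_real (x N)))) \<le> 2 * pi\<^sup>2 * ((x N)\<^sup>2 * J (x N))"
      proof (intro always_eventually allI)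
        fix N
        have "1 - cos (2 * pi * x N) = 2 * (sin (pi * x N))\<^sup>2"
          using cos_double_sin[of "pi * x N"] by (simp add: mult.assoc)
        also have "\<dots> \<le> 2 * (pi * x N)\<^sup>2"
        proof -
          have "\<bar>sin (pi * x N)\<bar> \<le> \<bar>pi * x N\<bar>" by (rule abs_sin_x_le_abs_x)
          hence "(sin (pi * x N))\<^sup>2 \<le> (pi * x N)\<^sup>2" by (simp only: abs_le_square_iff)
          then show ?thesis by simp
        qed
        finally have "(1 - cos (2 * pi * x N)) * J (x N) \<le> 2 * (pi * x N)\<^sup>2 * J (x N)"
          using J_nonneg by (intro mult_right_mono) auto
        moreover have "H (x N) - Re (E (of_real (x N))) = - ((1 - cos (2 * pi * x N)) * J (x N))"
        proof -
          have "Re (E (of_real (x N))) = H (x N) - (cos (2 * pi * x N) + - 1) * J (x N)"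
            unfolding E(2)[OF x0[of N]] by (rule Re_complex_of_real)
          then show ?thesis by (simp add: algebra_simps)
        qed
        moreover have "0 \<le> (1 - cos (2 * pi * x N)) * J (x N)" using J_nonneg by simp
        ultimately show "norm (H (x N) - Re (E (of_real (x N)))) \<le> 2 * pi\<^sup>2 * ((x N)\<^sup>2 * J (x N))"
          by (simp add: power_mult_distrib mult_ac)
      qed
    qed
    from LIMSEQ_unique[OF l1 this] show ?thesis by (simp add: log_monomial_def)
  qed
  have side: "0 \<le> - 1 * (H x - Re (E (of_real x)))" for x
    using side0[of x] E0 by (cases "x = 0") (auto simp: log_monomial_def)
  have dist: "l1_dist E (h n) = ennreal V"
  proof -
    have "\<bar>cos (2 * pi * x) + - 1\<bar> = 1 - cos (2 * pi * x)" for x by simp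
    then show ?thesis using interpolant_l1_dist[of E] E(2) gap(1) by simp
  qed
  have node: "Re (E (of_real (0 + of_int k))) = H (0 + of_int k)" for k :: int
  proof (cases "k = 0")
    case True then show ?thesis using E0 by (simp add: log_monomial_def)
  next
    case False
    have "cos (2 * pi * of_int k) = 1" by (rule cos_int_2pin)
    then show ?thesis using E(2)[of "of_int k"] False by simp
  qed
  have h_le: "h n x \<le> ereal (Re (F (of_real x))) \<longleftrightarrow> 0 \<le> - 1 * (H x - Re (F (of_real x)))" for F x
    by (simp add: h_pos_eq_log_monomial[OF n])
  have majE: "majorant (2 * pi) (h n) E"
    unfolding majorant_def by (intro conjI allI E(1) Ereal) (simp only: h_le side)
  have opt: "l1_dist E (h n) \<le> l1_dist G (h n)" "l1_dist G (h n) = l1_dist E (h n) \<Longrightarrow> G = E"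
    if G: "majorant (2 * pi) (h n) G" for G
  proof -
    have G': "entire_exp_type (2 * pi) G" "\<And>x::real. G (of_real x) \<in> \<real>" using G by (auto simp: majorant_def)
    have Gside: "0 \<le> - 1 * (H x - Re (G (of_real x)))" for x
      using G h_le[of x G] by (auto simp: majorant_def)
    have fin: "l1_dist E (h n) < \<infinity>" by (simp add: dist)
    have diff: "H differentiable (at (0 + of_int k))" for k :: int
      using log_monomial_differentiable[of "of_int k" n] log_monomial_at_0[OF n] by (cases "k = 0") auto
    note O = one_sided_optimality[of "- 1" E n 0 G, OF _ E(1) fin Ereal side node diff G' Gside]
    show "l1_dist E (h n) \<le> l1_dist G (h n)" by (rule O(1)) simp
    show "G = E" if "l1_dist G (h n) = l1_dist E (h n)" by (rule O(2)[OF _ that]) simp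
  qed
  show thesis
  proof (rule that[of E])
    show ext: "extremal_majorant (2 * pi) (h n) E" using majE opt by (auto simp: extremal_majorant_def)
    show "G = E" if "extremal_majorant (2 * pi) (h n) G" for G
      using that opt ext by (metis antisym extremal_majorant_def)
    show "interpolates_at E (h n) \<int>"
      unfolding interpolates_at_def
    proof (intro ballI conjI Ereal)
      fix x :: real assume "x \<in> \<int>"
      then obtain k :: int where k: "x = of_int k" by (auto elim: Ints_cases)
      then show "ereal (Re (E (of_real x))) = h n x"
        using node[of k] by (simp add: h_pos_eq_log_monomial[OF n])
    qed
    have "has_bochner_integral lborel (\<lambda>x. - 1 * (H x - Re (E (of_real x)))) V"
      by (rule has_bochner_integral_gap[OF E(1) side Ereal _ dist gap(2)]) simp_all
    then show "has_bochner_integral lborel (\<lambda>x. real_of_ereal (ereal (Re (E (of_real x))) - h n x))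
           (2 * fact (2 * n) * (2 * pi) powi (- 2 * int n) * riemann_zeta (2 * real n + 1))"
      unfolding V_def[symmetric] by (simp add: h_pos_eq_log_monomial[OF n])
  qed
qed

lemma best_approximation_solution:
  obtains E where "best_approximation pi (h n) E"
    and "\<And>G. best_approximation pi (h n) G \<Longrightarrow> G = E"
    and "interpolates_at E (h n) half_integers"
    and "\<And>x::real. E (of_real x) \<in> \<real>"
    and "\<And>x::real. 0 \<le> ereal (sgn (cos (pi * x))) * (h n x - ereal (Re (E (of_real x))))"
    and "l1_dist E (h n) = ennreal
           (2 / pi * fact (2 * n) * (2 * pi) powi (- 2 * int n) *
            (2 ^ (2 + 2 * n) * L_chi (2 + 2 * real n)))"
proof -
  interpret interpolation_kernel n pi 0 by (rule kernel_instances)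
  note gap = nn_integral_best_approximation_gap[OF kernel_instances(3), of n]
  obtain E where E: "entire_exp_type pi E"
    "\<And>x. x \<noteq> 0 \<Longrightarrow> E (of_real x) = of_real (H x - (cos (pi * x) + 0) * J x)"
    using interpolant_exists by blast
  have Ereal: "E (of_real x) \<in> \<real>" for x by (rule interpolant_real[OF E])
  have side: "0 \<le> sgn (cos (pi * x)) * (H x - Re (E (of_real x)))" if "x \<noteq> 0" for x
  proof -
    have "sgn (cos (pi * x)) * (H x - Re (E (of_real x))) = \<bar>cos (pi * x)\<bar> * J x"
      by (simp add: E(2)[OF that] abs_sgn mult_ac)
    then show ?thesis using J_nonneg[of x] by simp
  qed
  have dist: "l1_dist E (h n) = ennreal
           (2 / pi * fact (2 * n) * (2 * pi) powi (- 2 * int n) * (2 ^ (2 + 2 * n) * L_chi (2 + 2 * real n)))"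
    using interpolant_l1_dist[of E] E(2) gap(1) by simp
  have node: "Re (E (of_real (of_int k + 1 / 2))) = H (of_int k + 1 / 2)" for k :: int
    using E(2)[OF half_integer_nonzero[of k]] by (simp only: cos_pi_half_integer) simp
  have fin: "l1_dist E (h n) < \<infinity>" by (simp add: dist)
  note O = best_approximation_optimality[OF E(1) fin Ereal side node]
  show thesis
  proof (rule that[of E])
    show ext: "best_approximation pi (h n) E" using E(1) O(1) by (auto simp: best_approximation_def)
    show "G = E" if "best_approximation pi (h n) G" for G
      using that O ext by (metis antisym best_approximation_def)
    show "interpolates_at E (h n) half_integers"
      unfolding interpolates_at_def half_integers_def
    proof (intro ballI conjI Ereal)
      fix x :: real assume "x \<in> (\<lambda>m. of_int m + 1 / 2) ` UNIV"
      then obtain k :: int where k: "x = of_int k + 1 / 2" by auto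
      then show "ereal (Re (E (of_real x))) = h n x"
        using node[of k] half_integer_nonzero[of k] by (simp add: h_eq_log_monomial)
    qed
    show "0 \<le> ereal (sgn (cos (pi * x))) * (h n x - ereal (Re (E (of_real x))))" for x
    proof (cases "x = 0")
      case False
      then show ?thesis using side[OF False] by (simp add: h_eq_log_monomial)
    next
      case True
      show ?thesis
      proof (cases "n = 0")
        case False
        hence n: "n > 0" by simp
        have "0 \<le> 1 * (H 0 - Re (E 0))"
        proof (rule interpolant_side_at_0[OF E(1) n])
          fix x :: real assume x: "x \<noteq> 0" "\<bar>x\<bar> < 1 / 2"
          have "cos (pi * x) > 0"
          proof (rule cos_gt_zero_pi)
            show "- (pi / 2) < pi * x" "pi * x < pi / 2"
              using x(2) mult_strict_left_mono[of "- (1 / 2)" x pi] mult_strict_left_mono[of x "1 / 2" pi]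
              by (auto simp: abs_less_iff)
          qed
          then show "0 \<le> 1 * (H x - Re (E (of_real x)))" using side[OF x(1)] by simp
        qed
        then show ?thesis using True by (simp add: h_pos_eq_log_monomial[OF n])
      qed (simp add: True h_def)
    qed
  qed (rule Ereal, rule dist)
qed

theorem corollary24:
  fixes n :: nat
  shows
    "((\<exists>!l. extremal_minorant (2 * pi) (h n) l) \<and>
      (\<forall>l. extremal_minorant (2 * pi) (h n) l \<longrightarrow>
         interpolates_at l (h n) half_integers \<and>
         has_bochner_integral lborel
           (\<lambda>x. real_of_ereal (h n x - ereal (Re (l (of_real x)))))
           (zeta_factor n * fact (2 * n) * (2 * pi) powi (- 2 * int n))))
     \<and>
     (n > 0 \<longrightarrow>
      (\<exists>!m. extremal_majorant (2 * pi) (h n) m) \<and>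
      (\<forall>m. extremal_majorant (2 * pi) (h n) m \<longrightarrow>
         interpolates_at m (h n) \<int> \<and>
         has_bochner_integral lborel
           (\<lambda>x. real_of_ereal (ereal (Re (m (of_real x))) - h n x))
           (2 * fact (2 * n) * (2 * pi) powi (- 2 * int n) * riemann_zeta (2 * real n + 1))))
     \<and>
     ((\<exists>!k. best_approximation pi (h n) k) \<and>
      (\<forall>k. best_approximation pi (h n) k \<longrightarrow>
         interpolates_at k (h n) half_integers \<and>
         (\<forall>x::real. k (of_real x) \<in> \<real> \<and>
            0 \<le> ereal (sgn (cos (pi * x))) * (h n x - ereal (Re (k (of_real x))))) \<and>
         l1_dist k (h n) = ennreal
           (2 / pi * fact (2 * n) * (2 * pi) powi (- 2 * int n) *
            (2 ^ (2 + 2 * n) * L_chi (2 + 2 * real n)))))"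
proof (intro conjI impI)
  obtain E where E: "extremal_minorant (2 * pi) (h n) E"
    "\<And>G. extremal_minorant (2 * pi) (h n) G \<Longrightarrow> G = E"
    "interpolates_at E (h n) half_integers"
    "has_bochner_integral lborel (\<lambda>x. real_of_ereal (h n x - ereal (Re (E (of_real x)))))
           (zeta_factor n * fact (2 * n) * (2 * pi) powi (- 2 * int n))"
    using extremal_minorant_solution[of n] by blast
  show "\<exists>!l. extremal_minorant (2 * pi) (h n) l" using E(1,2) by blast
  show "\<forall>l. extremal_minorant (2 * pi) (h n) l \<longrightarrow>
         interpolates_at l (h n) half_integers \<and>
         has_bochner_integral lborel
           (\<lambda>x. real_of_ereal (h n x - ereal (Re (l (of_real x)))))
           (zeta_factor n * fact (2 * n) * (2 * pi) powi (- 2 * int n))"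
    using E(2-4) by blast
next
  assume n: "n > 0"
  obtain E where E: "extremal_majorant (2 * pi) (h n) E"
    "\<And>G. extremal_majorant (2 * pi) (h n) G \<Longrightarrow> G = E"
    "interpolates_at E (h n) \<int>"
    "has_bochner_integral lborel (\<lambda>x. real_of_ereal (ereal (Re (E (of_real x))) - h n x))
           (2 * fact (2 * n) * (2 * pi) powi (- 2 * int n) * riemann_zeta (2 * real n + 1))"
    using extremal_majorant_solution[OF n] by blast
  show "\<exists>!m. extremal_majorant (2 * pi) (h n) m" using E(1,2) by blast
  show "\<forall>m. extremal_majorant (2 * pi) (h n) m \<longrightarrow>
         interpolates_at m (h n) \<int> \<and>
         has_bochner_integral lborel
           (\<lambda>x. real_of_ereal (ereal (Re (m (of_real x))) - h n x))
           (2 * fact (2 * n) * (2 * pi) powi (- 2 * int n) * riemann_zeta (2 * real n + 1))"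
    using E(2-4) by blast
next
  obtain E where E: "best_approximation pi (h n) E"
    "\<And>G. best_approximation pi (h n) G \<Longrightarrow> G = E"
    "interpolates_at E (h n) half_integers"
    "\<And>x::real. E (of_real x) \<in> \<real>"
    "\<And>x::real. 0 \<le> ereal (sgn (cos (pi * x))) * (h n x - ereal (Re (E (of_real x))))"
    "l1_dist E (h n) = ennreal
           (2 / pi * fact (2 * n) * (2 * pi) powi (- 2 * int n) *
            (2 ^ (2 + 2 * n) * L_chi (2 + 2 * real n)))"
    using best_approximation_solution[of n] by blast
  show "\<exists>!k. best_approximation pi (h n) k" using E(1,2) by blast
  show "\<forall>k. best_approximation pi (h n) k \<longrightarrow>
         interpolates_at k (h n) half_integers \<and>
         (\<forall>x::real. k (of_real x) \<in> \<real> \<and>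
            0 \<le> ereal (sgn (cos (pi * x))) * (h n x - ereal (Re (k (of_real x))))) \<and>
         l1_dist k (h n) = ennreal
           (2 / pi * fact (2 * n) * (2 * pi) powi (- 2 * int n) *
            (2 ^ (2 + 2 * n) * L_chi (2 + 2 * real n)))"
  proof (intro allI impI)
    fix k assume "best_approximation pi (h n) k"
    hence "k = E" by (rule E(2))
    then show "interpolates_at k (h n) half_integers \<and>
         (\<forall>x::real. k (of_real x) \<in> \<real> \<and>
            0 \<le> ereal (sgn (cos (pi * x))) * (h n x - ereal (Re (k (of_real x))))) \<and>
         l1_dist k (h n) = ennreal
           (2 / pi * fact (2 * n) * (2 * pi) powi (- 2 * int n) *
            (2 ^ (2 + 2 * n) * L_chi (2 + 2 * real n)))"
      using E(3-6) by simp
  qed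
qed

end
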